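(* Let $A$ be a commutative ring, $r,d\ge1$, $B=A[x_1,\dots,x_r]$. Let $\mathcal{C}\subseteq\{1,\dots,d\}\times\mathcal{M}^*$ be one of the two collections $$\mathcal{C}_1=\{(k,x^\alpha):\gcd(\alpha)\cdot1_A\text{ invertible},\ k\text{ a product of primes in }\mathcal{P}(A)\},\qquad \mathcal{C}_2=\{(k,x^\alpha):\gcd(\alpha)=1\},$$ and let $\widetilde{\mathcal{C}}$ be the set of $(k,x^\alpha)\in\mathcal{C}$ such that either $k|\alpha|\le d$ or $Q_p(k\alpha)\le Q_p(d)$ for some $p\in\mathcal{P}(A)$. Then the $A$-algebra $\Gamma^d_A(B)\cong\mathrm{TS}^d_A(B)$ is generated by the elements $\gamma^k(x^\alpha)\times\gamma^{d-k}(1)$, $(k,x^\alpha)\in\widetilde{\mathcal{C}}$, and this is a minimal set of generators (no proper subset generates).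
   Context: $\mathrm{TS}^d_A(B)=(B^{\otimes_A d})^{\mathfrak S_d}$ is the ring of multisymmetric functions (symmetric tensors, componentwise multiplication), canonically isomorphic to the divided power algebra $\Gamma^d_A(B)$. $\mathcal{M}^*$ is the set of non-constant monomials $x^\alpha$, $\alpha\in\mathbb{N}^r\setminus\{0\}$; $|\alpha|=\sum\alpha_i$. $\mathcal{P}(A)$ is the set of primes $p$ with $p\cdot1_A$ not invertible in $A$ (a product of primes includes $k=1$). For a monomial $f$, $\gamma^k(f)\times\gamma^{d-k}(1)=\sum_{S\subseteq\{1..d\},|S|=k}\bigotimes_j f_j$ with $f_j=f$ for $j\in S$, $f_j=1$ otherwise. For $n\in\mathbb{N}$, $Q_p(n)\in\mathbb{Z}[t]$ is $a_st^s+\dots+a_0$ where $a_s\dots a_0$ are the base-$p$ digits of $n$; for $\beta\in\mathbb{N}^r$, $Q_p(\beta)=\sum_iQ_p(\beta_i)$. For $P,Q\in\mathbb{Z}[t]$, $P>Q$ means $P(n)>Q(n)$ for all sufficiently large $n$, and $P\le Q$ means not $P>Q$. *)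

theory Defs
  imports "HOL-Library.Poly_Mapping" "HOL-Computational_Algebra.Computational_Algebra"
    "HOL-Combinatorics.Permutations"
begin

text \<open>The tensor power B^{\<otimes>d} with B = A[x_1..x_r] is identified with the polynomial ring
  A[x_{j,i} : j < d, i < r]; the variable (j,i) is x_{i+1} in the (j+1)-th tensor factor.
  Polynomials are finitely supported maps from monomials (finitely supported exponent maps
  on variable pairs) to coefficients, with the convolution product of Poly_Mapping.\<close>

type_synonym 'a tpoly = "((nat \<times> nat) \<Rightarrow>\<^sub>0 nat) \<Rightarrow>\<^sub>0 'a"

definition const_tp :: "'a::comm_ring_1 \<Rightarrow> 'a tpoly" where
  "const_tp a = Poly_Mapping.single 0 a"

inductive_set subalg :: "'a::comm_ring_1 tpoly set \<Rightarrow> 'a tpoly set" for S where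
  sa_const: "const_tp a \<in> subalg S"
| sa_gen: "s \<in> S \<Longrightarrow> s \<in> subalg S"
| sa_add: "p \<in> subalg S \<Longrightarrow> q \<in> subalg S \<Longrightarrow> p + q \<in> subalg S"
| sa_mult: "p \<in> subalg S \<Longrightarrow> q \<in> subalg S \<Longrightarrow> p * q \<in> subalg S"

definition perm_mono :: "(nat \<Rightarrow> nat) \<Rightarrow> ((nat \<times> nat) \<Rightarrow>\<^sub>0 nat) \<Rightarrow> ((nat \<times> nat) \<Rightarrow>\<^sub>0 nat)" where
  "perm_mono \<sigma> m = Poly_Mapping.map_key (\<lambda>(j, i). (\<sigma> j, i)) m"

definition TS :: "nat \<Rightarrow> nat \<Rightarrow> 'a::comm_ring_1 tpoly set" where
  "TS d r = {p. (\<forall>m \<in> Poly_Mapping.keys p. \<forall>v \<in> Poly_Mapping.keys m. fst v < d \<and> snd v < r)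
      \<and> (\<forall>\<sigma>. \<sigma> permutes {..<d} \<longrightarrow>
            (\<forall>m. Poly_Mapping.lookup p (perm_mono \<sigma> m) = Poly_Mapping.lookup p m))}"

definition multiidx :: "nat \<Rightarrow> (nat \<Rightarrow> nat) \<Rightarrow> bool" where
  "multiidx r \<alpha> \<longleftrightarrow> (\<forall>i\<ge>r. \<alpha> i = 0)"

definition nonconst :: "nat \<Rightarrow> (nat \<Rightarrow> nat) \<Rightarrow> bool" where
  "nonconst r \<alpha> \<longleftrightarrow> multiidx r \<alpha> \<and> (\<exists>i<r. \<alpha> i \<noteq> 0)"

definition absidx :: "nat \<Rightarrow> (nat \<Rightarrow> nat) \<Rightarrow> nat" where
  "absidx r \<alpha> = (\<Sum>i<r. \<alpha> i)"

definition gcdidx :: "nat \<Rightarrow> (nat \<Rightarrow> nat) \<Rightarrow> nat" where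
  "gcdidx r \<alpha> = Gcd (\<alpha> ` {..<r})"

definition tmono :: "nat \<Rightarrow> nat set \<Rightarrow> (nat \<Rightarrow> nat) \<Rightarrow> ((nat \<times> nat) \<Rightarrow>\<^sub>0 nat)" where
  "tmono r S \<alpha> = (\<Sum>j\<in>S. \<Sum>i<r. Poly_Mapping.single (j, i) (\<alpha> i))"

definition gamma_gen :: "nat \<Rightarrow> nat \<Rightarrow> nat \<Rightarrow> (nat \<Rightarrow> nat) \<Rightarrow> 'a::comm_ring_1 tpoly" where
  "gamma_gen d r k \<alpha> =
     (\<Sum>S\<in>{S. S \<subseteq> {..<d} \<and> card S = k}. Poly_Mapping.single (tmono r S \<alpha>) 1)"

definition invertible_el :: "'a::comm_ring_1 \<Rightarrow> bool" where
  "invertible_el x \<longleftrightarrow> (\<exists>y. x * y = 1)"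

definition PA :: "'a::comm_ring_1 itself \<Rightarrow> nat set" where
  "PA _ = {p. prime p \<and> \<not> invertible_el (of_nat p :: 'a)}"

definition prod_of_PA :: "'a::comm_ring_1 itself \<Rightarrow> nat \<Rightarrow> bool" where
  "prod_of_PA T k \<longleftrightarrow> (\<exists>M. (\<forall>p \<in># M. p \<in> PA T) \<and> k = prod_mset M)"

definition C1 :: "'a::comm_ring_1 itself \<Rightarrow> nat \<Rightarrow> nat \<Rightarrow> (nat \<times> (nat \<Rightarrow> nat)) set" where
  "C1 T d r = {(k, \<alpha>). k \<in> {1..d} \<and> nonconst r \<alpha>
      \<and> invertible_el (of_nat (gcdidx r \<alpha>) :: 'a) \<and> prod_of_PA T k}"

definition C2 :: "nat \<Rightarrow> nat \<Rightarrow> (nat \<times> (nat \<Rightarrow> nat)) set" where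
  "C2 d r = {(k, \<alpha>). k \<in> {1..d} \<and> nonconst r \<alpha> \<and> gcdidx r \<alpha> = 1}"

text \<open>Q_p(n): polynomial whose coefficients are the base-p digits of n
  (digits of index \<ge> n vanish since p \<ge> 2).\<close>
definition Qp :: "nat \<Rightarrow> nat \<Rightarrow> int poly" where
  "Qp p n = (\<Sum>s\<le>n. monom (int ((n div p ^ s) mod p)) s)"

definition Qp_idx :: "nat \<Rightarrow> nat \<Rightarrow> (nat \<Rightarrow> nat) \<Rightarrow> int poly" where
  "Qp_idx p r \<beta> = (\<Sum>i<r. Qp p (\<beta> i))"

definition poly_gt :: "int poly \<Rightarrow> int poly \<Rightarrow> bool" where
  "poly_gt P Q \<longleftrightarrow> (\<forall>\<^sub>F n in sequentially. poly P (int n) > poly Q (int n))"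

definition Ctilde :: "'a::comm_ring_1 itself \<Rightarrow> nat \<Rightarrow> nat \<Rightarrow> (nat \<times> (nat \<Rightarrow> nat)) set
    \<Rightarrow> (nat \<times> (nat \<Rightarrow> nat)) set" where
  "Ctilde T d r C = {(k, \<alpha>) \<in> C. k * absidx r \<alpha> \<le> d \<or>
      (\<exists>p \<in> PA T. \<not> poly_gt (Qp_idx p r (\<lambda>i. k * \<alpha> i)) (Qp p d))}"

end

theory Submission
  imports Defs "HOL-Combinatorics.Multiset_Permutations"
begin

text \<open>The orbit sums of monomials, indexed by multisets \<open>\<kappa>\<close> of non-zero exponent vectors with
  at most \<open>d\<close> elements, form a basis of the symmetric tensors. By grading, a set of homogeneous elements
  generates iff it generates the module of indecomposables in every degree \<open>\<beta> \<noteq> 0\<close>. Let \<open>b\<close> be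
  the gcd of the entries of \<open>\<beta>\<close>. With unboundedly many tensor factors, this module is free of rank one on the class
  of \<open>\<gamma>\<^sup>b(x\<^sup>\<alpha>)\<close>, \<open>\<beta> = b \<alpha>\<close>, and the class of the orbit sum of \<open>\<kappa>\<close> is, up to sign, the multiple
  \<open>c(\<kappa>) = b (n - 1)! / (a\<^sub>1! \<dots> a\<^sub>s!)\<close> of it, where \<open>n\<close> is the size of \<open>\<kappa>\<close> and the \<open>a\<^sub>i\<close> are its
  multiplicities. For \<open>d\<close> factors the orbit sums with \<open>n > d\<close> vanish, so the module becomes
  \<open>A / (c(\<kappa>) : n > d)\<close>. It is non-zero iff either no \<open>\<kappa>\<close> has \<open>n > d\<close>, that is \<open>|\<beta>| \<le> d\<close>,
  or some prime that is not invertible in \<open>A\<close> divides all these integers. By Legendre's formula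
  and a greedy choice of \<open>\<kappa>\<close>, a prime \<open>p\<close> has the latter property iff \<open>Q\<^sub>p(\<beta>) \<le> Q\<^sub>p(d)\<close>.\<close>

section \<open>Exponent vectors and the coefficient of an orbit sum in the logarithm\<close>

text \<open>The formula for c(\<kappa>) comes from duality. With unboundedly many factors, the
  graded dual of the ring of orbit sums is a polynomial ring in variables t(x), x \<noteq> 0, in
  which T = 1 + sum of t(x) X^x is group-like. So log T is primitive, its coefficient at X^\<beta>
  is a functional that kills products, and expanding the logarithm gives the values (-1)^(n-1)
  (n-1)! / (a_1! ... a_s!). The factor b is the least one that makes them integral. The vanishing on
  products is verified here by a weighted count with finitely many factors. With d factors the types
  with n > d drop out and the functional no longer kills products. It still does so modulo any
  integer q that divides all c(\<kappa>) with n > d. If q is not invertible in A, this proves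
  minimality: the functional of degree \<beta> is a unit on the only generator of that degree and a
  multiple of q on everything that the others generate. For generation, the multipliers that bring
  the reference class into the subalgebra are studied as an ideal of the integers, which is
  principal, so that only primes have to be tested although A is arbitrary.\<close>

abbreviation lookup :: "('b \<Rightarrow>\<^sub>0 'c::zero) \<Rightarrow> 'b \<Rightarrow> 'c" where
  "lookup \<equiv> Poly_Mapping.lookup"

abbreviation keys :: "('b \<Rightarrow>\<^sub>0 'c::zero) \<Rightarrow> 'b set" where
  "keys \<equiv> Poly_Mapping.keys"

type_synonym expo = "nat \<Rightarrow>\<^sub>0 nat"

definition smul :: "nat \<Rightarrow> expo \<Rightarrow> expo" where
  "smul k x = Poly_Mapping.map ((*) k) x"

lemma lookup_smul [simp]: "lookup (smul k x) i = k * lookup x i"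
  by (simp add: smul_def Poly_Mapping.map.rep_eq when_def)

text \<open>Division is rounded down in each coordinate. It is exact when k divides
  \<open>exp_gcd x\<close>; in the digit arguments it removes the lowest base-p digit of every
  coordinate.\<close>

definition sdiv :: "expo \<Rightarrow> nat \<Rightarrow> expo" where
  "sdiv x k = Poly_Mapping.map (\<lambda>v. v div k) x"

lemma lookup_sdiv [simp]: "lookup (sdiv x k) i = lookup x i div k"
  by (simp add: sdiv_def Poly_Mapping.map.rep_eq when_def)

definition exp_gcd :: "expo \<Rightarrow> nat" where
  "exp_gcd \<beta> = Gcd (range (lookup \<beta>))"

lemma dvd_exp_gcd_iff: "k dvd exp_gcd \<beta> \<longleftrightarrow> (\<forall>i. k dvd lookup \<beta> i)"
  by (auto simp: exp_gcd_def dvd_Gcd_iff)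

lemma exp_gcd_dvd_lookup: "exp_gcd \<beta> dvd lookup \<beta> i"
  using dvd_exp_gcd_iff[of "exp_gcd \<beta>" \<beta>] by simp

lemma exp_gcd_eq_0_iff [simp]: "exp_gcd \<beta> = 0 \<longleftrightarrow> \<beta> = 0"
  by (auto simp: exp_gcd_def poly_mapping_eq_iff fun_eq_iff)

lemma exp_gcd_smul: "exp_gcd (smul k x) = k * exp_gcd x"
proof (rule dvd_antisym)
  show "k * exp_gcd x dvd exp_gcd (smul k x)"
    by (simp add: dvd_exp_gcd_iff exp_gcd_dvd_lookup mult_dvd_mono)
  show "exp_gcd (smul k x) dvd k * exp_gcd x"
  proof (cases "k = 0")
    case False
    obtain m where m: "exp_gcd (smul k x) = k * m"
      using dvd_exp_gcd_iff[of k "smul k x"] by (auto elim: dvdE)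
    have "m dvd exp_gcd x"
      unfolding dvd_exp_gcd_iff
    proof
      fix i show "m dvd lookup x i"
        using exp_gcd_dvd_lookup[of "smul k x" i] False by (simp add: m)
    qed
    with m show ?thesis by simp
  qed simp
qed

lemma smul_sdiv: "k dvd exp_gcd x \<Longrightarrow> smul k (sdiv x k) = x"
  by (rule poly_mapping_eqI) (simp add: dvd_exp_gcd_iff)

lemma sum_mset_set_mset:
  "(\<Sum>x\<in>#M. f x) = (\<Sum>x\<in>set_mset M. count M x * (f x :: nat))"
proof -
  have "(\<Sum>x\<in>#M. f x) = (\<Sum>x\<in>X. count M x * f x)" if "finite X" "set_mset M \<subseteq> X" for X
    using that(2)
  proof (induction M)
    case (add y M)
    have "(\<Sum>x\<in>X. count (add_mset y M) x * f x)
        = (\<Sum>x\<in>X. count M x * f x + (if x = y then f x else 0))"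
      by (rule sum.cong) auto
    with add that(1) show ?case by (simp add: sum.distrib)
  qed simp
  then show ?thesis by blast
qed

lemma lookup_sum_mset: "lookup (sum_mset M) i = (\<Sum>x\<in>#M. lookup x i)"
  by (induction M) (simp_all add: lookup_add)

lemma sum_mset_eq_0_iff': "sum_mset (M :: expo multiset) = 0 \<longleftrightarrow> (\<forall>x\<in>#M. x = 0)"
proof
  assume *: "sum_mset M = 0"
  show "\<forall>x\<in>#M. x = 0"
  proof
    fix x assume x: "x \<in># M"
    show "x = 0"
    proof (rule poly_mapping_eqI)
      fix i
      have "(\<Sum>y\<in>#M. lookup y i) = 0"
        using * by (simp flip: lookup_sum_mset)
      with x show "lookup x i = lookup 0 i" by simp
    qed
  qed
next
  assume "\<forall>x\<in>#M. x = 0"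
  then show "sum_mset M = 0" by (induction M) auto
qed

lemma sum_mset_repeat: "sum_mset (repeat_mset k M) = smul k (sum_mset M)"
  by (induction k) (auto intro!: poly_mapping_eqI simp: lookup_add)

lemma sum_mset_replicate: "sum_mset (replicate_mset k x) = smul k x"
  by (induction k) (auto intro!: poly_mapping_eqI simp: lookup_add)

text \<open>This is c(\<kappa>) of the overview. That the division of natural numbers is exact in
  non-zero degree is the content of \<open>orbit_coeff_mult\<close>.\<close>

definition orbit_coeff :: "expo multiset \<Rightarrow> nat" where
  "orbit_coeff \<kappa> = exp_gcd (sum_mset \<kappa>) * fact (size \<kappa> - 1) div (\<Prod>x\<in>set_mset \<kappa>. fact (count \<kappa> x))"

text \<open>By Legendre, the sum of these over s \<ge> 1 is the p-adic valuation of the product of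
  the factorials of the multiplicities. Position s = 0 gives the size, so size and valuation can be
  treated together.\<close>

definition div_sum :: "nat \<Rightarrow> nat \<Rightarrow> expo multiset \<Rightarrow> nat" where
  "div_sum p s \<kappa> = (\<Sum>x\<in>set_mset \<kappa>. count \<kappa> x div p ^ s)"

lemma div_sum_superset:
  "finite X \<Longrightarrow> set_mset \<kappa> \<subseteq> X \<Longrightarrow> div_sum p s \<kappa> = (\<Sum>x\<in>X. count \<kappa> x div p ^ s)"
  unfolding div_sum_def by (rule sum.mono_neutral_left) (auto simp: not_in_iff)

lemma div_sum_mono: "\<kappa> \<subseteq># \<mu> \<Longrightarrow> div_sum p s \<kappa> \<le> div_sum p s \<mu>"
  by (subst div_sum_superset[of "set_mset \<mu>"])
     (auto simp: div_sum_def mset_subset_eq_count dest: mset_subset_eqD intro!: sum_mono div_le_mono)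

lemma div_sum_0 [simp]: "div_sum p 0 \<kappa> = size \<kappa>"
  by (simp add: div_sum_def size_multiset_overloaded_eq)

lemma div_sum_repeat: "p > 0 \<Longrightarrow> div_sum p (Suc s) (repeat_mset p \<kappa>) = div_sum p s \<kappa>"
  by (subst div_sum_superset[of "set_mset \<kappa>"]) (auto simp: div_sum_def simp flip: count_greater_zero_iff)

text \<open>If p^s divides all multiplicities, it divides the gcd of the degree, and the left side
  is n / p^s = 1 + (n - 1) div p^s with n = \<open>size \<kappa>\<close>. Otherwise one of the
  floors is strict, so p^s times the left side is at most n - 1.\<close>

lemma div_sum_le:
  assumes "\<kappa> \<noteq> {#}" "p > 0"
  shows "div_sum p s \<kappa> \<le> of_bool (p ^ s dvd exp_gcd (sum_mset \<kappa>)) + (size \<kappa> - 1) div p ^ s"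
proof (cases "\<forall>x\<in>#\<kappa>. p ^ s dvd count \<kappa> x")
  case True
  have 1: "p ^ s * div_sum p s \<kappa> = size \<kappa>"
    using True by (simp add: div_sum_def size_multiset_overloaded_eq sum_distrib_left)
  have "p ^ s dvd exp_gcd (sum_mset \<kappa>)"
    unfolding dvd_exp_gcd_iff lookup_sum_mset sum_mset_set_mset using True by (auto intro!: dvd_sum)
  moreover have "div_sum p s \<kappa> \<le> 1 + (size \<kappa> - 1) div p ^ s"
  proof -
    have "p ^ s * (div_sum p s \<kappa> - 1) \<le> size \<kappa> - 1"
    proof -
      have "p ^ s \<ge> 1" using assms(2) by (simp add: Suc_leI)
      then show ?thesis using 1 by (simp add: diff_mult_distrib2)
    qed
    then have "div_sum p s \<kappa> - 1 \<le> (size \<kappa> - 1) div p ^ s"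
      using assms(2) by (simp add: less_eq_div_iff_mult_less_eq mult.commute)
    then show ?thesis by linarith
  qed
  ultimately show ?thesis by simp
next
  case False
  then obtain y where y: "y \<in># \<kappa>" "\<not> p ^ s dvd count \<kappa> y" by auto
  have "(\<Sum>x\<in>set_mset \<kappa>. count \<kappa> x div p ^ s * p ^ s) < (\<Sum>x\<in>set_mset \<kappa>. count \<kappa> x)"
  proof (rule sum_strict_mono_ex1)
    have "count \<kappa> y div p ^ s * p ^ s \<noteq> count \<kappa> y"
      using y(2) by (metis dvd_triv_right)
    then have "count \<kappa> y div p ^ s * p ^ s < count \<kappa> y"
      using div_times_less_eq_dividend le_neq_implies_less by blast
    then show "\<exists>x\<in>set_mset \<kappa>. count \<kappa> x div p ^ s * p ^ s < count \<kappa> x"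
      using y(1) by blast
  qed (simp_all add: div_times_less_eq_dividend)
  then have "div_sum p s \<kappa> * p ^ s \<le> size \<kappa> - 1"
    by (simp add: div_sum_def sum_distrib_right size_multiset_overloaded_eq)
  then show ?thesis
    using assms(2) by (simp add: less_eq_div_iff_mult_less_eq trans_le_add2)
qed

section \<open>Legendre's formula and the p-adic valuation of the orbit coefficients\<close>

text \<open>The valuation v counts the exponents s \<ge> 1 with p^s dividing m, and v < p^v \<le> m
  \<le> K. The free bound K lets sums of different origin share one index range.\<close>

lemma multiplicity_eq_sum:
  assumes "prime (p::nat)" "0 < m" "m \<le> K"
  shows "multiplicity p m = (\<Sum>s\<in>{1..K}. of_bool (p ^ s dvd m))"
proof -
  have np: "\<not> is_unit p" using assms(1) by (simp add: prime_nat_iff)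
  have "multiplicity p m < p ^ multiplicity p m"
    using prime_gt_1_nat[OF assms(1)] by (simp add: power_gt_expt)
  also have "\<dots> \<le> m" using assms(2) by (intro dvd_imp_le multiplicity_dvd) auto
  finally have "multiplicity p m \<le> K" using assms(3) by simp
  then have "{s \<in> {1..K}. p ^ s dvd m} = {1..multiplicity p m}"
    using assms(2) np by (auto simp: power_dvd_iff_le_multiplicity)
  moreover have "(\<Sum>s\<in>{1..K}. of_bool (p ^ s dvd m)) = card {s \<in> {1..K}. p ^ s dvd m}"
    by (simp add: of_bool_def sum.If_cases) (simp add: Int_def)
  ultimately show ?thesis by simp
qed

text \<open>Passing from n to n + 1 raises \<open>n div p ^ s\<close> by one exactly when p^s
  divides n + 1, and the number of such s is the valuation of the new factor.\<close>

lemma legendre_formula: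
  assumes "prime (p::nat)" "n \<le> K"
  shows "multiplicity p (fact n :: nat) = (\<Sum>s\<in>{1..K}. n div p ^ s)"
  using assms(2)
proof (induction n)
  case (Suc n)
  have "multiplicity p (fact (Suc n) :: nat) = multiplicity p (Suc n) + multiplicity p (fact n :: nat)"
    using assms(1) by (simp only: fact_Suc of_nat_id) (subst prime_elem_multiplicity_mult_distrib; auto)
  also have "multiplicity p (Suc n) = (\<Sum>s\<in>{1..K}. of_bool (p ^ s dvd Suc n))"
    using Suc assms(1) by (intro multiplicity_eq_sum) auto
  also have "multiplicity p (fact n :: nat) = (\<Sum>s\<in>{1..K}. n div p ^ s)"
    using Suc by simp
  also have "(\<Sum>s\<in>{1..K}. of_bool (p ^ s dvd Suc n)) + (\<Sum>s\<in>{1..K}. n div p ^ s)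
     = (\<Sum>s\<in>{1..K}. Suc n div p ^ s)"
    unfolding sum.distrib[symmetric]
    by (rule sum.cong) (auto simp: div_Suc dvd_eq_mod_eq_0)
  finally show ?case .
qed simp

lemma multiplicity_prod_fact:
  assumes "prime (p::nat)" "size \<kappa> \<le> K"
  shows "multiplicity p (\<Prod>x\<in>set_mset \<kappa>. fact (count \<kappa> x)) = (\<Sum>s\<in>{1..K}. div_sum p s \<kappa>)"
proof -
  have "multiplicity p (\<Prod>x\<in>set_mset \<kappa>. fact (count \<kappa> x))
      = (\<Sum>x\<in>set_mset \<kappa>. multiplicity p (fact (count \<kappa> x) :: nat))"
    using assms(1) by (subst prime_elem_multiplicity_prod_distrib) auto
  also have "\<dots> = (\<Sum>x\<in>set_mset \<kappa>. \<Sum>s\<in>{1..K}. count \<kappa> x div p ^ s)"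
    using assms by (intro sum.cong refl legendre_formula) (auto intro: order.trans[OF count_le_size])
  also have "\<dots> = (\<Sum>s\<in>{1..K}. div_sum p s \<kappa>)"
    unfolding div_sum_def by (rule sum.swap)
  finally show ?thesis .
qed

lemma multiplicity_num:
  assumes "prime (p::nat)" "\<beta> \<noteq> 0" "exp_gcd \<beta> + n \<le> K"
  shows "multiplicity p (exp_gcd \<beta> * fact n)
    = (\<Sum>s\<in>{1..K}. of_bool (p ^ s dvd exp_gcd \<beta>) + n div p ^ s)"
proof -
  have "multiplicity p (exp_gcd \<beta> * fact n) = multiplicity p (exp_gcd \<beta>) + multiplicity p (fact n :: nat)"
    using assms by (intro prime_elem_multiplicity_mult_distrib) auto
  also have "multiplicity p (exp_gcd \<beta>) = (\<Sum>s\<in>{1..K}. of_bool (p ^ s dvd exp_gcd \<beta>))"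
    using assms by (intro multiplicity_eq_sum) (auto intro: Nat.gr0I)
  also have "multiplicity p (fact n :: nat) = (\<Sum>s\<in>{1..K}. n div p ^ s)"
    using assms by (intro legendre_formula) auto
  finally show ?thesis by (simp only: sum.distrib)
qed

text \<open>Integrality is checked one prime at a time: \<open>div_sum_le\<close> compares the
  Legendre sums of denominator and numerator term by term.\<close>

lemma orbit_coeff_mult:
  assumes "sum_mset \<kappa> \<noteq> 0"
  shows "orbit_coeff \<kappa> * (\<Prod>x\<in>set_mset \<kappa>. fact (count \<kappa> x)) = exp_gcd (sum_mset \<kappa>) * fact (size \<kappa> - 1)"
proof -
  have ne: "\<kappa> \<noteq> {#}" using assms by auto
  have "(\<Prod>x\<in>set_mset \<kappa>. fact (count \<kappa> x)) dvd exp_gcd (sum_mset \<kappa>) * (fact (size \<kappa> - 1) :: nat)"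
  proof (rule multiplicity_le_imp_dvd)
    fix p :: nat assume p: "prime p"
    define K where "K = exp_gcd (sum_mset \<kappa>) + size \<kappa>"
    note le = div_sum_le[OF ne prime_gt_0_nat[OF p]]
    show "multiplicity p (\<Prod>x\<in>set_mset \<kappa>. fact (count \<kappa> x))
        \<le> multiplicity p (exp_gcd (sum_mset \<kappa>) * (fact (size \<kappa> - 1) :: nat))"
      using p assms ne
      by (subst multiplicity_prod_fact[of _ _ K], simp, simp add: K_def,
          subst multiplicity_num[of _ _ _ K])
        (simp_all only: K_def sum_mono le)
  qed auto
  then show ?thesis by (simp add: orbit_coeff_def)
qed

text \<open>With g = \<open>exp_gcd x\<close> the value is k g (k - 1)! / k! = g. So the orbit sum
  of k copies of x can serve as the generator of its degree whenever g is invertible in A, the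
  condition common to both collections.\<close>

lemma orbit_coeff_replicate_mset:
  assumes "k > 0" "x \<noteq> 0"
  shows "orbit_coeff (replicate_mset k x) = exp_gcd x"
proof -
  obtain m where m: "k = Suc m" using assms(1) by (cases k) auto
  have "exp_gcd (smul k x) \<noteq> 0" using assms by (simp only: exp_gcd_smul) simp
  then have "smul k x \<noteq> 0" by simp
  then have "orbit_coeff (replicate_mset k x) * fact k = k * exp_gcd x * fact (k - 1)"
    using orbit_coeff_mult[of "replicate_mset k x"] assms(1)
    by (simp add: sum_mset_replicate exp_gcd_smul del: sum_mset_replicate_mset)
  also have "\<dots> = exp_gcd x * fact k" by (simp add: m algebra_simps)
  finally show ?thesis by simp
qed

lemma orbit_coeff_pos: "sum_mset \<kappa> \<noteq> 0 \<Longrightarrow> orbit_coeff \<kappa> > 0"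
  using orbit_coeff_mult[of \<kappa>] by (intro Nat.gr0I) auto

text \<open>Equality in \<open>div_sum_le\<close> at all positions s \<ge> 1; at s = 0 it holds for
  every non-empty multiset.\<close>

definition tight :: "nat \<Rightarrow> expo multiset \<Rightarrow> bool" where
  "tight p \<kappa> \<longleftrightarrow> (\<forall>s\<ge>1. div_sum p s \<kappa>
      = of_bool (p ^ s dvd exp_gcd (sum_mset \<kappa>)) + (size \<kappa> - 1) div p ^ s)"

text \<open>The valuation of \<open>orbit_coeff \<kappa>\<close> is the sum of the gaps in
  \<open>div_sum_le\<close>. No gap is negative, so the sum is zero iff each gap is.\<close>

lemma not_dvd_orbit_coeff_iff:
  assumes "prime p" "sum_mset \<kappa> \<noteq> 0"
  shows "\<not> p dvd orbit_coeff \<kappa> \<longleftrightarrow> tight p \<kappa>"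
proof -
  define b where "b = exp_gcd (sum_mset \<kappa>)"
  have ne: "\<kappa> \<noteq> {#}" using assms by auto
  have eq: "multiplicity p (orbit_coeff \<kappa>) + (\<Sum>s\<in>{1..K}. div_sum p s \<kappa>)
      = (\<Sum>s\<in>{1..K}. of_bool (p ^ s dvd b) + (size \<kappa> - 1) div p ^ s)"
    if "b + size \<kappa> \<le> K" for K
  proof -
    have "multiplicity p (orbit_coeff \<kappa> * (\<Prod>x\<in>set_mset \<kappa>. fact (count \<kappa> x)))
        = multiplicity p (orbit_coeff \<kappa>) + (\<Sum>s\<in>{1..K}. div_sum p s \<kappa>)"
      using assms that orbit_coeff_pos[OF assms(2)]
      by (subst prime_elem_multiplicity_mult_distrib)
         (auto simp: multiplicity_prod_fact[of p \<kappa> K])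
    then show ?thesis
      using assms that by (simp add: orbit_coeff_mult multiplicity_num[of p _ _ K] b_def)
  qed
  have le: "div_sum p s \<kappa> \<le> of_bool (p ^ s dvd b) + (size \<kappa> - 1) div p ^ s" for s
    unfolding b_def using ne assms by (intro div_sum_le prime_gt_0_nat)
  have "\<not> p dvd orbit_coeff \<kappa> \<longleftrightarrow> multiplicity p (orbit_coeff \<kappa>) = 0"
    using assms orbit_coeff_pos[OF assms(2)] by (auto simp: multiplicity_eq_zero_iff prime_nat_iff)
  also have "\<dots> \<longleftrightarrow> tight p \<kappa>"
  proof
    assume 0: "multiplicity p (orbit_coeff \<kappa>) = 0"
    show "tight p \<kappa>"
      unfolding tight_def
    proof (intro allI impI)
      fix s :: nat assume s: "s \<ge> 1"
      \<comment> \<open>Adding s to the bound places the position under consideration inside the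
        range of summation.\<close>
      define K where "K = b + size \<kappa> + s"
      have "(\<Sum>s\<in>{1..K}. div_sum p s \<kappa>)
          = (\<Sum>s\<in>{1..K}. of_bool (p ^ s dvd b) + (size \<kappa> - 1) div p ^ s)"
        using eq[of K] 0 by (simp add: K_def)
      then show "div_sum p s \<kappa> = of_bool (p ^ s dvd exp_gcd (sum_mset \<kappa>)) + (size \<kappa> - 1) div p ^ s"
        using le s unfolding b_def[symmetric]
        by (intro sum_mono_inv[where I = "{1..K}" and f = "\<lambda>s. div_sum p s \<kappa>"]) (auto simp: K_def)
    qed
  next
    assume "tight p \<kappa>"
    then show "multiplicity p (orbit_coeff \<kappa>) = 0"
      using eq[of "b + size \<kappa>"] by (simp add: tight_def b_def)
  qed
  finally show ?thesis .
qed

section \<open>Base-\<open>p\<close> digits\<close>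

lemma keys_subset_lessThan_iff: "keys \<beta> \<subseteq> {..<r} \<longleftrightarrow> (\<forall>i. lookup \<beta> i \<noteq> 0 \<longrightarrow> i < r)"
  unfolding subset_iff in_keys_iff lessThan_iff ..

lemma coeff_Qp:
  assumes "p \<ge> 2"
  shows "coeff (Qp p n) s = int (n div p ^ s mod p)"
proof -
  have "coeff (Qp p n) s = (\<Sum>t\<le>n. if t = s then int (n div p ^ t mod p) else 0)"
    unfolding Qp_def coeff_sum coeff_monom by (rule sum.cong) auto
  also have "\<dots> = (if s \<le> n then int (n div p ^ s mod p) else 0)"
    by (simp add: sum.delta)
  also have "\<dots> = int (n div p ^ s mod p)"
  proof (cases "s \<le> n")
    case False
    have "s < p ^ s" using assms by (simp add: power_gt_expt)
    with False have "n < p ^ s" by simp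
    then show ?thesis by simp
  qed simp
  finally show ?thesis .
qed

text \<open>Digits of different coordinates are added without carrying, so a coefficient may exceed
  p - 1.\<close>

lemma coeff_Qp_idx:
  "p \<ge> 2 \<Longrightarrow> coeff (Qp_idx p r b) s = int (\<Sum>i<r. b i div p ^ s mod p)"
  by (simp add: Qp_idx_def coeff_sum coeff_Qp)

lemma Qp_rec: "p \<ge> 2 \<Longrightarrow> Qp p n = pCons (int (n mod p)) (Qp p (n div p))"
  by (rule poly_eqI) (auto simp: coeff_Qp coeff_pCons div_mult2_eq split: nat.split)

lemma Qp_idx_rec:
  "p \<ge> 2 \<Longrightarrow> Qp_idx p r b = pCons (int (\<Sum>i<r. b i mod p)) (Qp_idx p r (\<lambda>i. b i div p))"
  by (rule poly_eqI) (auto simp: coeff_Qp_idx coeff_pCons div_mult2_eq split: nat.split)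

text \<open>In the Horner form a + n R(n), the induction hypothesis gives R(n) \<ge> 1 over the
  integers, and n > |a| then outweighs a.\<close>

lemma pos_poly_eventually:
  "pos_poly (R :: int poly) \<Longrightarrow> \<forall>\<^sub>F n in sequentially. poly R (int n) > 0"
proof (induction R)
  case (pCons a R)
  show ?case
  proof (cases "pos_poly R")
    case True
    have "\<forall>\<^sub>F n in sequentially. n > nat \<bar>a\<bar>"
      by (rule eventually_gt_at_top)
    with pCons.IH[OF True] show ?thesis
    proof eventually_elim
      case (elim n)
      have "int n * 1 \<le> int n * poly R (int n)"
        using elim by (intro mult_left_mono) auto
      moreover have "\<bar>a\<bar> < int n" using elim by simp
      ultimately show ?case by simp
    qed
  next
    case False
    with pCons.prems show ?thesis by (simp add: pos_poly_pCons)
  qed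
qed (simp add: pos_poly_def)

text \<open>By trichotomy, the sign of the leading coefficient of the difference decides the
  asymptotic order, so digits can be compared from the top.\<close>

lemma poly_gt_iff_pos_poly: "poly_gt P Q \<longleftrightarrow> pos_poly (P - Q)"
proof
  assume gt: "poly_gt P Q"
  show "pos_poly (P - Q)"
  proof (rule ccontr)
    assume "\<not> pos_poly (P - Q)"
    then have "P - Q = 0 \<or> pos_poly (- (P - Q))"
      using pos_poly_total by blast
    then show False
    proof
      assume "P - Q = 0"
      with gt show False by (simp add: poly_gt_def)
    next
      assume "pos_poly (- (P - Q))"
      from pos_poly_eventually[OF this] gt[unfolded poly_gt_def]
      have "\<forall>\<^sub>F n :: nat in sequentially. False"
        by eventually_elim simp
      then show False by simp
    qed
  qed
next
  assume "pos_poly (P - Q)"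
  from pos_poly_eventually[OF this] show "poly_gt P Q"
    by (simp add: poly_gt_def)
qed

text \<open>All values from s1 on are zero, and the recursion carries the zero back down to
  s0.\<close>

lemma geometric_vanish:
  fixes X :: "nat \<Rightarrow> int"
  assumes "\<And>s. s \<ge> s0 \<Longrightarrow> X s = p * X (Suc s)" "\<And>s. s \<ge> s1 \<Longrightarrow> X s = 0" "s \<ge> s0"
  shows "X s = 0"
proof -
  have "s \<ge> s0 \<Longrightarrow> X s = 0" if "s \<le> s0 + s1" for s
    using that
  proof (induction rule: inc_induct)
    case (step n)
    with assms(1)[of n] show ?case by simp
  qed (simp add: assms(2))
  with assms(2)[of s] assms(3) show ?thesis
    by (cases "s \<le> s0 + s1") auto
qed

text \<open>A base-p digit is \<open>n div p ^ s\<close> minus p times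
  \<open>n div p ^ Suc s\<close>. Through X, the difference of the floors, a comparison of digits
  becomes a comparison of floors.\<close>

lemma coeff_Qp_diff:
  fixes p r d :: nat and b :: "nat \<Rightarrow> nat"
  assumes "p \<ge> 2"
  defines "X \<equiv> \<lambda>s. int (\<Sum>i<r. b i div p ^ s) - int (d div p ^ s)"
  shows "coeff (Qp_idx p r b - Qp p d) s = X s - int p * X (Suc s)"
proof -
  have *: "int (a div p ^ s mod p) = int (a div p ^ s) - int p * int (a div p ^ Suc s)" for a :: nat
  proof -
    have "a div p ^ Suc s = a div p ^ s div p"
      by (simp only: power_Suc2 div_mult2_eq)
    then have "a div p ^ s = p * (a div p ^ Suc s) + a div p ^ s mod p" by simp
    then have "int (a div p ^ s) = int p * int (a div p ^ Suc s) + int (a div p ^ s mod p)"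
      by (metis of_nat_add of_nat_mult)
    then show ?thesis by simp
  qed
  show ?thesis
    unfolding coeff_diff coeff_Qp_idx[OF assms(1)] coeff_Qp[OF assms(1)] X_def of_nat_sum *
    by (simp only: sum_subtractf right_diff_distrib sum_distrib_left)
qed

lemma div_power_eq_0: "p \<ge> 2 \<Longrightarrow> a \<le> s \<Longrightarrow> (a::nat) div p ^ s = 0"
proof -
  assume "p \<ge> 2" "a \<le> s"
  then have "s < p ^ s" by (simp add: power_gt_expt)
  with \<open>a \<le> s\<close> show ?thesis by simp
qed

lemma tailsum_vanish:
  fixes p r d :: nat and b :: "nat \<Rightarrow> nat"
  assumes "p \<ge> 2"
  obtains s1 where "\<And>s. s \<ge> s1 \<Longrightarrow>
    int (\<Sum>i<r. b i div p ^ s) - int (d div p ^ s) = 0"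
proof
  fix s assume s: "s \<ge> (\<Sum>i<r. b i) + d"
  have "b i \<le> s" if "i < r" for i
  proof -
    have "b i \<le> (\<Sum>i<r. b i)" using that by (intro member_le_sum) auto
    with s show ?thesis by simp
  qed
  with s show "int (\<Sum>i<r. b i div p ^ s) - int (d div p ^ s) = 0"
    using assms by (simp add: div_power_eq_0)
qed

text \<open>Above the degree of the difference R, the recursion X(s) = p X(s + 1) and the vanishing
  tail force X = 0. So the leading coefficient of R is X at the degree of R, which is non-negative
  by the hypothesis on floors. R = 0 would give X(0) = 0, against the strict inequality.\<close>

lemma pos_poly_QpI:
  assumes "p \<ge> 2" "\<And>s. d div p ^ s \<le> (\<Sum>i<r. b i div p ^ s)" "d < (\<Sum>i<r. b i)"
  shows "pos_poly (Qp_idx p r b - Qp p d)"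
proof -
  define R where "R = Qp_idx p r b - Qp p d"
  define X where "X s = int (\<Sum>i<r. b i div p ^ s) - int (d div p ^ s)" for s
  have coeff: "coeff R s = X s - int p * X (Suc s)" for s
    unfolding R_def X_def by (rule coeff_Qp_diff[OF assms(1)])
  obtain s1 where s1: "\<And>s. s \<ge> s1 \<Longrightarrow> X s = 0"
    using tailsum_vanish[OF assms(1), where r = r and b = b and d = d] unfolding X_def by blast
  have "R \<noteq> 0"
  proof
    assume "R = 0"
    have "X s = int p * X (Suc s)" for s using coeff[of s] \<open>R = 0\<close> by simp
    then have "X 0 = 0" by (rule geometric_vanish[OF _ s1 order.refl])
    with assms(3) show False by (simp add: X_def del: of_nat_sum)
  qed
  have "X (Suc (degree R)) = 0"
  proof (rule geometric_vanish[OF _ s1 order.refl])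
    fix s assume "s \<ge> Suc (degree R)"
    then show "X s = int p * X (Suc s)" using coeff[of s] by (simp add: coeff_eq_0)
  qed
  then have "lead_coeff R = X (degree R)" by (simp add: coeff)
  also have "\<dots> \<ge> 0" using assms(2)[of "degree R"] by (simp add: X_def del: of_nat_sum)
  finally have "lead_coeff R > 0" using \<open>R \<noteq> 0\<close> by (simp add: less_le)
  then show ?thesis by (simp add: pos_poly_def R_def)
qed

lemma tailsum_eqI:
  assumes "p \<ge> 2" "Qp_idx p r b = Qp p d"
  shows "(\<Sum>i<r. b i div p ^ s) = d div p ^ s"
proof -
  define X where "X s = int (\<Sum>i<r. b i div p ^ s) - int (d div p ^ s)" for s
  obtain s1 where s1: "\<And>s. s \<ge> s1 \<Longrightarrow> X s = 0"
    using tailsum_vanish[OF assms(1), where r = r and b = b and d = d] unfolding X_def by blast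
  have "X s = int p * X (Suc s)" for s
    using coeff_Qp_diff[OF assms(1), of r b d s] assms(2) by (simp add: X_def)
  then have "X s = 0" by (rule geometric_vanish[OF _ s1 le0])
  then show ?thesis by (simp add: X_def del: of_nat_sum)
qed

section \<open>Multisets of exponent vectors that attain the Legendre bound\<close>

definition unitv :: "nat \<Rightarrow> expo" where
  "unitv i = Poly_Mapping.single i 1"

lemma lookup_unitv: "lookup (unitv i) j = (if j = i then 1 else 0)"
  by (simp add: unitv_def lookup_single when_def)

lemma unitv_eq_iff [simp]: "unitv i = unitv j \<longleftrightarrow> i = j"
  by (metis lookup_unitv zero_neq_one)

lemma unitv_neq_0 [simp]: "unitv i \<noteq> 0"
  by (metis lookup_unitv lookup_zero zero_neq_one)

text \<open>The finest multiset with sum \<beta>. Its \<open>div_sum\<close> is the sum of the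
  floors of the coordinates, the largest value that a multiset of non-zero vectors with this sum can
  have.\<close>

definition units :: "expo \<Rightarrow> expo multiset" where
  "units \<beta> = (\<Sum>i\<in>keys \<beta>. replicate_mset (lookup \<beta> i) (unitv i))"

lemma count_units: "count (units \<beta>) (unitv i) = lookup \<beta> i"
proof -
  have "count (units \<beta>) (unitv i)
      = (\<Sum>j\<in>keys \<beta>. if j = i then lookup \<beta> i else 0)"
    unfolding units_def count_sum by (rule sum.cong) (auto simp: unitv_eq_iff)
  then show ?thesis by (simp add: sum.delta in_keys_iff)
qed

lemma set_mset_units: "set_mset (units \<beta>) = (\<lambda>i. unitv i) ` keys \<beta>"
  by (auto simp: units_def set_mset_sum in_keys_iff)

lemma zero_notin_units: "0 \<notin># units \<beta>"
  by (auto simp: set_mset_units dest: sym)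

lemma div_sum_units: "div_sum p s (units \<beta>) = (\<Sum>i\<in>keys \<beta>. lookup \<beta> i div p ^ s)"
  unfolding div_sum_def set_mset_units
  by (subst sum.reindex) (auto simp: inj_on_def unitv_eq_iff count_units)

lemma div_sum_units': "keys \<beta> \<subseteq> {..<r} \<Longrightarrow> div_sum p s (units \<beta>) = (\<Sum>i<r. lookup \<beta> i div p ^ s)"
  unfolding div_sum_units by (rule sum.mono_neutral_left) (auto simp: in_keys_iff)

lemma sum_mset_units: "sum_mset (units \<beta>) = \<beta>"
proof (rule poly_mapping_eqI)
  fix i
  have "lookup (sum_mset (units \<beta>)) i = (\<Sum>j\<in>keys \<beta>. lookup \<beta> j * (if j = i then 1 else 0))"
    unfolding lookup_sum_mset sum_mset_set_mset set_mset_units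
    by (subst sum.reindex) (auto simp: inj_on_def unitv_eq_iff count_units lookup_unitv intro!: sum.cong)
  also have "\<dots> = (\<Sum>j\<in>keys \<beta>. if j = i then lookup \<beta> j else 0)"
    by (rule sum.cong) auto
  finally show "lookup (sum_mset (units \<beta>)) i = lookup \<beta> i"
    by (simp add: in_keys_iff)
qed

lemma obtain_submset_size:
  assumes "k \<le> size M"
  obtains K where "K \<subseteq># M" "size K = k"
proof -
  obtain xs where xs: "mset xs = M" using ex_mset by blast
  show ?thesis
  proof (rule that[of "mset (take k xs)"])
    show "mset (take k xs) \<subseteq># M"
      by (metis append_take_drop_id mset_append mset_subset_eq_add_left xs)
    show "size (mset (take k xs)) = k" using assms xs by auto
  qed
qed

text \<open>Reading the base-\<open>p\<close> digits from the top, the surplus of \<open>\<beta>\<close> over \<open>d\<close> is split until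
  the digits of \<open>d\<close> are covered; the remainder becomes \<open>\<rho>\<close>.\<close>
lemma exists_decomposition:
  assumes "p \<ge> 2" "keys \<beta> \<subseteq> {..<r}" "pos_poly (Qp_idx p r (lookup \<beta>) - Qp p d)"
  shows "\<exists>\<kappa> \<rho>. 0 \<notin># \<kappa> \<and> size \<kappa> = d \<and> \<rho> \<noteq> 0 \<and> sum_mset \<kappa> + \<rho> = \<beta>
    \<and> (\<forall>s. d div p ^ s \<le> div_sum p s \<kappa>)"
  using assms(2,3)
proof (induction d arbitrary: \<beta> rule: less_induct)
  case (less d)
  \<comment> \<open>The recursion is that of \<open>Qp\<close>: \<beta>' keeps the higher digits of
    all coordinates and \<eta> the lowest ones.\<close>
  define \<beta>' where "\<beta>' = sdiv \<beta> p"
  define \<delta> where "\<delta> = d mod p"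
  define \<eta> where "\<eta> = \<beta> - smul p \<beta>'"
  have eta: "lookup \<eta> i = lookup \<beta> i mod p" for i
    by (simp add: \<eta>_def \<beta>'_def lookup_minus minus_mult_div_eq_mod)
  have keys': "keys \<beta>' \<subseteq> {..<r}"
    using less.prems(1) unfolding keys_subset_lessThan_iff \<beta>'_def lookup_sdiv by (metis div_0)
  have keys_eta: "keys \<eta> \<subseteq> {..<r}"
    using less.prems(1) unfolding keys_subset_lessThan_iff eta by (metis mod_0)
  have decomp: "\<beta> = smul p \<beta>' + \<eta>"
    by (rule poly_mapping_eqI) (simp add: lookup_add eta \<beta>'_def)
  have Q: "Qp_idx p r (lookup \<beta>) - Qp p d = pCons (int (\<Sum>i<r. lookup \<beta> i mod p) - int \<delta>)
      (Qp_idx p r (lookup \<beta>') - Qp p (d div p))"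
    using Qp_idx_rec[OF assms(1), of r "lookup \<beta>"] Qp_rec[OF assms(1), of d]
    by (simp add: \<beta>'_def \<delta>_def lookup_sdiv[abs_def])
  \<comment> \<open>Position s + 1 for p copies of \<kappa>' is position s for \<kappa>'. Only
    position 0, the size, remains, and the d mod p elements of K provide it.\<close>
  have mono: "d div p ^ s \<le> div_sum p s (repeat_mset p \<kappa>' + K)"
    if "size \<kappa>' = d div p" "size K = \<delta>" "\<forall>s. d div p div p ^ s \<le> div_sum p s \<kappa>'" for s \<kappa>' K
  proof (cases s)
    case 0
    with that show ?thesis by (simp add: \<delta>_def)
  next
    case (Suc t)
    have "d div p ^ s = d div p div p ^ t" by (simp add: Suc div_mult2_eq)
    also have "\<dots> \<le> div_sum p s (repeat_mset p \<kappa>')"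
      using that(3) assms(1) by (simp add: Suc div_sum_repeat)
    also have "\<dots> \<le> div_sum p s (repeat_mset p \<kappa>' + K)" by (rule div_sum_mono) simp
    finally show ?thesis .
  qed
  \<comment> \<open>A positive higher part makes the difference positive; if the higher part is
    zero, the lowest coefficient decides.\<close>
  consider "pos_poly (Qp_idx p r (lookup \<beta>') - Qp p (d div p))"
    | "Qp_idx p r (lookup \<beta>') = Qp p (d div p)" "\<delta> < (\<Sum>i<r. lookup \<beta> i mod p)"
  proof -
    have "\<delta> < (\<Sum>i<r. lookup \<beta> i mod p)" if "0 < int (\<Sum>i<r. lookup \<beta> i mod p) - int \<delta>"
      using that by linarith
    then show thesis
      using less.prems(2) that unfolding Q pos_poly_pCons right_minus_eq by blast
  qed
  then show ?case
  proof cases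
    case 1
    show ?thesis
    proof (cases "d = 0")
      case True
      have "\<beta> \<noteq> 0"
      proof
        assume "\<beta> = 0"
        with less.prems(2) True show False
          by (simp add: Qp_idx_def Qp_def pos_poly_def)
      qed
      with True show ?thesis by (intro exI[of _ "{#}"] exI[of _ \<beta>]) auto
    next
      case False
      then have "d div p < d" using assms(1) by simp
      from less.IH[OF this keys' 1] obtain \<kappa>' \<rho>' where IH: "0 \<notin># \<kappa>'" "size \<kappa>' = d div p"
        "\<rho>' \<noteq> 0" "sum_mset \<kappa>' + \<rho>' = \<beta>'" "\<forall>s. d div p div p ^ s \<le> div_sum p s \<kappa>'"
        by blast
      \<comment> \<open>Multiplying by p yields p copies of \<rho>'. The d mod p elements still
        missing are taken from them; the other copies, at least one because \<delta> < p, join the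
        lowest digits in the new remainder.\<close>
      define \<kappa> where "\<kappa> = repeat_mset p \<kappa>' + replicate_mset \<delta> \<rho>'"
      define \<rho> where "\<rho> = smul (p - \<delta>) \<rho>' + \<eta>"
      have "\<delta> < p" using assms(1) by (simp add: \<delta>_def)
      have "0 \<notin># \<kappa>" using IH(1,3) by (auto simp: \<kappa>_def simp flip: count_greater_zero_iff split: if_splits)
      moreover have "size \<kappa> = d" by (simp add: \<kappa>_def \<delta>_def IH(2))
      moreover have "\<rho> \<noteq> 0"
      proof
        assume "\<rho> = 0"
        then have "lookup \<rho> i = 0" for i by simp
        then have "lookup \<rho>' i = 0" for i
          using \<open>\<delta> < p\<close> by (simp add: \<rho>_def lookup_add)
        with IH(3) show False by (auto intro: poly_mapping_eqI)
      qed
      moreover have "sum_mset \<kappa> + \<rho> = \<beta>"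
      proof (rule poly_mapping_eqI)
        fix i
        have "lookup (sum_mset \<kappa> + \<rho>) i = p * lookup (sum_mset \<kappa>') i
          + \<delta> * lookup \<rho>' i + (p - \<delta>) * lookup \<rho>' i + lookup \<eta> i"
          by (simp add: \<kappa>_def \<rho>_def lookup_add sum_mset_repeat sum_mset_replicate
              del: sum_mset_replicate_mset)
        also have "\<dots> = p * lookup (sum_mset \<kappa>' + \<rho>') i + lookup \<eta> i"
          using distrib_right[of \<delta> "p - \<delta>" "lookup \<rho>' i"] \<open>\<delta> < p\<close>
          by (simp add: lookup_add distrib_left)
        also have "\<dots> = lookup \<beta> i"
          by (subst decomp) (simp add: IH(4) lookup_add)
        finally show "lookup (sum_mset \<kappa> + \<rho>) i = lookup \<beta> i" .
      qed
      moreover have "\<forall>s. d div p ^ s \<le> div_sum p s \<kappa>"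
        unfolding \<kappa>_def using IH by (intro allI mono) auto
      ultimately show ?thesis by blast
    qed
  next
    case 2
    \<comment> \<open>Here the higher digits of \<beta> and d agree in total, so unit vectors meet
      the floors with equality. The strict surplus sits in the lowest digits and leaves a non-zero
      remainder once \<delta> of their units are taken.\<close>
    have tail: "div_sum p s (units \<beta>') = d div p div p ^ s" for s
      using tailsum_eqI[OF assms(1) 2(1), of s] by (simp add: div_sum_units'[OF keys'])
    have size_eta: "size (units \<eta>) = (\<Sum>i<r. lookup \<beta> i mod p)"
      using div_sum_units'[OF keys_eta, of p 0] by (simp add: eta)
    obtain K where K: "K \<subseteq># units \<eta>" "size K = \<delta>"
      using obtain_submset_size[of \<delta> "units \<eta>"] 2(2) size_eta by auto
    define \<kappa> where "\<kappa> = repeat_mset p (units \<beta>') + K"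
    define \<rho> where "\<rho> = sum_mset (units \<eta> - K)"
    have "0 \<notin># \<kappa>"
      using zero_notin_units[of \<eta>] zero_notin_units[of \<beta>'] mset_subset_eqD[OF K(1), of 0]
      by (auto simp: \<kappa>_def simp flip: count_greater_zero_iff)
    moreover have "size \<kappa> = d"
      using tail[of 0] by (simp add: \<kappa>_def K(2) \<delta>_def)
    moreover have "\<rho> \<noteq> 0"
    proof
      assume "\<rho> = 0"
      then have "x = 0" if "x \<in># units \<eta> - K" for x
        using that by (auto simp: \<rho>_def sum_mset_eq_0_iff')
      then have "units \<eta> - K = {#}"
        using zero_notin_units[of \<eta>] by (metis in_diffD multiset_nonemptyE)
      then show False
        using K 2(2) size_eta by (metis size_Diff_submset size_empty zero_less_diff less_irrefl)
    qed
    moreover have "sum_mset \<kappa> + \<rho> = \<beta>"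
    proof -
      have "sum_mset K + \<rho> = sum_mset (units \<eta>)"
        unfolding \<rho>_def sum_mset.union[symmetric] using K(1) by simp
      then show ?thesis
        by (subst decomp) (simp add: \<kappa>_def sum_mset_repeat sum_mset_units add.assoc)
    qed
    moreover have "\<forall>s. d div p ^ s \<le> div_sum p s \<kappa>"
      unfolding \<kappa>_def using K tail tail[of 0] by (intro allI mono) auto
    ultimately show ?thesis by blast
  qed
qed

text \<open>If p does not divide the gcd of \<beta>, adjoining the remainder to the multiset of
  \<open>exists_decomposition\<close> gives size d + 1, and the lower bound
  \<open>d div p ^ s\<close> meets the upper bound of \<open>div_sum_le\<close>. If p divides the
  gcd, a tight multiset for \<beta>/p and \<open>d div p\<close> is repeated p times.\<close>

lemma exists_tight:
  assumes "prime p" "keys \<beta> \<subseteq> {..<r}" "pos_poly (Qp_idx p r (lookup \<beta>) - Qp p d)"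
  shows "\<exists>\<kappa>. 0 \<notin># \<kappa> \<and> sum_mset \<kappa> = \<beta> \<and> d < size \<kappa> \<and> tight p \<kappa>"
  using assms(2,3)
proof (induction "exp_gcd \<beta>" arbitrary: \<beta> d rule: less_induct)
  case less
  have p2: "p \<ge> 2" using assms(1) by (rule prime_ge_2_nat)
  have b0: "\<beta> \<noteq> 0"
  proof
    assume "\<beta> = 0"
    then have "Qp_idx p r (lookup \<beta>) - Qp p d = - Qp p d"
      by (simp add: Qp_idx_def Qp_def)
    with less.prems(2) have "lead_coeff (Qp p d) < 0" by (simp add: pos_poly_def)
    then show False by (simp add: coeff_Qp[OF p2])
  qed
  show ?case
  proof (cases "p dvd exp_gcd \<beta>")
    case False
    obtain \<kappa>' \<rho> where k: "0 \<notin># \<kappa>'" "size \<kappa>' = d" "\<rho> \<noteq> 0" "sum_mset \<kappa>' + \<rho> = \<beta>"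
      "\<forall>s. d div p ^ s \<le> div_sum p s \<kappa>'"
      using exists_decomposition[OF p2 less.prems] by blast
    define \<kappa> where "\<kappa> = add_mset \<rho> \<kappa>'"
    have sum: "sum_mset \<kappa> = \<beta>" using k(4) by (simp add: \<kappa>_def add.commute)
    have "div_sum p s \<kappa> = d div p ^ s" if "s \<ge> 1" for s
    proof (rule antisym)
      have "\<not> p ^ s dvd exp_gcd \<beta>" using False that by (metis dvd_power dvd_trans zero_less_one order_less_le_trans)
      then show "div_sum p s \<kappa> \<le> d div p ^ s"
        using div_sum_le[of \<kappa> p s] sum p2 by (simp add: \<kappa>_def k(2))
      have "d div p ^ s \<le> div_sum p s \<kappa>'" using k(5) by blast
      also have "\<dots> \<le> div_sum p s \<kappa>" by (rule div_sum_mono) (simp add: \<kappa>_def)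
      finally show "d div p ^ s \<le> div_sum p s \<kappa>" .
    qed
    moreover have "\<not> p ^ s dvd exp_gcd \<beta>" if "s \<ge> 1" for s
      using False that by (metis dvd_power dvd_trans zero_less_one order_less_le_trans)
    ultimately have "tight p \<kappa>"
      by (simp add: tight_def sum) (simp add: \<kappa>_def k(2))
    with k sum show ?thesis by (intro exI[of _ \<kappa>]) (auto simp: \<kappa>_def)
  next
    case True
    define \<beta>' where "\<beta>' = sdiv \<beta> p"
    have beta: "\<beta> = smul p \<beta>'" using True by (simp add: \<beta>'_def smul_sdiv)
    have bg: "exp_gcd \<beta> = p * exp_gcd \<beta>'" by (simp add: beta exp_gcd_smul)
    have "exp_gcd \<beta>' < exp_gcd \<beta>" unfolding bg using b0 p2 bg
      by (intro n_less_m_mult_n) (auto intro: Nat.gr0I)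
    moreover have "keys \<beta>' \<subseteq> {..<r}"
      using less.prems(1) unfolding keys_subset_lessThan_iff \<beta>'_def lookup_sdiv by (metis div_0)
    moreover have "pos_poly (Qp_idx p r (lookup \<beta>') - Qp p (d div p))"
    proof -
      \<comment> \<open>The lowest digits of p \<beta>' are zero, so the constant coefficient is -(d
        mod p) \<le> 0 and positivity must come from the higher part.\<close>
      have "Qp_idx p r (lookup \<beta>) - Qp p d = pCons (- int (d mod p))
        (Qp_idx p r (lookup \<beta>') - Qp p (d div p))"
        using Qp_idx_rec[OF p2, of r "lookup \<beta>"] Qp_rec[OF p2, of d] p2
        by (simp add: beta)
      with less.prems(2) show ?thesis
        by (auto simp: pos_poly_pCons)
    qed
    ultimately obtain \<kappa>' where k: "0 \<notin># \<kappa>'" "sum_mset \<kappa>' = \<beta>'" "d div p < size \<kappa>'" "tight p \<kappa>'"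
      using less.hyps by blast
    define \<kappa> where "\<kappa> = repeat_mset p \<kappa>'"
    have sum: "sum_mset \<kappa> = \<beta>" by (simp add: \<kappa>_def sum_mset_repeat k(2) beta)
    \<comment> \<open>The off-by-one survives repetition: (p n - 1) div p = n - 1, so the floors of
      \<open>size \<kappa> - 1\<close> are those for \<kappa>' shifted by one position.\<close>
    have size: "(size \<kappa> - 1) div p = size \<kappa>' - 1"
    proof -
      obtain m where m: "size \<kappa>' = Suc m" using k(3) by (cases "size \<kappa>'") auto
      have "(p * Suc m - 1) div p = (p * m + (p - 1)) div p" using p2 by (simp add: algebra_simps)
      also have "\<dots> = m" using p2 by (subst div_mult_self4) auto
      finally show ?thesis by (simp add: \<kappa>_def m)
    qed
    have "tight p \<kappa>"
      unfolding tight_def sum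
    proof (intro allI impI)
      fix s :: nat assume "s \<ge> 1"
      then obtain t where s: "s = Suc t" by (cases s) auto
      have e: "div_sum p s \<kappa> = div_sum p t \<kappa>'" using p2 by (simp add: \<kappa>_def s div_sum_repeat)
      have dv: "p ^ s dvd exp_gcd \<beta> \<longleftrightarrow> p ^ t dvd exp_gcd \<beta>'" using p2 by (simp add: s bg)
      have dd: "(size \<kappa> - 1) div p ^ s = (size \<kappa>' - 1) div p ^ t"
        by (simp only: s power_Suc div_mult2_eq size)
      show "div_sum p s \<kappa> = of_bool (p ^ s dvd exp_gcd \<beta>) + (size \<kappa> - 1) div p ^ s"
        \<comment> \<open>\<open>tight\<close> says nothing at t = 0; there the identity is n = 1 +
          (n - 1) for the size n > 0 of \<kappa>'.\<close>
        using k(3,4) unfolding e dv dd by (cases "t = 0") (auto simp: tight_def k(2))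
    qed
    moreover have "d < size \<kappa>"
      using k(3) p2 by (simp add: \<kappa>_def dividend_less_times_div div_less_iff_less_mult mult.commute)
    moreover have "0 \<notin># \<kappa>" using k(1) by (auto simp: \<kappa>_def simp flip: count_greater_zero_iff)
    ultimately show ?thesis using sum by blast
  qed
qed

text \<open>Every non-zero vector has a coordinate that is at least 1, and floors are superadditive,
  so \<open>div_sum p s \<kappa>\<close> is at most the sum of the floors of the coordinates of the
  degree. Tightness and d \<le> n - 1 bound it below by \<open>d div p ^ s\<close>, and
  \<open>pos_poly_QpI\<close> applies.\<close>

lemma tight_imp_pos_poly:
  assumes "prime p" "keys (sum_mset \<kappa>) \<subseteq> {..<r}" "0 \<notin># \<kappa>" "d < size \<kappa>" "tight p \<kappa>"
  shows "pos_poly (Qp_idx p r (lookup (sum_mset \<kappa>)) - Qp p d)"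
proof -
  define \<beta> where "\<beta> = sum_mset \<kappa>"
  have p2: "p \<ge> 2" using assms(1) by (rule prime_ge_2_nat)
  have ge: "div_sum p s \<kappa> \<le> (\<Sum>i<r. lookup \<beta> i div p ^ s)" for s
  proof -
    have "1 \<le> (\<Sum>i<r. lookup x i)" if x: "x \<in># \<kappa>" for x
    proof -
      have "x \<noteq> 0" using x assms(3) by auto
      then obtain i where i: "lookup x i \<noteq> 0" by (auto simp: poly_mapping_eq_iff fun_eq_iff)
      have "lookup \<beta> i \<noteq> 0"
        using x i by (auto simp: \<beta>_def lookup_sum_mset)
      then have "i < r" using assms(2) by (simp add: keys_subset_lessThan_iff \<beta>_def)
      then have "lookup x i \<le> (\<Sum>i<r. lookup x i)" by (intro member_le_sum) auto
      with i show ?thesis by simp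
    qed
    then have "div_sum p s \<kappa> \<le> (\<Sum>x\<in>set_mset \<kappa>. count \<kappa> x div p ^ s * (\<Sum>i<r. lookup x i))"
      unfolding div_sum_def by (intro sum_mono) (simp add: mult_le_mono2[of 1, simplified])
    also have "\<dots> = (\<Sum>i<r. \<Sum>x\<in>set_mset \<kappa>. count \<kappa> x div p ^ s * lookup x i)"
      unfolding sum_distrib_left by (rule sum.swap)
    also have "\<dots> \<le> (\<Sum>i<r. lookup \<beta> i div p ^ s)"
    proof (rule sum_mono)
      fix i
      have "(\<Sum>x\<in>set_mset \<kappa>. count \<kappa> x div p ^ s * lookup x i) * p ^ s
          = (\<Sum>x\<in>set_mset \<kappa>. (count \<kappa> x div p ^ s * p ^ s) * lookup x i)"
        unfolding sum_distrib_right by (simp only: mult_ac)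
      also have "\<dots> \<le> (\<Sum>x\<in>set_mset \<kappa>. count \<kappa> x * lookup x i)"
        by (intro sum_mono mult_right_mono) (auto simp: div_times_less_eq_dividend)
      also have "\<dots> = lookup \<beta> i" by (simp add: \<beta>_def lookup_sum_mset sum_mset_set_mset)
      finally show "(\<Sum>x\<in>set_mset \<kappa>. count \<kappa> x div p ^ s * lookup x i) \<le> lookup \<beta> i div p ^ s"
        using p2 by (simp add: less_eq_div_iff_mult_less_eq)
    qed
    finally show ?thesis .
  qed
  have "pos_poly (Qp_idx p r (lookup \<beta>) - Qp p d)"
  proof (rule pos_poly_QpI[OF p2])
    show "d < (\<Sum>i<r. lookup \<beta> i)" using ge[of 0] assms(4) by simp
    fix s
    show "d div p ^ s \<le> (\<Sum>i<r. lookup \<beta> i div p ^ s)"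
    proof (cases "s = 0")
      case True
      with ge[of 0] assms(4) show ?thesis by simp
    next
      case False
      have "d div p ^ s \<le> (size \<kappa> - 1) div p ^ s" using assms(4) by (intro div_le_mono) simp
      also have "\<dots> \<le> div_sum p s \<kappa>" using assms(5) False by (simp add: tight_def)
      finally show ?thesis using ge[of s] by simp
    qed
  qed
  then show ?thesis by (simp add: \<beta>_def)
qed

section \<open>Monomials and their types\<close>

type_synonym mono = "(nat \<times> nat) \<Rightarrow>\<^sub>0 nat"

definition row :: "mono \<Rightarrow> nat \<Rightarrow> expo" where
  "row M j = Poly_Mapping.map_key (Pair j) M"

lemma lookup_row [simp]: "lookup (row M j) i = lookup M (j, i)"
  by (simp add: row_def Poly_Mapping.map_key.rep_eq inj_def)

definition msupp :: "mono \<Rightarrow> nat set" where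
  "msupp M = {j. row M j \<noteq> 0}"

text \<open>The invariant of a monomial under permutation of the tensor factors. Zero rows are left
  out, so a type does not refer to the number of factors.\<close>

definition mtype :: "mono \<Rightarrow> expo multiset" where
  "mtype M = image_mset (row M) (mset_set (msupp M))"

definition build :: "nat set \<Rightarrow> (nat \<Rightarrow> expo) \<Rightarrow> mono" where
  "build T f = (\<Sum>j\<in>T. \<Sum>i\<in>keys (f j). Poly_Mapping.single (j, i) (lookup (f j) i))"

lemma mono_eqI: "(\<And>j. row M j = row N j) \<Longrightarrow> M = N"
  by (rule poly_mapping_eqI) (metis lookup_row surj_pair)

lemma row_add [simp]: "row (M + N) j = row M j + row N j"
  by (rule poly_mapping_eqI) (simp add: lookup_add)

lemma msupp_eq: "msupp M = fst ` keys M"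
proof -
  have *: "j \<in> msupp M \<longleftrightarrow> (\<exists>i. (j, i) \<in> keys M)" for j
    unfolding msupp_def in_keys_iff poly_mapping_eq_iff fun_eq_iff by simp
  show ?thesis
  proof (intro set_eqI iffI)
    fix j assume "j \<in> fst ` keys M"
    then show "j \<in> msupp M" unfolding * by (metis imageE prod.collapse)
  next
    fix j assume "j \<in> msupp M"
    then show "j \<in> fst ` keys M" unfolding * by (metis fst_conv imageI)
  qed
qed

lemma finite_msupp [simp]: "finite (msupp M)"
  by (simp add: msupp_eq)

lemma row_eq_0_iff: "row M j = 0 \<longleftrightarrow> j \<notin> msupp M"
  by (simp add: msupp_def)

lemma expo_add_eq_0_iff: "(x::expo) + y = 0 \<longleftrightarrow> x = 0 \<and> y = 0"
  by (auto simp: poly_mapping_eq_iff fun_eq_iff lookup_add)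

lemma msupp_add: "msupp (M + N) = msupp M \<union> msupp N"
  by (auto simp: msupp_def expo_add_eq_0_iff)

lemma size_mtype [simp]: "size (mtype M) = card (msupp M)"
  by (simp add: mtype_def)

lemma zero_notin_mtype [simp]: "0 \<notin># mtype M"
  by (auto simp: mtype_def row_eq_0_iff)

lemma set_mset_mtype: "set_mset (mtype M) = row M ` msupp M"
  by (simp add: mtype_def)

lemma image_mset_row:
  assumes "finite T" "msupp M \<subseteq> T"
  shows "image_mset (row M) (mset_set T) = mtype M + replicate_mset (card T - card (msupp M)) 0"
proof -
  have "mset_set T = mset_set (msupp M) + mset_set (T - msupp M)"
    using assms by (subst mset_set_Union[symmetric]) (auto simp: Un_absorb1)
  moreover have "image_mset (row M) (mset_set (T - msupp M)) = image_mset (\<lambda>_. 0) (mset_set (T - msupp M))"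
    by (rule image_mset_cong) (use assms in \<open>auto simp: row_eq_0_iff\<close>)
  ultimately show ?thesis
    using assms by (simp add: mtype_def image_mset_const_eq card_Diff_subset)
qed

lemma sum_mtype_superset:
  assumes "finite T" "msupp M \<subseteq> T"
  shows "sum_mset (mtype M) = (\<Sum>j\<in>T. row M j)"
proof -
  have "sum_mset (mtype M) = (\<Sum>j\<in>msupp M. row M j)"
    by (simp add: mtype_def sum_unfold_sum_mset)
  also have "\<dots> = (\<Sum>j\<in>T. row M j)"
    using assms by (intro sum.mono_neutral_left) (auto simp: row_eq_0_iff)
  finally show ?thesis .
qed

lemma sum_mtype_add: "sum_mset (mtype (M + N)) = sum_mset (mtype M) + sum_mset (mtype N)"
proof -
  have "sum_mset (mtype K) = (\<Sum>j\<in>msupp M \<union> msupp N. row K j)"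
    if "K \<in> {M, N, M + N}" for K
    using that by (intro sum_mtype_superset) (auto simp: msupp_add)
  then show ?thesis by (simp add: sum.distrib)
qed

lemma lookup_build:
  assumes "finite T"
  shows "lookup (build T f) (j, i) = (if j \<in> T then lookup (f j) i else 0)"
proof -
  have "lookup (\<Sum>i'\<in>keys (f j'). Poly_Mapping.single (j', i') (lookup (f j') i')) (j, i)
      = (if j' = j then lookup (f j) i else 0)" for j'
  proof (cases "j' = j")
    case True
    have "lookup (\<Sum>i'\<in>keys (f j'). Poly_Mapping.single (j', i') (lookup (f j') i')) (j, i)
      = (\<Sum>i'\<in>keys (f j). if i' = i then lookup (f j) i' else 0)"
      unfolding lookup_sum by (rule sum.cong) (auto simp: True lookup_single when_def)
    with True show ?thesis by (simp add: in_keys_iff)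
  qed (simp add: lookup_sum lookup_single when_def)
  then show ?thesis using assms by (simp add: build_def lookup_sum)
qed

lemma row_build: "finite T \<Longrightarrow> row (build T f) j = (if j \<in> T then f j else 0)"
  by (rule poly_mapping_eqI) (simp add: lookup_build)

lemma msupp_build: "finite T \<Longrightarrow> (\<And>j. j \<in> T \<Longrightarrow> f j \<noteq> 0) \<Longrightarrow> msupp (build T f) = T"
  by (auto simp: msupp_def row_build split: if_splits)

lemma mtype_build:
  assumes "finite T" "\<And>j. j \<in> T \<Longrightarrow> f j \<noteq> 0"
  shows "mtype (build T f) = image_mset f (mset_set T)"
proof -
  have "msupp (build T f) = T" using assms by (rule msupp_build)
  then show ?thesis
    using assms(1) by (auto simp: mtype_def row_build intro!: image_mset_cong)
qed

lemma lookup_perm_mono [simp]: "inj \<sigma> \<Longrightarrow> lookup (perm_mono \<sigma> M) (j, i) = lookup M (\<sigma> j, i)"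
proof -
  assume "inj \<sigma>"
  then have "inj (\<lambda>(j, i). (\<sigma> j, i :: nat))" by (auto simp: inj_def)
  then show ?thesis by (simp add: perm_mono_def Poly_Mapping.map_key.rep_eq)
qed

lemma row_perm_mono [simp]: "inj \<sigma> \<Longrightarrow> row (perm_mono \<sigma> M) j = row M (\<sigma> j)"
  by (rule poly_mapping_eqI) simp

lemma perm_mono_add: "inj \<sigma> \<Longrightarrow> perm_mono \<sigma> (M + N) = perm_mono \<sigma> M + perm_mono \<sigma> N"
  by (rule mono_eqI) simp

lemma msupp_perm_mono: "inj \<sigma> \<Longrightarrow> msupp (perm_mono \<sigma> M) = \<sigma> -` msupp M"
  by (auto simp: msupp_def)

lemma mtype_perm_mono:
  assumes "bij \<sigma>"
  shows "mtype (perm_mono \<sigma> M) = mtype M"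
proof -
  have inj: "inj \<sigma>" and surj: "surj \<sigma>" using assms by (auto simp: bij_def)
  have "row (perm_mono \<sigma> M) = row M \<circ> \<sigma>" using inj by auto
  then have "mtype (perm_mono \<sigma> M) = image_mset (row M) (image_mset \<sigma> (mset_set (\<sigma> -` msupp M)))"
    by (simp add: mtype_def msupp_perm_mono[OF inj] multiset.map_comp)
  also have "image_mset \<sigma> (mset_set (\<sigma> -` msupp M)) = mset_set (\<sigma> ` (\<sigma> -` msupp M))"
    using inj by (intro image_mset_mset_set) (auto simp: inj_on_def inj_def)
  also have "\<sigma> ` (\<sigma> -` msupp M) = msupp M"
    using surj by (simp add: surj_image_vimage_eq)
  finally show ?thesis by (simp add: mtype_def)
qed

lemma inj_perm_mono: "bij \<sigma> \<Longrightarrow> inj (perm_mono \<sigma>)"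
proof (rule injI)
  fix M N assume b: "bij \<sigma>" and eq: "perm_mono \<sigma> M = perm_mono \<sigma> N"
  have inj: "inj \<sigma>" using b by (auto simp: bij_def)
  show "M = N"
  proof (rule mono_eqI)
    fix j
    obtain i where "j = \<sigma> i" using b by (metis bij_pointE)
    then show "row M j = row N j"
      using arg_cong[OF eq, of "\<lambda>K. row K i"] inj by simp
  qed
qed

text \<open>Padding both types with zero rows up to \<open>card T\<close> makes the row multisets
  over T equal, so a permutation of T matches the rows. Types thus classify orbits of
  monomials.\<close>

lemma mtype_eq_imp_perm:
  assumes "finite T" "msupp M \<subseteq> T" "msupp N \<subseteq> T" "mtype M = mtype N"
  obtains \<sigma> where "\<sigma> permutes T" "N = perm_mono \<sigma> M"
proof -
  have "card (msupp M) = card (msupp N)"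
    using arg_cong[OF assms(4), of size] by simp
  then have "image_mset (row N) (mset_set T) = image_mset (row M) (mset_set T)"
    using assms by (simp add: image_mset_row)
  from image_mset_eq_implies_permutes[OF assms(1) this] obtain \<sigma> where
    \<sigma>: "\<sigma> permutes T" "\<forall>x\<in>T. row N x = row M (\<sigma> x)" by blast
  have "N = perm_mono \<sigma> M"
  proof (rule mono_eqI)
    fix j
    have inj: "inj \<sigma>" using \<sigma>(1) by (rule permutes_inj)
    show "row N j = row (perm_mono \<sigma> M) j"
    proof (cases "j \<in> T")
      case False
      then have "row N j = 0" "row M j = 0" using assms by (auto simp: row_eq_0_iff)
      with False show ?thesis using \<sigma>(1) inj by (simp add: permutes_not_in)
    qed (use \<sigma>(2) inj in simp)
  qed
  with \<sigma>(1) show thesis by (rule that)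
qed

text \<open>A monomial of the given type whose rows fill the first \<open>size \<kappa>\<close>
  factors in an arbitrarily chosen order. Coefficients of symmetric tensors are read off
  here.\<close>

definition rep :: "expo multiset \<Rightarrow> mono" where
  "rep \<kappa> = build {..<size \<kappa>} (\<lambda>j. (SOME xs. mset xs = \<kappa>) ! j)"

lemma
  assumes "0 \<notin># \<kappa>"
  shows mtype_rep: "mtype (rep \<kappa>) = \<kappa>" and msupp_rep: "msupp (rep \<kappa>) = {..<size \<kappa>}"
proof -
  define xs where "xs = (SOME xs. mset xs = \<kappa>)"
  have xs: "mset xs = \<kappa>" unfolding xs_def using ex_mset by (rule someI_ex)
  have len: "size \<kappa> = length xs" using xs by auto
  have nz: "xs ! j \<noteq> 0" if "j < length xs" for j
    using that assms xs by (metis nth_mem_mset)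
  have rep: "rep \<kappa> = build {..<length xs} (\<lambda>j. xs ! j)"
    by (simp add: rep_def len xs_def)
  show "msupp (rep \<kappa>) = {..<size \<kappa>}"
    unfolding rep len using nz by (intro msupp_build) auto
  have "mtype (rep \<kappa>) = image_mset (\<lambda>j. xs ! j) (mset_set {..<length xs})"
    unfolding rep using nz by (intro mtype_build) auto
  also have "\<dots> = mset (map (\<lambda>j. xs ! j) [0..<length xs])"
    by (simp add: lessThan_atLeast0)
  finally show "mtype (rep \<kappa>) = \<kappa>" by (simp add: map_nth xs)
qed

lemma finite_below: "finite {u :: 'b \<Rightarrow>\<^sub>0 nat. \<forall>x. lookup u x \<le> lookup M x}"
proof (rule inj_on_finite)
  let ?f = "\<lambda>u :: 'b \<Rightarrow>\<^sub>0 nat. restrict (lookup u) (keys M)"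
  show "inj_on ?f {u. \<forall>x. lookup u x \<le> lookup M x}"
  proof (rule inj_onI)
    fix u v assume uv: "u \<in> {u. \<forall>x. lookup u x \<le> lookup M x}" "v \<in> {u. \<forall>x. lookup u x \<le> lookup M x}"
      and eq: "?f u = ?f v"
    show "u = v"
    proof (rule poly_mapping_eqI)
      fix x show "lookup u x = lookup v x"
      proof (cases "x \<in> keys M")
        case True then show ?thesis using fun_cong[OF eq, of x] by simp
      next
        case False
        then have "lookup M x = 0" by (simp add: in_keys_iff)
        with uv show ?thesis by (metis le_zero_eq mem_Collect_eq)
      qed
    qed
  qed
  show "?f ` {u. \<forall>x. lookup u x \<le> lookup M x} \<subseteq> PiE (keys M) (\<lambda>x. {..lookup M x})"
    by auto
  show "finite (PiE (keys M) (\<lambda>x. {..lookup M x}))"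
    by (intro finite_PiE) auto
qed

definition total_deg :: "expo \<Rightarrow> nat" where
  "total_deg x = (\<Sum>i\<in>keys x. lookup x i)"

lemma total_deg_add: "total_deg (x + y) = total_deg x + total_deg y"
  unfolding total_deg_def by (rule setsum_keys_plus_distrib) auto

lemma total_deg_0 [simp]: "total_deg 0 = 0"
  by (simp add: total_deg_def)

lemma total_deg_pos: "x \<noteq> 0 \<Longrightarrow> total_deg x > 0"
proof -
  assume "x \<noteq> 0"
  then obtain i where i: "lookup x i \<noteq> 0" by (auto simp: poly_mapping_eq_iff fun_eq_iff)
  then have "lookup x i \<le> total_deg x"
    unfolding total_deg_def by (intro member_le_sum) (auto simp: in_keys_iff)
  with i show ?thesis by simp
qed

lemma size_le_total_deg: "0 \<notin># \<kappa> \<Longrightarrow> size \<kappa> \<le> total_deg (sum_mset \<kappa>)"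
proof (induction \<kappa>)
  case (add x \<kappa>)
  then have "size \<kappa> \<le> total_deg (sum_mset \<kappa>)" "total_deg x > 0" by (auto intro: total_deg_pos)
  then show ?case by (simp add: total_deg_add)
qed simp

definition types :: "expo \<Rightarrow> expo multiset set" where
  "types \<beta> = {\<kappa>. 0 \<notin># \<kappa> \<and> sum_mset \<kappa> = \<beta>}"

lemma lookup_le_sum_mset: "x \<in># \<kappa> \<Longrightarrow> lookup x i \<le> lookup (sum_mset (\<kappa> :: expo multiset)) i"
  by (induction \<kappa>) (auto simp: lookup_add)

lemma row_in_mtype: "j \<in> msupp M \<Longrightarrow> row M j \<in># mtype M"
  by (simp add: set_mset_mtype)

lemma finite_support_type:
  assumes "finite T"
  shows "finite {M. msupp M \<subseteq> T \<and> sum_mset (mtype M) = \<beta>}"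
proof (rule finite_subset[OF _ finite_below[of "build T (\<lambda>_. \<beta>)"]], safe)
  fix M j i assume M: "msupp M \<subseteq> T" "\<beta> = sum_mset (mtype M)"
  show "lookup M (j, i) \<le> lookup (build T (\<lambda>_. sum_mset (mtype M))) (j, i)"
  proof (cases "j \<in> msupp M")
    case True
    then show ?thesis
      using M assms lookup_le_sum_mset[OF row_in_mtype[OF True], of i] by (auto simp: lookup_build)
  next
    case False
    then have "lookup (row M j) i = 0" by (simp add: row_eq_0_iff[symmetric] del: lookup_row)
    then show ?thesis by simp
  qed
qed

lemma finite_types [simp]: "finite (types \<beta>)"
proof (rule finite_subset)
  show "finite (mtype ` {M. msupp M \<subseteq> {..<total_deg \<beta>} \<and> sum_mset (mtype M) = \<beta>})"
    by (intro finite_imageI finite_support_type) simp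
  show "types \<beta> \<subseteq> mtype ` {M. msupp M \<subseteq> {..<total_deg \<beta>} \<and> sum_mset (mtype M) = \<beta>}"
  proof
    fix \<kappa> assume "\<kappa> \<in> types \<beta>"
    then have "0 \<notin># \<kappa>" "sum_mset \<kappa> = \<beta>" by (auto simp: types_def)
    then show "\<kappa> \<in> mtype ` {M. msupp M \<subseteq> {..<total_deg \<beta>} \<and> sum_mset (mtype M) = \<beta>}"
      using size_le_total_deg[of \<kappa>] by (intro image_eqI[of _ _ "rep \<kappa>"]) (auto simp: mtype_rep msupp_rep)
  qed
qed

section \<open>Structure constants of products and the number of monomials of a type\<close>

definition pairs :: "expo multiset \<Rightarrow> expo multiset \<Rightarrow> mono \<Rightarrow> (mono \<times> mono) set" where
  "pairs \<mu> \<nu> M = {(u, v). u + v = M \<and> mtype u = \<mu> \<and> mtype v = \<nu>}"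

lemma finite_pairs [simp]: "finite (pairs \<mu> \<nu> M)"
proof (rule finite_subset)
  show "pairs \<mu> \<nu> M \<subseteq> {u. \<forall>x. lookup u x \<le> lookup M x} \<times> {u. \<forall>x. lookup u x \<le> lookup M x}"
    by (auto simp: pairs_def lookup_add)
qed (intro finite_cartesian_product finite_below)

text \<open>This is the coefficient of M in the product of the orbit sums of \<mu> and \<nu>. It
  depends only on the type of M and is the same for every number of factors that has room for
  M.\<close>

definition ncount :: "expo multiset \<Rightarrow> expo multiset \<Rightarrow> mono \<Rightarrow> nat" where
  "ncount \<mu> \<nu> M = card (pairs \<mu> \<nu> M)"

text \<open>A permutation maps pairs injectively to pairs. The equality follows in
  \<open>ncount_cong\<close> by applying this in both directions.\<close>

lemma ncount_perm_le: "bij \<sigma> \<Longrightarrow> ncount \<mu> \<nu> M \<le> ncount \<mu> \<nu> (perm_mono \<sigma> M)"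
  unfolding ncount_def
proof (rule card_inj_on_le)
  assume b: "bij \<sigma>"
  then have inj: "inj \<sigma>" by (simp add: bij_def)
  show "inj_on (map_prod (perm_mono \<sigma>) (perm_mono \<sigma>)) (pairs \<mu> \<nu> M)"
    using inj_perm_mono[OF b] by (auto simp: inj_on_def inj_def)
  show "map_prod (perm_mono \<sigma>) (perm_mono \<sigma>) ` pairs \<mu> \<nu> M \<subseteq> pairs \<mu> \<nu> (perm_mono \<sigma> M)"
    by (auto simp: pairs_def mtype_perm_mono[OF b] perm_mono_add[OF inj])
qed simp

lemma ncount_cong:
  assumes "mtype M = mtype N"
  shows "ncount \<mu> \<nu> M = ncount \<mu> \<nu> N"
proof -
  have "ncount \<mu> \<nu> K \<le> ncount \<mu> \<nu> L" if eq: "mtype K = mtype L" for K L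
  proof -
    obtain \<sigma> where "\<sigma> permutes (msupp K \<union> msupp L)" "L = perm_mono \<sigma> K"
      using mtype_eq_imp_perm[of "msupp K \<union> msupp L" K L] eq by auto
    then show ?thesis using ncount_perm_le permutes_bij by blast
  qed
  from this[OF assms] this[OF assms[symmetric]] show ?thesis by simp
qed

text \<open>With T listed in increasing order, a monomial with support T is the list of its rows,
  that is, an arrangement of \<kappa>.\<close>

lemma card_fixed_support:
  assumes "finite T" "0 \<notin># \<kappa>" "card T = size \<kappa>"
  shows "card {M. msupp M = T \<and> mtype M = \<kappa>} = card (permutations_of_multiset \<kappa>)"
proof (rule bij_betw_same_card)
  let ?js = "sorted_list_of_set T"
  have len: "length ?js = size \<kappa>" using assms(3) by simp
  have set: "set ?js = T" and dist: "distinct ?js" using assms(1) by auto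
  have mset: "mset ?js = mset_set T" using mset_set_set[OF dist] set by simp
  show "bij_betw (\<lambda>M. map (row M) ?js) {M. msupp M = T \<and> mtype M = \<kappa>} (permutations_of_multiset \<kappa>)"
  proof (rule bij_betw_imageI)
    show "inj_on (\<lambda>M. map (row M) ?js) {M. msupp M = T \<and> mtype M = \<kappa>}"
    proof (rule inj_onI)
      fix M N assume *: "M \<in> {M. msupp M = T \<and> mtype M = \<kappa>}" "N \<in> {M. msupp M = T \<and> mtype M = \<kappa>}"
        "map (row M) ?js = map (row N) ?js"
      have "row M j = row N j" for j
      proof (cases "j \<in> T")
        case True with *(3) set show ?thesis by (metis map_eq_conv)
      next
        case False
        then have "row M j = 0" "row N j = 0" using * by (auto simp: row_eq_0_iff)
        then show ?thesis by simp
      qed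
      then show "M = N" by (rule mono_eqI)
    qed
    show "(\<lambda>M. map (row M) ?js) ` {M. msupp M = T \<and> mtype M = \<kappa>} = permutations_of_multiset \<kappa>"
    proof (intro equalityI subsetI)
      fix xs assume "xs \<in> (\<lambda>M. map (row M) ?js) ` {M. msupp M = T \<and> mtype M = \<kappa>}"
      then show "xs \<in> permutations_of_multiset \<kappa>"
        using mset by (auto simp: permutations_of_multiset_def mtype_def)
    next
      fix xs assume "xs \<in> permutations_of_multiset \<kappa>"
      then have xs: "mset xs = \<kappa>" by (simp add: permutations_of_multiset_def)
      then have lenxs: "length xs = length ?js" using len by auto
      define f where "f j = the (map_of (zip ?js xs) j)" for j
      have f: "map f ?js = xs"
      proof (rule nth_equalityI)
        fix i assume "i < length (map f ?js)"
        then show "map f ?js ! i = xs ! i"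
          using lenxs dist by (simp add: f_def map_of_zip_nth)
      qed (simp add: lenxs)
      have nz: "f j \<noteq> 0" if "j \<in> T" for j
      proof -
        have "f j \<in> set xs" using that set f by (metis image_eqI list.set_map)
        then show ?thesis using xs assms(2) by auto
      qed
      have "mtype (build T f) = image_mset f (mset_set T)"
        using assms(1) nz by (rule mtype_build)
      also have "\<dots> = mset (map f ?js)" using mset by simp
      finally have "mtype (build T f) = \<kappa>" by (simp only: f xs)
      moreover have "msupp (build T f) = T" using assms(1) nz by (rule msupp_build)
      moreover have "map (row (build T f)) ?js = xs"
        unfolding f[symmetric] by (rule map_cong) (use set assms(1) in \<open>simp_all add: row_build\<close>)
      ultimately show "xs \<in> (\<lambda>M. map (row M) ?js) ` {M. msupp M = T \<and> mtype M = \<kappa>}" by blast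
    qed
  qed
qed

definition monoset :: "nat \<Rightarrow> expo multiset \<Rightarrow> mono set" where
  "monoset D \<kappa> = {M. msupp M \<subseteq> {..<D} \<and> mtype M = \<kappa>}"

lemma finite_monoset [simp]: "finite (monoset D \<kappa>)"
  unfolding monoset_def by (rule finite_subset[OF _ finite_support_type[of "{..<D}" "sum_mset \<kappa>"]]) auto

text \<open>Every support of the right size carries the same number of monomials of type \<kappa>,
  so a weight that sees only the support factors out.\<close>

lemma sum_monoset_by_support:
  fixes h :: "nat set \<Rightarrow> rat"
  assumes "0 \<notin># \<kappa>"
  shows "(\<Sum>M\<in>monoset D \<kappa>. h (msupp M))
    = of_nat (card (permutations_of_multiset \<kappa>)) * (\<Sum>T | T \<subseteq> {..<D} \<and> card T = size \<kappa>. h T)"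
proof -
  let ?\<T> = "{T. T \<subseteq> {..<D} \<and> card T = size \<kappa>}"
  have "(\<Sum>M\<in>monoset D \<kappa>. h (msupp M)) = (\<Sum>T\<in>?\<T>. \<Sum>M\<in>{M \<in> monoset D \<kappa>. msupp M = T}. h (msupp M))"
    by (rule sum.group[symmetric], simp, simp) (auto simp: monoset_def)
  also have "\<dots> = (\<Sum>T\<in>?\<T>. of_nat (card (permutations_of_multiset \<kappa>)) * h T)"
  proof (rule sum.cong[OF refl])
    fix T assume T: "T \<in> ?\<T>"
    then have "{M \<in> monoset D \<kappa>. msupp M = T} = {M. msupp M = T \<and> mtype M = \<kappa>}"
      by (auto simp: monoset_def)
    moreover have "card {M. msupp M = T \<and> mtype M = \<kappa>} = card (permutations_of_multiset \<kappa>)"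
      using T assms by (intro card_fixed_support) (auto intro: finite_subset)
    ultimately show "(\<Sum>M\<in>{M \<in> monoset D \<kappa>. msupp M = T}. h (msupp M))
        = of_nat (card (permutations_of_multiset \<kappa>)) * h T"
      by simp
  qed
  finally show ?thesis by (simp add: sum_distrib_left)
qed

lemma card_monoset:
  assumes "0 \<notin># \<kappa>"
  shows "card (monoset D \<kappa>) = card (permutations_of_multiset \<kappa>) * (D choose size \<kappa>)"
proof -
  have "rat_of_nat (card (monoset D \<kappa>)) = rat_of_nat (card (permutations_of_multiset \<kappa>) * (D choose size \<kappa>))"
    using sum_monoset_by_support[OF assms, of "\<lambda>_. 1" D] by (simp add: n_subsets)
  then show ?thesis by (simp only: of_nat_eq_iff)
qed

section \<open>Vanishing of the logarithm coefficients on products\<close>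

text \<open>There are (D choose n) supports of size n, and c(\<kappa>) is b/n times the number of
  arrangements of \<kappa>. So this weight spreads (-1)^n c(\<kappa>) / b evenly over the monomials
  of type \<kappa> in D factors, and it depends only on the size of the support.\<close>

definition wt :: "nat \<Rightarrow> nat \<Rightarrow> rat" where
  "wt D n = (- 1) ^ n / (of_nat n * of_nat (D choose n))"

text \<open>Counting the sets \<open>T\<close> by \<open>i = card (T - S)\<close> turns the sum into a multiple of the coefficient of
  \<open>t\<^sup>l\<close> in \<open>(1 + t)\<^sup>-\<^sup>k (1 + t)\<^sup>k\<close>, where \<open>k = card S\<close>.\<close>
lemma sum_wt_eq_0:
  assumes "S \<subseteq> {..<D}" "S \<noteq> {}" "l > 0" "card S + l \<le> D"
  shows "(\<Sum>T | T \<subseteq> {..<D} \<and> card T = l. wt D (card (S \<union> T))) = 0"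
proof -
  define k where "k = card S"
  define C where "C = {..<D} - S"
  let ?\<T> = "{T. T \<subseteq> {..<D} \<and> card T = l}"
  have finS: "finite S" using assms(1) finite_subset by blast
  have finC: "finite C" by (simp add: C_def)
  have k: "k > 0" using assms(2) finS by (simp add: k_def card_gt_0_iff)
  have cardC: "card C = D - k" using assms(1) finS by (simp add: C_def k_def card_Diff_subset)
  \<comment> \<open>T is determined by its parts V outside S and U inside S, which are chosen
    independently.\<close>
  have cnt: "card {T \<in> ?\<T>. card (T - S) = i} = (D - k choose i) * (k choose (l - i))" if "i \<le> l" for i
  proof -
    let ?P = "{V. V \<subseteq> C \<and> card V = i} \<times> {U. U \<subseteq> S \<and> card U = l - i}"
    have "bij_betw (\<lambda>(V, U). V \<union> U) ?P {T \<in> ?\<T>. card (T - S) = i}"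
    proof (rule bij_betw_byWitness[where f' = "\<lambda>T. (T - S, T \<inter> S)"])
      show "\<forall>a\<in>?P. (\<lambda>T. (T - S, T \<inter> S)) ((\<lambda>(V, U). V \<union> U) a) = a"
        by (auto simp: C_def)
      show "\<forall>T\<in>{T \<in> ?\<T>. card (T - S) = i}. (\<lambda>(V, U). V \<union> U) (T - S, T \<inter> S) = T"
        by auto
      show "(\<lambda>(V, U). V \<union> U) ` ?P \<subseteq> {T \<in> ?\<T>. card (T - S) = i}"
      proof safe
        fix V U assume *: "V \<subseteq> C" "U \<subseteq> S" "i = card V" "card U = l - card V"
        have "V \<inter> U = {}" using * by (auto simp: C_def)
        then show "card (V \<union> U) = l"
          using * that finS finC by (subst card_Un_disjoint) (auto intro: finite_subset)
        have "V \<union> U - S = V" using * by (auto simp: C_def)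
        then show "card (V \<union> U - S) = card V" by simp
      qed (use assms(1) in \<open>auto simp: C_def\<close>)
      show "(\<lambda>T. (T - S, T \<inter> S)) ` {T \<in> ?\<T>. card (T - S) = i} \<subseteq> ?P"
      proof (clarsimp simp: C_def, intro conjI)
        fix T assume *: "T \<subseteq> {..<D}" "l = card T" "i = card (T - S)"
        have "finite T" using *(1) finite_subset by blast
        have "card T = card (T - S) + card (T \<inter> S)"
          using \<open>finite T\<close> by (subst card_Un_disjoint[symmetric]) (auto simp: Un_Diff_Int)
        then show "card (T \<inter> S) = card T - card (T - S)" by simp
      qed auto
    qed
    then have "card {T \<in> ?\<T>. card (T - S) = i} = card ?P" by (simp add: bij_betw_same_card)
    also have "\<dots> = (D - k choose i) * (k choose (l - i))"
      using finS finC by (simp add: card_cartesian_product n_subsets cardC k_def)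
    finally show ?thesis .
  qed
  \<comment> \<open>The part that does not depend on i: written with factorials, (D - k choose i) /
    ((k + i) (D choose k + i)) is this constant times (k + i - 1 choose i), which is (-k choose i)
    up to sign.\<close>
  define c where "c = (fact (D - k) * fact (k - 1) / fact D :: rat)"
  have wt: "of_nat ((D - k choose i) * (k choose (l - i))) * wt D (k + i)
      = (- 1) ^ k * c * ((- of_nat k gchoose i) * (of_nat k gchoose (l - i)))" if "i \<le> l" for i
  proof -
    have "k + i \<le> D" using that assms(4) by (simp add: k_def)
    obtain k' where k': "k = Suc k'" using k by (cases k) auto
    have "of_nat (D - k choose i) / (of_nat (k + i) * of_nat (D choose (k + i)))
       = c * of_nat (k + i - 1 choose i)"
      using \<open>k + i \<le> D\<close> unfolding c_def k'
      by (simp add: binomial_fact field_simps del: fact_Suc of_nat_Suc of_nat_add)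
         (simp add: field_simps)
    moreover have "(- of_nat k gchoose i :: rat) = (- 1) ^ i * of_nat (k + i - 1 choose i)"
      using k by (simp add: gbinomial_minus binomial_gbinomial of_nat_diff)
    moreover have "(of_nat k gchoose (l - i) :: rat) = of_nat (k choose (l - i))"
      by (simp add: binomial_gbinomial)
    moreover have "of_nat ((D - k choose i) * (k choose (l - i))) * wt D (k + i)
      = (- 1) ^ (k + i) * of_nat (k choose (l - i))
        * (of_nat (D - k choose i) / (of_nat (k + i) * of_nat (D choose (k + i))))"
      unfolding wt_def by (simp only: of_nat_mult times_divide_eq_right times_divide_eq_left mult_ac)
    ultimately show ?thesis by (simp only: power_add mult_ac)
  qed
  have "(\<Sum>T\<in>?\<T>. wt D (card (S \<union> T)))
      = (\<Sum>i\<in>{0..l}. \<Sum>T\<in>{T \<in> ?\<T>. card (T - S) = i}. wt D (card (S \<union> T)))"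
    by (rule sum.group[symmetric]) (auto intro!: card_mono dest: finite_subset[OF _ finite_lessThan])
  also have "\<dots> = (\<Sum>i\<in>{0..l}. of_nat ((D - k choose i) * (k choose (l - i))) * wt D (k + i))"
  proof (rule sum.cong[OF refl])
    fix i assume i: "i \<in> {0..l}"
    have "card (S \<union> T) = k + i" if "T \<in> ?\<T>" "card (T - S) = i" for T
    proof -
      have "finite T" using that finite_subset by blast
      then have "card (S \<union> (T - S)) = card S + card (T - S)"
        using finS by (intro card_Un_disjoint) auto
      with that show ?thesis by (simp add: k_def)
    qed
    then have "(\<Sum>T\<in>{T \<in> ?\<T>. card (T - S) = i}. wt D (card (S \<union> T)))
        = of_nat (card {T \<in> ?\<T>. card (T - S) = i}) * wt D (k + i)"
      by simp
    then show "(\<Sum>T\<in>{T \<in> ?\<T>. card (T - S) = i}. wt D (card (S \<union> T)))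
        = of_nat ((D - k choose i) * (k choose (l - i))) * wt D (k + i)"
      using cnt i by simp
  qed
  also have "\<dots> = (\<Sum>i\<in>{0..l}. (- 1) ^ k * c * ((- of_nat k gchoose i) * (of_nat k gchoose (l - i))))"
    by (rule sum.cong[OF refl], rule wt) simp
  \<comment> \<open>Vandermonde's convolution for the upper arguments -k and k, which cancel; (0
    choose l) is zero because l > 0.\<close>
  also have "\<dots> = (- 1) ^ k * c * ((- of_nat k + of_nat k) gchoose l)"
    by (simp add: gbinomial_Vandermonde flip: sum_distrib_left)
  also have "\<dots> = 0" using assms(3) by (simp add: gbinomial_0(2) gr0_conv_Suc) (auto simp: gr0_conv_Suc)
  finally show ?thesis .
qed

definition phi :: "expo multiset \<Rightarrow> int" where
  "phi \<kappa> = (- 1) ^ size \<kappa> * int (orbit_coeff \<kappa>)"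

text \<open>Multiplying by n turns (n - 1)! into n!, and n! divided by the factorials of the
  multiplicities counts the arrangements of \<kappa>.\<close>

lemma orbit_coeff_eq_permutations:
  assumes "sum_mset \<kappa> \<noteq> 0"
  shows "orbit_coeff \<kappa> * size \<kappa> = exp_gcd (sum_mset \<kappa>) * card (permutations_of_multiset \<kappa>)"
proof -
  let ?P = "\<Prod>x\<in>set_mset \<kappa>. fact (count \<kappa> x) :: nat"
  have "\<kappa> \<noteq> {#}" using assms by auto
  then obtain m where m: "size \<kappa> = Suc m" by (metis size_eq_0_iff_empty not0_implies_Suc)
  have "orbit_coeff \<kappa> * size \<kappa> * ?P = exp_gcd (sum_mset \<kappa>) * (fact (size \<kappa> - 1) * size \<kappa>)"
    using orbit_coeff_mult[OF assms] by (metis mult.assoc mult.commute)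
  also have "fact (size \<kappa> - 1) * size \<kappa> = fact (size \<kappa>)" by (simp add: m)
  also have "\<dots> = card (permutations_of_multiset \<kappa>) * ?P"
    by (simp add: card_permutations_of_multiset_aux)
  finally have "orbit_coeff \<kappa> * size \<kappa> * ?P = exp_gcd (sum_mset \<kappa>) * card (permutations_of_multiset \<kappa>) * ?P"
    by (simp add: mult.assoc)
  then show ?thesis by simp
qed

lemma phi_eq_card_monoset:
  assumes "sum_mset \<kappa> \<noteq> 0" "0 \<notin># \<kappa>" "size \<kappa> \<le> D"
  shows "rat_of_int (phi \<kappa>) = of_nat (exp_gcd (sum_mset \<kappa>)) * of_nat (card (monoset D \<kappa>)) * wt D (size \<kappa>)"
proof -
  have "size \<kappa> > 0" using assms(1) by (auto simp: nonempty_has_size[symmetric])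
  have "rat_of_nat (orbit_coeff \<kappa>) * of_nat (size \<kappa>)
      = of_nat (exp_gcd (sum_mset \<kappa>)) * of_nat (card (permutations_of_multiset \<kappa>))"
    using orbit_coeff_eq_permutations[OF assms(1)] by (metis of_nat_mult)
  then have "rat_of_nat (orbit_coeff \<kappa>)
      = of_nat (exp_gcd (sum_mset \<kappa>)) * of_nat (card (permutations_of_multiset \<kappa>)) / of_nat (size \<kappa>)"
    using \<open>size \<kappa> > 0\<close> by (subst eq_divide_eq) (simp del: size_eq_0_iff_empty)
  then show ?thesis
    using assms(3) \<open>size \<kappa> > 0\<close> by (simp add: phi_def wt_def card_monoset[OF assms(2)])
qed

lemma pairs_msupp: "(u, v) \<in> pairs \<mu> \<nu> M \<Longrightarrow> msupp M = msupp u \<union> msupp v"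
  by (auto simp: pairs_def msupp_add)

lemma size_le_if_ncount:
  assumes "ncount \<mu> \<nu> M \<noteq> 0"
  shows "size (mtype M) \<le> size \<mu> + size \<nu>"
proof -
  obtain u v where "(u, v) \<in> pairs \<mu> \<nu> M"
    using assms by (auto simp: ncount_def)
  then show ?thesis using card_Un_le[of "msupp u" "msupp v"]
    by (auto simp: pairs_def msupp_add)
qed

text \<open>\<^const>\<open>phi\<close> is, up to sign, \<open>exp_gcd \<beta>\<close> times the coefficient of an orbit sum in the logarithm of
  the generating function of all orbit sums; hence it vanishes on products.\<close>
lemma phi_relation:
  assumes "\<mu> \<noteq> {#}" "\<nu> \<noteq> {#}" "0 \<notin># \<mu>" "0 \<notin># \<nu>" "sum_mset \<mu> + sum_mset \<nu> = \<beta>"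
  shows "(\<Sum>\<kappa>\<in>types \<beta>. int (ncount \<mu> \<nu> (rep \<kappa>)) * phi \<kappa>) = 0"
proof -
  \<comment> \<open>Just enough factors: a product of monomials of these types has at most D
    non-zero rows, and \<open>sum_wt_eq_0\<close> requires room for both supports side by
    side.\<close>
  define D where "D = size \<mu> + size \<nu>"
  have "\<beta> \<noteq> 0"
    using assms(1,3,5) by (metis expo_add_eq_0_iff multiset_nonemptyE sum_mset_eq_0_iff')
  let ?S = "monoset D \<mu> \<times> monoset D \<nu>"
  let ?w = "\<lambda>(u, v). wt D (card (msupp u \<union> msupp v))"
  \<comment> \<open>All pairs whose product has type \<kappa> carry the same weight, so the
    structure constant times \<open>phi \<kappa>\<close> becomes a weighted sum over these
    pairs.\<close>
  have inner: "of_nat (ncount \<mu> \<nu> (rep \<kappa>)) * rat_of_int (phi \<kappa>) =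
      of_nat (exp_gcd \<beta>) * (\<Sum>x\<in>{x \<in> ?S. mtype (fst x + snd x) = \<kappa>}. ?w x)" if "\<kappa> \<in> types \<beta>" for \<kappa>
  proof -
    have \<kappa>: "0 \<notin># \<kappa>" "sum_mset \<kappa> = \<beta>" using that by (auto simp: types_def)
    have "(\<Sum>x\<in>{x \<in> ?S. mtype (fst x + snd x) = \<kappa>}. ?w x)
        = (\<Sum>M\<in>monoset D \<kappa>. \<Sum>x\<in>{x \<in> {x \<in> ?S. mtype (fst x + snd x) = \<kappa>}. fst x + snd x = M}. ?w x)"
      by (rule sum.group[symmetric], simp, simp) (auto simp: monoset_def msupp_add)
    also have "\<dots> = (\<Sum>M\<in>monoset D \<kappa>. of_nat (ncount \<mu> \<nu> (rep \<kappa>)) * wt D (size \<kappa>))"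
    proof (rule sum.cong[OF refl])
      fix M assume M: "M \<in> monoset D \<kappa>"
      have eq: "{x \<in> {x \<in> ?S. mtype (fst x + snd x) = \<kappa>}. fst x + snd x = M} = pairs \<mu> \<nu> M"
        using M by (auto simp: monoset_def pairs_def msupp_add)
      have "(\<Sum>x\<in>pairs \<mu> \<nu> M. ?w x) = (\<Sum>x\<in>pairs \<mu> \<nu> M. wt D (size \<kappa>))"
      proof (rule sum.cong[OF refl])
        fix x assume "x \<in> pairs \<mu> \<nu> M"
        moreover have "size \<kappa> = card (msupp M)" using M by (auto simp: monoset_def)
        ultimately show "?w x = wt D (size \<kappa>)"
          by (cases x) (auto simp: pairs_msupp)
      qed
      also have "\<dots> = of_nat (ncount \<mu> \<nu> (rep \<kappa>)) * wt D (size \<kappa>)"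
        using M ncount_cong[of M "rep \<kappa>" \<mu> \<nu>] by (simp add: ncount_def monoset_def mtype_rep[OF \<kappa>(1)])
      finally show "(\<Sum>x\<in>{x \<in> {x \<in> ?S. mtype (fst x + snd x) = \<kappa>}. fst x + snd x = M}. ?w x)
          = of_nat (ncount \<mu> \<nu> (rep \<kappa>)) * wt D (size \<kappa>)"
        unfolding eq .
    qed
    finally have *: "(\<Sum>x\<in>{x \<in> ?S. mtype (fst x + snd x) = \<kappa>}. ?w x)
        = of_nat (card (monoset D \<kappa>)) * of_nat (ncount \<mu> \<nu> (rep \<kappa>)) * wt D (size \<kappa>)"
      by simp
    show ?thesis
    proof (cases "size \<kappa> \<le> D")
      case True
      show ?thesis unfolding *
        using phi_eq_card_monoset[of \<kappa> D] True \<kappa> \<open>\<beta> \<noteq> 0\<close> by simp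
    next
      case False
      then have "ncount \<mu> \<nu> (rep \<kappa>) = 0"
        using size_le_if_ncount[of \<mu> \<nu> "rep \<kappa>"] \<kappa>(1) by (auto simp: D_def mtype_rep simp del: size_mtype)
      then show ?thesis unfolding * by simp
    qed
  qed
  have "rat_of_int (\<Sum>\<kappa>\<in>types \<beta>. int (ncount \<mu> \<nu> (rep \<kappa>)) * phi \<kappa>)
      = (\<Sum>\<kappa>\<in>types \<beta>. of_nat (exp_gcd \<beta>) * (\<Sum>x\<in>{x \<in> ?S. mtype (fst x + snd x) = \<kappa>}. ?w x))"
    by (simp add: inner)
  also have "\<dots> = of_nat (exp_gcd \<beta>) * (\<Sum>\<kappa>\<in>types \<beta>. \<Sum>x\<in>{x \<in> ?S. mtype (fst x + snd x) = \<kappa>}. ?w x)"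
    by (simp add: sum_distrib_left)
  also have "(\<Sum>\<kappa>\<in>types \<beta>. \<Sum>x\<in>{x \<in> ?S. mtype (fst x + snd x) = \<kappa>}. ?w x) = (\<Sum>x\<in>?S. ?w x)"
    using assms(5) by (intro sum.group, simp, simp) (auto simp: types_def monoset_def sum_mtype_add)
  \<comment> \<open>For fixed u the weight sees only the support of v, so the inner sum is a
    multiple of the one in \<open>sum_wt_eq_0\<close>.\<close>
  also have "\<dots> = (\<Sum>u\<in>monoset D \<mu>. \<Sum>v\<in>monoset D \<nu>. wt D (card (msupp u \<union> msupp v)))"
    by (simp add: sum.cartesian_product)
  also have "\<dots> = 0"
  proof (rule sum.neutral, rule ballI)
    fix u assume u: "u \<in> monoset D \<mu>"
    then have cu: "card (msupp u) = size \<mu>" by (auto simp: monoset_def simp flip: size_mtype)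
    have "(\<Sum>T | T \<subseteq> {..<D} \<and> card T = size \<nu>. wt D (card (msupp u \<union> T))) = 0"
      using u cu assms(1,2)
      by (intro sum_wt_eq_0) (auto simp: monoset_def D_def nonempty_has_size card_gt_0_iff)
    then show "(\<Sum>v\<in>monoset D \<nu>. wt D (card (msupp u \<union> msupp v))) = 0"
      using sum_monoset_by_support[OF assms(4), of "\<lambda>T. wt D (card (msupp u \<union> T))" D] by simp
  qed
  finally show ?thesis by (simp only: mult_zero_right of_int_eq_0_iff)
qed

section \<open>Orbit sums\<close>

definition osum :: "nat \<Rightarrow> expo multiset \<Rightarrow> 'a::comm_ring_1 tpoly" where
  "osum d \<kappa> = (\<Sum>M\<in>monoset d \<kappa>. Poly_Mapping.single M 1)"

lemma lookup_osum: "lookup (osum d \<kappa>) M = (if M \<in> monoset d \<kappa> then 1 else 0)"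
proof -
  have "lookup (osum d \<kappa>) M = (\<Sum>N\<in>monoset d \<kappa>. if N = M then 1 else 0)"
    unfolding osum_def lookup_sum by (rule sum.cong) (auto simp: lookup_single when_def)
  then show ?thesis by simp
qed

lemma osum_eq_0: "size \<kappa> > d \<Longrightarrow> osum d \<kappa> = 0"
proof -
  assume d: "size \<kappa> > d"
  have False if "M \<in> monoset d \<kappa>" for M
  proof -
    have "card (msupp M) \<le> card {..<d}" using that by (intro card_mono) (auto simp: monoset_def)
    moreover have "card (msupp M) = size \<kappa>" using that by (auto simp: monoset_def)
    ultimately show False using d by simp
  qed
  then have "monoset d \<kappa> = {}" by blast
  then show ?thesis by (simp add: osum_def)
qed

lemma lookup_const_mult: "lookup (const_tp a * F) M = a * lookup F M"
  by (simp add: const_tp_def Poly_Mapping.map.rep_eq when_def flip: mult_map_scale_conv_mult)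

lemma const_tp_add: "const_tp (a + b) = const_tp a + const_tp b"
  by (simp add: const_tp_def single_add)

lemma const_tp_mult: "const_tp (a * b) = const_tp a * const_tp b"
  by (simp add: const_tp_def mult_single)

lemma const_tp_0 [simp]: "const_tp 0 = 0" and const_tp_1 [simp]: "const_tp 1 = 1"
  by (simp_all add: const_tp_def)

lemma const_tp_uminus: "const_tp (- a) = - const_tp a"
  by (simp add: const_tp_def single_uminus)

lemma const_tp_sum: "const_tp (sum f A) = (\<Sum>x\<in>A. const_tp (f x))"
  by (induction A rule: infinite_finite_induct) (auto simp: const_tp_add)

section \<open>Products of orbit sums and the ring of symmetric tensors\<close>

definition splits :: "mono \<Rightarrow> (mono \<times> mono) set" where
  "splits M = {(u, v). u + v = M}"

lemma finite_splits [simp]: "finite (splits M)"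
proof (rule finite_subset)
  show "splits M \<subseteq> {u. \<forall>x. lookup u x \<le> lookup M x} \<times> {u. \<forall>x. lookup u x \<le> lookup M x}"
    by (auto simp: splits_def lookup_add)
qed (intro finite_cartesian_product finite_below)

text \<open>A monomial has only finitely many factorizations, which turns the formally infinite
  convolution sums into ordinary finite ones.\<close>

lemma lookup_mult_splits:
  fixes F G :: "'a::comm_ring_1 tpoly"
  shows "lookup (F * G) M = (\<Sum>(u, v)\<in>splits M. lookup F u * lookup G v)"
proof -
  let ?U = "fst ` splits M" and ?V = "snd ` splits M"
  have inner: "(\<Sum>q. lookup G q when M = l + q) = (\<Sum>q\<in>?V. lookup G q when M = l + q)" for l
    by (rule Sum_any.expand_superset, simp) (auto simp: splits_def when_def image_iff)
  have "lookup (F * G) M = (\<Sum>l. lookup F l * (\<Sum>q\<in>?V. lookup G q when M = l + q))"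
    unfolding lookup_mult inner ..
  also have "\<dots> = (\<Sum>l\<in>?U. lookup F l * (\<Sum>q\<in>?V. lookup G q when M = l + q))"
  proof (rule Sum_any.expand_superset)
    show "{l. lookup F l * (\<Sum>q\<in>?V. lookup G q when M = l + q) \<noteq> 0} \<subseteq> ?U"
    proof
      fix l assume "l \<in> {l. lookup F l * (\<Sum>q\<in>?V. lookup G q when M = l + q) \<noteq> 0}"
      then have "(\<Sum>q\<in>?V. lookup G q when M = l + q) \<noteq> 0" by auto
      then obtain q where "(lookup G q when M = l + q) \<noteq> 0"
        by (meson sum.neutral)
      then have "(l, q) \<in> splits M" by (auto simp: splits_def when_def split: if_splits)
      then show "l \<in> ?U" by (metis fst_conv imageI)
    qed
  qed simp
  also have "\<dots> = (\<Sum>(u, v)\<in>?U \<times> ?V. lookup F u * lookup G v when M = u + v)"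
    by (simp add: sum_distrib_left sum.cartesian_product mult_when)
  also have "\<dots> = (\<Sum>(u, v)\<in>splits M. lookup F u * lookup G v)"
  proof (rule sum.mono_neutral_cong_right)
    show "splits M \<subseteq> ?U \<times> ?V" by (auto simp: image_iff) (metis fst_conv snd_conv)+
    show "\<forall>x\<in>?U \<times> ?V - splits M. (case x of (u, v) \<Rightarrow> lookup F u * lookup G v when M = u + v) = 0"
    proof
      fix x assume "x \<in> ?U \<times> ?V - splits M"
      then have "fst x + snd x \<noteq> M" by (simp add: splits_def case_prod_beta)
      then show "(case x of (u, v) \<Rightarrow> lookup F u * lookup G v when M = u + v) = 0"
        by (auto simp: case_prod_beta when_def)
    qed
    show "(case x of (u, v) \<Rightarrow> lookup F u * lookup G v when M = u + v)
        = (case x of (u, v) \<Rightarrow> lookup F u * lookup G v)" if "x \<in> splits M" for x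
      using that by (auto simp: splits_def)
  qed simp
  finally show ?thesis .
qed

lemma lookup_osum_mult:
  assumes "msupp M \<subseteq> {..<d}"
  shows "lookup (osum d \<mu> * osum d \<nu> :: 'a::comm_ring_1 tpoly) M = of_nat (ncount \<mu> \<nu> M)"
proof -
  have "lookup (osum d \<mu> * osum d \<nu> :: 'a tpoly) M
      = (\<Sum>x\<in>splits M. if x \<in> pairs \<mu> \<nu> M then 1 else 0)"
    unfolding lookup_mult_splits using assms
    by (intro sum.cong) (auto simp: lookup_osum splits_def pairs_def monoset_def msupp_add split: if_splits)
  also have "\<dots> = of_nat (card (splits M \<inter> pairs \<mu> \<nu> M))"
    by (simp add: sum.If_cases)
  also have "splits M \<inter> pairs \<mu> \<nu> M = pairs \<mu> \<nu> M"
    by (auto simp: splits_def pairs_def)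
  finally show ?thesis by (simp add: ncount_def)
qed

lemma lookup_osum_mult_0:
  assumes "\<not> msupp M \<subseteq> {..<d}"
  shows "lookup (osum d \<mu> * osum d \<nu> :: 'a::comm_ring_1 tpoly) M = 0"
  unfolding lookup_mult_splits using assms
  by (intro sum.neutral) (auto simp: lookup_osum splits_def monoset_def msupp_add)

lemma ncount_eq_0_degree:
  assumes "sum_mset (mtype M) \<noteq> sum_mset \<mu> + sum_mset \<nu>"
  shows "ncount \<mu> \<nu> M = 0"
proof -
  have "pairs \<mu> \<nu> M = {}" using assms by (auto simp: pairs_def sum_mtype_add)
  then show ?thesis by (simp add: ncount_def)
qed

text \<open>The structure constants are the same for every d. Types of size above d stay in the sum,
  with orbit sum zero, so that the universal relation \<open>phi_relation\<close> can be applied to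
  it.\<close>

lemma osum_mult:
  "osum d \<mu> * osum d \<nu> = (\<Sum>\<kappa>\<in>types (sum_mset \<mu> + sum_mset \<nu>).
     const_tp (of_nat (ncount \<mu> \<nu> (rep \<kappa>)) :: 'a::comm_ring_1) * osum d \<kappa>)"
proof (rule poly_mapping_eqI)
  fix M
  let ?T = "types (sum_mset \<mu> + sum_mset \<nu>)"
  have rhs: "lookup (\<Sum>\<kappa>\<in>?T. const_tp (of_nat (ncount \<mu> \<nu> (rep \<kappa>)) :: 'a) * osum d \<kappa>) M
      = (\<Sum>\<kappa>\<in>?T. if \<kappa> = mtype M then (if msupp M \<subseteq> {..<d} then of_nat (ncount \<mu> \<nu> M) else 0) else 0)"
    unfolding lookup_sum lookup_const_mult
  proof (rule sum.cong[OF refl])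
    fix \<kappa> assume "\<kappa> \<in> ?T"
    then have "mtype (rep \<kappa>) = \<kappa>" by (auto simp: types_def mtype_rep)
    then show "of_nat (ncount \<mu> \<nu> (rep \<kappa>)) * lookup (osum d \<kappa>) M
      = (if \<kappa> = mtype M then (if msupp M \<subseteq> {..<d} then of_nat (ncount \<mu> \<nu> M) else 0) else (0::'a))"
      using ncount_cong[of M "rep \<kappa>" \<mu> \<nu>] by (auto simp: lookup_osum monoset_def)
  qed
  have "ncount \<mu> \<nu> M = 0" if "mtype M \<notin> ?T"
    using that by (intro ncount_eq_0_degree) (auto simp: types_def)
  then show "lookup (osum d \<mu> * osum d \<nu> :: 'a tpoly) M = lookup (\<Sum>\<kappa>\<in>?T. const_tp (of_nat (ncount \<mu> \<nu> (rep \<kappa>))) * osum d \<kappa>) M"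
    unfolding rhs by (auto simp: lookup_osum_mult lookup_osum_mult_0)
qed

lemma sum_mtype_lookup: "lookup (sum_mset (mtype M)) i = (\<Sum>j\<in>msupp M. lookup M (j, i))"
  by (simp add: sum_mtype_superset[of "msupp M"] lookup_sum)

lemma columns_iff:
  "keys (sum_mset (mtype M)) \<subseteq> {..<r} \<longleftrightarrow> (\<forall>v\<in>keys M. snd v < r)"
proof -
  have *: "lookup (sum_mset (mtype M)) i \<noteq> 0 \<longleftrightarrow> (\<exists>j. lookup M (j, i) \<noteq> 0)" for i
  proof -
    have "j \<in> msupp M" if "lookup M (j, i) \<noteq> 0" for j
      using that unfolding msupp_eq by (metis fst_conv imageI in_keys_iff)
    then show ?thesis unfolding sum_mtype_lookup by auto
  qed
  show ?thesis
    unfolding keys_subset_lessThan_iff * in_keys_iff Ball_def split_paired_All snd_conv by blast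
qed

lemma TS_iff:
  "F \<in> TS d r \<longleftrightarrow>
    (\<forall>M\<in>keys F. msupp M \<subseteq> {..<d} \<and> keys (sum_mset (mtype M)) \<subseteq> {..<r}) \<and>
    (\<forall>\<sigma>. \<sigma> permutes {..<d} \<longrightarrow> (\<forall>M. lookup F (perm_mono \<sigma> M) = lookup F M))"
proof -
  have "(\<forall>v\<in>keys M. fst v < d \<and> snd v < r) \<longleftrightarrow> msupp M \<subseteq> {..<d} \<and> keys (sum_mset (mtype M)) \<subseteq> {..<r}" for M :: mono
    unfolding columns_iff msupp_eq by auto
  then show ?thesis by (simp add: TS_def)
qed

lemma TS_lookup_cong:
  assumes "F \<in> TS d r" "msupp M \<subseteq> {..<d}" "msupp N \<subseteq> {..<d}" "mtype M = mtype N"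
  shows "lookup F M = lookup F N"
  using mtype_eq_imp_perm[OF _ assms(2-4)] assms(1) by (metis TS_iff finite_lessThan)

lemma osum_TS:
  assumes "keys (sum_mset \<kappa>) \<subseteq> {..<r}"
  shows "osum d \<kappa> \<in> TS d r"
  unfolding TS_iff
proof (intro conjI ballI allI impI)
  fix M assume "M \<in> keys (osum d \<kappa> :: 'a tpoly)"
  then have "M \<in> monoset d \<kappa>" by (auto simp: in_keys_iff lookup_osum split: if_splits)
  then show "msupp M \<subseteq> {..<d}" "keys (sum_mset (mtype M)) \<subseteq> {..<r}"
    using assms by (auto simp: monoset_def)
next
  fix \<sigma> M assume \<sigma>: "\<sigma> permutes {..<d}"
  have "\<sigma> -` msupp M \<subseteq> {..<d} \<longleftrightarrow> msupp M \<subseteq> {..<d}"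
    using \<sigma> permutes_in_image[OF \<sigma>] permutes_surj[OF \<sigma>] by (auto simp: subset_iff) (metis surjD lessThan_iff)
  then show "lookup (osum d \<kappa> :: 'a tpoly) (perm_mono \<sigma> M) = lookup (osum d \<kappa>) M"
    using \<sigma> by (simp add: lookup_osum monoset_def mtype_perm_mono permutes_bij
      msupp_perm_mono permutes_inj)
qed

text \<open>Coefficients are constant on orbits and can be read off at the representative, which
  lies in the first d factors because an occurring type has at most d elements.\<close>

lemma TS_expansion:
  fixes F :: "'a::comm_ring_1 tpoly"
  assumes "F \<in> TS d r"
  shows "F = (\<Sum>\<kappa>\<in>mtype ` keys F. const_tp (lookup F (rep \<kappa>)) * osum d \<kappa>)"
proof (rule poly_mapping_eqI)
  fix M
  have "lookup (\<Sum>\<kappa>\<in>mtype ` keys F. const_tp (lookup F (rep \<kappa>)) * osum d \<kappa>) M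
      = (\<Sum>\<kappa>\<in>mtype ` keys F. if \<kappa> = mtype M then (if msupp M \<subseteq> {..<d} then lookup F M else 0) else 0)"
    unfolding lookup_sum lookup_const_mult
  proof (rule sum.cong[OF refl])
    fix \<kappa> assume "\<kappa> \<in> mtype ` keys F"
    then obtain N where N: "N \<in> keys F" "\<kappa> = mtype N" by auto
    have k0: "0 \<notin># \<kappa>" using N by simp
    have msN: "msupp N \<subseteq> {..<d}" using assms N(1) unfolding TS_iff by blast
    have "card (msupp N) \<le> card {..<d}" using msN by (intro card_mono) auto
    then have "msupp (rep \<kappa>) \<subseteq> {..<d}" by (simp add: msupp_rep[OF k0]) (simp add: N(2))
    then have "lookup F (rep \<kappa>) = lookup F M" if "\<kappa> = mtype M" "msupp M \<subseteq> {..<d}"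
      using that k0 by (intro TS_lookup_cong[OF assms]) (auto simp: mtype_rep)
    then show "lookup F (rep \<kappa>) * lookup (osum d \<kappa>) M
      = (if \<kappa> = mtype M then (if msupp M \<subseteq> {..<d} then lookup F M else 0) else 0)"
      by (auto simp: lookup_osum monoset_def)
  qed
  also have "\<dots> = lookup F M"
    using assms by (auto simp: TS_iff in_keys_iff)
  finally show "lookup F M = lookup (\<Sum>\<kappa>\<in>mtype ` keys F. const_tp (lookup F (rep \<kappa>)) * osum d \<kappa>) M" ..
qed

lemma mtype_0 [simp]: "mtype 0 = {#}" "msupp 0 = {}"
  by (auto simp: mtype_def msupp_eq)

lemma row_0: "row 0 j = 0"
  by (simp add: row_eq_0_iff)

lemma const_tp_TS: "const_tp a \<in> TS d r"
  unfolding TS_iff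
proof (intro conjI ballI allI impI)
  fix M assume "M \<in> keys (const_tp a)"
  then have "M = 0" by (auto simp: const_tp_def split: if_splits)
  then show "msupp M \<subseteq> {..<d}" "keys (sum_mset (mtype M)) \<subseteq> {..<r}" by auto
next
  fix \<sigma> M assume \<sigma>: "\<sigma> permutes {..<d}"
  have "perm_mono \<sigma> 0 = 0" by (rule mono_eqI) (use \<sigma> in \<open>simp add: permutes_inj row_0\<close>)
  then have "perm_mono \<sigma> M = 0 \<longleftrightarrow> M = 0"
    using inj_perm_mono[OF permutes_bij[OF \<sigma>]] by (metis injD)
  then show "lookup (const_tp a) (perm_mono \<sigma> M) = lookup (const_tp a) M"
    by (auto simp: const_tp_def lookup_single when_def)
qed

lemma TS_add: "F \<in> TS d r \<Longrightarrow> G \<in> TS d r \<Longrightarrow> F + G \<in> TS d r"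
  unfolding TS_iff
  by (intro conjI ballI allI impI) (use keys_add[of F G] in \<open>blast | simp add: lookup_add\<close>)+

lemma TS_mult:
  assumes F: "F \<in> TS d r" and G: "G \<in> TS d r"
  shows "F * G \<in> TS d r"
  unfolding TS_iff
proof (intro conjI ballI allI impI)
  fix M assume "M \<in> keys (F * G)"
  then obtain u v where "M = u + v" "u \<in> keys F" "v \<in> keys G"
    using keys_mult[of F G] by blast
  moreover have "keys (x + y) \<subseteq> {..<r}" if "keys x \<subseteq> {..<r}" "keys y \<subseteq> {..<r}" for x y :: expo
    using that keys_add[of x y] by blast
  ultimately show "msupp M \<subseteq> {..<d}" "keys (sum_mset (mtype M)) \<subseteq> {..<r}"
    using F G unfolding TS_iff by (auto simp: msupp_add sum_mtype_add)
next
  fix \<sigma> M assume \<sigma>: "\<sigma> permutes {..<d}"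
  define \<tau> where "\<tau> = inv \<sigma>"
  have b: "inj \<sigma>" "inj \<tau>" using \<sigma> permutes_inv[OF \<sigma>] by (auto simp: \<tau>_def intro: permutes_inj)
  have inv: "perm_mono \<tau> (perm_mono \<sigma> N) = N" "perm_mono \<sigma> (perm_mono \<tau> N) = N" for N
    using \<sigma> b by (auto intro!: mono_eqI simp: \<tau>_def permutes_inverses)
  show "lookup (F * G) (perm_mono \<sigma> M) = lookup (F * G) M"
    unfolding lookup_mult_splits
  proof (rule sum.reindex_bij_witness[of _ "map_prod (perm_mono \<sigma>) (perm_mono \<sigma>)" "map_prod (perm_mono \<tau>) (perm_mono \<tau>)"])
    fix x assume "x \<in> splits (perm_mono \<sigma> M)"
    then show "map_prod (perm_mono \<tau>) (perm_mono \<tau>) x \<in> splits M"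
      by (auto simp: splits_def inv simp flip: perm_mono_add[OF b(2)])
    show "(case map_prod (perm_mono \<tau>) (perm_mono \<tau>) x of (u, v) \<Rightarrow> lookup F u * lookup G v)
        = (case x of (u, v) \<Rightarrow> lookup F u * lookup G v)"
      using F G permutes_inv[OF \<sigma>] unfolding TS_iff \<tau>_def by (cases x) simp
  next
    fix x assume "x \<in> splits M"
    then show "map_prod (perm_mono \<sigma>) (perm_mono \<sigma>) x \<in> splits (perm_mono \<sigma> M)"
      by (auto simp: splits_def perm_mono_add[OF b(1)])
  qed (auto simp: inv)
qed

lemma subalg_subset_TS: "S \<subseteq> TS d r \<Longrightarrow> F \<in> subalg S \<Longrightarrow> F \<in> TS d r"
  by (rotate_tac, induction rule: subalg.induct) (auto intro: const_tp_TS TS_add TS_mult)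

lemma subalg_const_mult: "F \<in> subalg S \<Longrightarrow> const_tp a * F \<in> subalg S"
  by (intro sa_mult sa_const)

lemma subalg_uminus: "F \<in> subalg S \<Longrightarrow> - F \<in> subalg S"
  using subalg_const_mult[of F S "- 1"] by (simp add: const_tp_uminus)

lemma subalg_diff: "F \<in> subalg S \<Longrightarrow> G \<in> subalg S \<Longrightarrow> F - G \<in> subalg S"
  using sa_add[OF _ subalg_uminus, of F S G] by simp

lemma subalg_0: "0 \<in> subalg S"
  using sa_const[of 0 S] by simp

lemma subalg_sum: "(\<And>x. x \<in> A \<Longrightarrow> f x \<in> subalg S) \<Longrightarrow> sum f A \<in> subalg S"
  by (induction A rule: infinite_finite_induct) (auto intro: subalg_0 sa_add)

section \<open>The generators as orbit sums\<close>

definition mvec :: "nat \<Rightarrow> (nat \<Rightarrow> nat) \<Rightarrow> expo" where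
  "mvec r \<alpha> = (\<Sum>i<r. Poly_Mapping.single i (\<alpha> i))"

lemma lookup_mvec: "lookup (mvec r \<alpha>) i = (if i < r then \<alpha> i else 0)"
proof -
  have "lookup (mvec r \<alpha>) i = (\<Sum>j<r. if j = i then \<alpha> i else 0)"
    unfolding mvec_def lookup_sum by (rule sum.cong) (auto simp: lookup_single when_def)
  then show ?thesis by simp
qed

lemma row_tmono: "finite S \<Longrightarrow> row (tmono r S \<alpha>) j = (if j \<in> S then mvec r \<alpha> else 0)"
proof (rule poly_mapping_eqI)
  fix i assume "finite S"
  have "lookup (tmono r S \<alpha>) (j, i) = (\<Sum>j'\<in>S. if j' = j then lookup (mvec r \<alpha>) i else 0)"
    unfolding tmono_def lookup_sum
  proof (rule sum.cong[OF refl])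
    fix j'
    have "(\<Sum>i'<r. lookup (Poly_Mapping.single (j', i') (\<alpha> i')) (j, i))
        = (\<Sum>i'<r. if i' = i then (if j' = j then \<alpha> i else 0) else 0)"
      by (rule sum.cong) (auto simp: lookup_single when_def)
    then show "(\<Sum>i'<r. lookup (Poly_Mapping.single (j', i') (\<alpha> i')) (j, i)) = (if j' = j then lookup (mvec r \<alpha>) i else 0)"
      by (simp add: lookup_mvec)
  qed
  then show "lookup (row (tmono r S \<alpha>) j) i = lookup (if j \<in> S then mvec r \<alpha> else 0) i"
    using \<open>finite S\<close> by simp
qed

lemma tmono_eq_build: "finite S \<Longrightarrow> tmono r S \<alpha> = build S (\<lambda>_. mvec r \<alpha>)"
  by (rule mono_eqI) (simp add: row_tmono row_build)

text \<open>As the vector is non-zero, a set S of factors is recovered as the support of the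
  monomial that has this vector as its row on S.\<close>

lemma gamma_gen_eq_osum:
  assumes "mvec r \<alpha> \<noteq> 0"
  shows "gamma_gen d r k \<alpha> = osum d (replicate_mset k (mvec r \<alpha>))"
  unfolding gamma_gen_def osum_def
proof (rule sum.reindex_bij_witness[of _ msupp "\<lambda>S. tmono r S \<alpha>"])
  fix S assume "S \<in> {S. S \<subseteq> {..<d} \<and> card S = k}"
  then have S: "finite S" "S \<subseteq> {..<d}" "card S = k" by (auto intro: finite_subset)
  show "msupp (tmono r S \<alpha>) = S"
    using S assms by (simp add: tmono_eq_build msupp_build)
  show "tmono r S \<alpha> \<in> monoset d (replicate_mset k (mvec r \<alpha>))"
    using S assms by (simp add: tmono_eq_build monoset_def msupp_build mtype_build image_mset_const_eq)
next
  fix M assume M: "M \<in> monoset d (replicate_mset k (mvec r \<alpha>))"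
  show "msupp M \<in> {S. S \<subseteq> {..<d} \<and> card S = k}"
    using M by (auto simp: monoset_def simp flip: size_mtype)
  have "row M j = mvec r \<alpha>" if "j \<in> msupp M" for j
    using row_in_mtype[OF that] M by (auto simp: monoset_def split: if_splits)
  then show "tmono r (msupp M) \<alpha> = M"
    by (intro mono_eqI) (auto simp: row_tmono row_eq_0_iff)
qed auto

section \<open>Two factorizations that isolate one orbit sum\<close>

lemma mtype_eq_filter:
  assumes "finite T" "msupp M \<subseteq> T"
  shows "mtype M = filter_mset (\<lambda>x. x \<noteq> 0) (image_mset (row M) (mset_set T))"
proof -
  have "filter_mset (\<lambda>x. x \<noteq> 0) (mtype M) = mtype M"
    using zero_notin_mtype[of M] by (intro filter_mset_eq_conv[THEN iffD2]) auto
  then show ?thesis by (simp add: image_mset_row[OF assms])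
qed

text \<open>Without overlap of supports the product has type \<mu> + \<nu> = \<kappa>, and every
  overlap lowers the size. In type \<kappa> the rows equal to x must come from u and the others from
  v, so the factorization is unique. The product is the orbit sum of \<kappa> plus terms of smaller
  size.\<close>

lemma ncount_separate:
  fixes x :: expo
  assumes "x \<in># \<kappa>" "0 \<notin># \<kappa>"
  defines "\<mu> \<equiv> filter_mset (\<lambda>y. y = x) \<kappa>" and "\<nu> \<equiv> filter_mset (\<lambda>y. y \<noteq> x) \<kappa>"
  shows "mtype M = \<kappa> \<Longrightarrow> ncount \<mu> \<nu> M = 1"
    and "ncount \<mu> \<nu> M \<noteq> 0 \<Longrightarrow> mtype M = \<kappa> \<or> size (mtype M) < size \<kappa>"
proof -
  have x0: "x \<noteq> 0" using assms(1,2) by auto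
  have sz: "size \<kappa> = size \<mu> + size \<nu>"
    unfolding \<mu>_def \<nu>_def by (metis multiset_partition size_union)
  have disj: "msupp u \<inter> msupp v = {}" if "(u, v) \<in> pairs \<mu> \<nu> M" "size (mtype M) \<ge> size \<kappa>" for u v M
  proof -
    have "card (msupp u) = size \<mu>" "card (msupp v) = size \<nu>"
      using that by (auto simp: pairs_def simp flip: size_mtype)
    moreover have "card (msupp u \<union> msupp v) \<ge> size \<kappa>"
      using that by (auto simp: pairs_msupp)
    moreover have "card (msupp u) + card (msupp v) = card (msupp u \<union> msupp v) + card (msupp u \<inter> msupp v)"
      by (rule card_Un_Int) auto
    ultimately have "card (msupp u \<inter> msupp v) = 0" using sz by linarith
    then show ?thesis by simp
  qed
  show "mtype M = \<kappa> \<or> size (mtype M) < size \<kappa>" if "ncount \<mu> \<nu> M \<noteq> 0"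
  proof (cases "size (mtype M) < size \<kappa>")
    case False
    have "pairs \<mu> \<nu> M \<noteq> {}" using that by (auto simp: ncount_def)
    then obtain u v where uv: "(u, v) \<in> pairs \<mu> \<nu> M" by auto
    have d: "msupp u \<inter> msupp v = {}" using disj[OF uv] False by simp
    have M: "M = u + v" "mtype u = \<mu>" "mtype v = \<nu>" using uv by (auto simp: pairs_def)
    have "mset_set (msupp M) = mset_set (msupp u) + mset_set (msupp v)"
      using d by (simp add: M msupp_add mset_set_Union)
    moreover have "image_mset (row M) (mset_set (msupp u)) = mtype u"
      unfolding mtype_def by (rule image_mset_cong) (use d in \<open>auto simp: M row_eq_0_iff\<close>)
    moreover have "image_mset (row M) (mset_set (msupp v)) = mtype v"
      unfolding mtype_def by (rule image_mset_cong) (use d in \<open>auto simp: M row_eq_0_iff\<close>)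
    ultimately have "mtype M = \<mu> + \<nu>" unfolding mtype_def[of M] by (simp add: M)
    then show ?thesis unfolding \<mu>_def \<nu>_def by (metis multiset_partition)
  qed simp
  show "ncount \<mu> \<nu> M = 1" if M: "mtype M = \<kappa>"
  proof -
    define S where "S = msupp M"
    define u0 where "u0 = build {j \<in> S. row M j = x} (row M)"
    define v0 where "v0 = build {j \<in> S. row M j \<noteq> x} (row M)"
    have fin: "finite {j \<in> S. row M j = x}" "finite {j \<in> S. row M j \<noteq> x}" by (auto simp: S_def)
    have nz: "row M j \<noteq> 0" if "j \<in> S" for j using that by (simp add: S_def row_eq_0_iff)
    have "(u0, v0) \<in> pairs \<mu> \<nu> M"
    proof -
      have "u0 + v0 = M"
        by (rule mono_eqI) (use fin in \<open>auto simp: u0_def v0_def row_build S_def row_eq_0_iff\<close>)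
      moreover have "mtype u0 = \<mu>"
        unfolding u0_def \<mu>_def M[symmetric] using fin(1) nz
        by (subst mtype_build) (auto simp: mtype_def S_def filter_mset_image_mset)
      moreover have "mtype v0 = \<nu>"
        unfolding v0_def \<nu>_def M[symmetric] using fin(2) nz
        by (subst mtype_build) (auto simp: mtype_def S_def filter_mset_image_mset)
      ultimately show ?thesis by (simp add: pairs_def)
    qed
    moreover have "(u, v) = (u0, v0)" if uv: "(u, v) \<in> pairs \<mu> \<nu> M" for u v
    proof -
      have d: "msupp u \<inter> msupp v = {}" using disj[OF uv] M by simp
      have Muv: "M = u + v" "mtype u = \<mu>" "mtype v = \<nu>" using uv by (auto simp: pairs_def)
      have S: "S = msupp u \<union> msupp v" using uv by (simp add: S_def pairs_msupp)
      have ru: "row u j = x" if "j \<in> msupp u" for j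
        using row_in_mtype[OF that] by (simp add: Muv \<mu>_def)
      have rv: "row v j \<noteq> x" if "j \<in> msupp v" for j
        using row_in_mtype[OF that] by (simp add: Muv \<nu>_def)
      have "row u j = row u0 j" for j
      proof -
        consider "j \<in> msupp u" "j \<notin> msupp v" | "j \<in> msupp v" "j \<notin> msupp u" | "j \<notin> msupp u" "j \<notin> msupp v"
          using d by blast
        then show ?thesis
        proof cases
          case 1
          then have "row v j = 0" "row u j = x" using ru by (auto simp: row_eq_0_iff)
          with 1 show ?thesis using fin by (simp add: u0_def row_build S Muv(1))
        next
          case 2
          then have "row u j = 0" "row v j \<noteq> x" using rv by (auto simp: row_eq_0_iff)
          then show ?thesis using fin by (simp add: u0_def row_build Muv(1))
        next
          case 3
          then have "row u j = 0" by (simp add: row_eq_0_iff)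
          with 3 show ?thesis using fin by (simp add: u0_def row_build S)
        qed
      qed
      then have "u = u0" by (rule mono_eqI)
      moreover have "u0 + v0 = M" using \<open>(u0, v0) \<in> pairs \<mu> \<nu> M\<close> by (simp add: pairs_def)
      ultimately show ?thesis using Muv(1) by simp
    qed
    ultimately have "pairs \<mu> \<nu> M = {(u0, v0)}" by (metis (no_types) equalityI insert_subset empty_subsetI singletonI subrelI)
    then show ?thesis by (simp add: ncount_def)
  qed
qed

text \<open>\<open>x - f + f = x\<close> says f \<le> x in every coordinate. The first factor fills
  \<open>size \<kappa>\<close> rows, so no product has a smaller support. If the size is equal,
  every row contains one f, and removing it gives the rows of \<nu>, padded by zeros. The product is
  the orbit sum of \<kappa> plus terms of larger size.\<close>

lemma ncount_strip:
  fixes f :: expo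
  assumes "f \<noteq> 0" "0 \<notin># \<kappa>" and ge: "\<And>x. x \<in># \<kappa> \<Longrightarrow> x - f + f = x"
  defines "\<mu> \<equiv> replicate_mset (size \<kappa>) f"
    and "\<nu> \<equiv> filter_mset (\<lambda>x. x \<noteq> 0) (image_mset (\<lambda>x. x - f) \<kappa>)"
  shows "mtype M = \<kappa> \<Longrightarrow> ncount \<mu> \<nu> M = 1"
    and "ncount \<mu> \<nu> M \<noteq> 0 \<Longrightarrow> mtype M = \<kappa> \<or> size \<kappa> < size (mtype M)"
proof -
  have u_eq: "u = build (msupp M) (\<lambda>_. f)" "msupp u = msupp M"
    if "(u, v) \<in> pairs \<mu> \<nu> M" "size (mtype M) \<le> size \<kappa>" for u v M
  proof -
    have c: "card (msupp u) = size \<kappa>"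
      using that(1) by (auto simp: pairs_def \<mu>_def simp flip: size_mtype)
    have sub: "msupp u \<subseteq> msupp M" using that(1) by (auto simp: pairs_msupp)
    then show eq: "msupp u = msupp M"
      using c that(2) card_mono[OF finite_msupp sub] by (intro card_subset_eq) auto
    have "row u j = f" if "j \<in> msupp M" for j
      using row_in_mtype[of j u] that eq \<open>(u, v) \<in> pairs \<mu> \<nu> M\<close>
      by (auto simp: pairs_def \<mu>_def split: if_splits)
    then show "u = build (msupp M) (\<lambda>_. f)"
      using eq by (intro mono_eqI) (auto simp: row_build row_eq_0_iff)
  qed
  show "mtype M = \<kappa> \<or> size \<kappa> < size (mtype M)" if "ncount \<mu> \<nu> M \<noteq> 0"
  proof (cases "size \<kappa> < size (mtype M)")
    case False
    have "pairs \<mu> \<nu> M \<noteq> {}" using that by (auto simp: ncount_def)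
    then obtain u v where uv: "(u, v) \<in> pairs \<mu> \<nu> M" by auto
    have u: "u = build (msupp M) (\<lambda>_. f)" "msupp u = msupp M" using u_eq[OF uv] False by auto
    have M: "M = u + v" "mtype u = \<mu>" "mtype v = \<nu>" using uv by (auto simp: pairs_def)
    have card: "card (msupp M) = size \<kappa>"
      using arg_cong[OF M(2), of size] u(2) by (simp add: \<mu>_def)
    have "msupp v \<subseteq> msupp M" using uv by (auto simp: pairs_msupp)
    from image_mset_row[OF finite_msupp this]
    have "image_mset (row v) (mset_set (msupp M)) = \<nu> + replicate_mset (size \<kappa> - size \<nu>) 0"
      using M(3) card by (simp flip: size_mtype)
    \<comment> \<open>Elements equal to f become zero and are dropped in \<nu>; the padding restores
      exactly these.\<close>
    also have "\<dots> = image_mset (\<lambda>x. x - f) \<kappa>"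
    proof -
      let ?I = "image_mset (\<lambda>x. x - f) \<kappa>"
      have "?I = \<nu> + filter_mset (\<lambda>x. \<not> x \<noteq> 0) ?I"
        unfolding \<nu>_def by (rule multiset_partition)
      also have "filter_mset (\<lambda>x. \<not> x \<noteq> 0) ?I = replicate_mset (count ?I 0) 0"
        using filter_eq_replicate_mset[of 0 ?I] by simp
      finally have eq: "?I = \<nu> + replicate_mset (count ?I 0) 0" .
      have "count ?I 0 = size \<kappa> - size \<nu>"
        using arg_cong[OF eq, of size] by simp
      with eq show ?thesis by simp
    qed
    finally have v: "image_mset (row v) (mset_set (msupp M)) = image_mset (\<lambda>x. x - f) \<kappa>" .
    have "mtype M = image_mset (\<lambda>j. row v j + f) (mset_set (msupp M))"
      unfolding mtype_def
    proof (rule image_mset_cong)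
      fix j assume "j \<in># mset_set (msupp M)"
      then have "row u j = f" unfolding u(1) by (simp add: row_build)
      then show "row M j = row v j + f" by (simp add: M(1) add.commute)
    qed
    also have "\<dots> = image_mset (\<lambda>y. y + f) (image_mset (row v) (mset_set (msupp M)))"
      by (simp add: multiset.map_comp o_def)
    also have "\<dots> = image_mset (\<lambda>x. x - f + f) \<kappa>"
      unfolding v by (simp add: multiset.map_comp o_def)
    also have "\<dots> = \<kappa>" using ge by (simp cong: image_mset_cong)
    finally show ?thesis by simp
  qed simp
  show "ncount \<mu> \<nu> M = 1" if M: "mtype M = \<kappa>"
  proof -
    define u0 where "u0 = build (msupp M) (\<lambda>_. f)"
    define v0 where "v0 = build (msupp M) (\<lambda>j. row M j - f)"
    have "u0 + v0 = M"
    proof (rule mono_eqI)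
      fix j show "row (u0 + v0) j = row M j"
      proof (cases "j \<in> msupp M")
        case True
        then show ?thesis
          using ge[of "row M j"] row_in_mtype[OF True] M
          by (simp add: u0_def v0_def row_build add.commute)
      next
        case False
        then show ?thesis by (simp add: u0_def v0_def row_build row_eq_0_iff)
      qed
    qed
    moreover have "mtype u0 = \<mu>"
      unfolding u0_def \<mu>_def M[symmetric] using assms(1)
      by (subst mtype_build) (auto simp: image_mset_const_eq)
    moreover have "mtype v0 = \<nu>"
    proof -
      have "row v0 j = 0" if "j \<notin> msupp M" for j using that by (simp add: v0_def row_build)
      then have "msupp v0 \<subseteq> msupp M" by (auto simp: row_eq_0_iff)
      from mtype_eq_filter[OF finite_msupp this]
      have "mtype v0 = filter_mset (\<lambda>x. x \<noteq> 0) (image_mset (row v0) (mset_set (msupp M)))" .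
      also have "image_mset (row v0) (mset_set (msupp M)) = image_mset (\<lambda>x. x - f) \<kappa>"
        unfolding M[symmetric] mtype_def multiset.map_comp
        by (rule image_mset_cong) (simp add: v0_def row_build)
      finally show ?thesis by (simp add: \<nu>_def)
    qed
    ultimately have "(u0, v0) \<in> pairs \<mu> \<nu> M" by (simp add: pairs_def)
    moreover have "(u, v) = (u0, v0)" if uv: "(u, v) \<in> pairs \<mu> \<nu> M" for u v
    proof -
      have "u = u0" using u_eq(1)[OF uv] M by (simp add: u0_def)
      moreover have "u + v = M" using uv by (simp add: pairs_def)
      ultimately have "u0 + v = u0 + v0" using \<open>u0 + v0 = M\<close> by simp
      with \<open>u = u0\<close> show ?thesis by simp
    qed
    ultimately have "pairs \<mu> \<nu> M = {(u0, v0)}" by (metis (no_types) equalityI insert_subset empty_subsetI singletonI subrelI)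
    then show ?thesis by (simp add: ncount_def)
  qed
qed

section \<open>Reduction modulo decomposables\<close>

text \<open>W stands for the generated subalgebra. Only its linear structure and the products in
  degree \<beta> enter; these lie in W by induction, since both factors have smaller degree.\<close>

locale decomposable =
  fixes W :: "'a::comm_ring_1 tpoly set" and d :: nat and \<beta> :: expo
  assumes W_add: "F \<in> W \<Longrightarrow> G \<in> W \<Longrightarrow> F + G \<in> W"
    and W_const: "F \<in> W \<Longrightarrow> const_tp a * F \<in> W"
    and W_0: "0 \<in> W"
    and W_prod: "\<mu> \<noteq> {#} \<Longrightarrow> \<nu> \<noteq> {#} \<Longrightarrow> 0 \<notin># \<mu> \<Longrightarrow> 0 \<notin># \<nu> \<Longrightarrow>
      sum_mset \<mu> + sum_mset \<nu> = \<beta> \<Longrightarrow> osum d \<mu> * osum d \<nu> \<in> W"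
    and beta_nz: "\<beta> \<noteq> 0"
begin

definition b where "b = exp_gcd \<beta>"
definition f where "f = sdiv \<beta> b"
text \<open>The type of \<gamma>^b(x^f), with f = \<beta>/b primitive. Its orbit coefficient is 1,
  which makes it the reference class of degree \<beta>.\<close>

definition E where "E = replicate_mset b f"

lemma b_pos: "b > 0"
  using beta_nz by (auto simp: b_def intro: Nat.gr0I)

lemma smul_f: "smul b f = \<beta>"
  by (simp add: f_def b_def smul_sdiv)

lemma f_nz: "f \<noteq> 0"
proof
  assume "f = 0"
  then have "smul b f = 0" by (intro poly_mapping_eqI) simp
  with smul_f beta_nz show False by simp
qed

lemma exp_gcd_f: "exp_gcd f = 1"
proof -
  have "b * exp_gcd f = b" by (metis b_def exp_gcd_smul smul_f)
  with b_pos show ?thesis by (metis mult.right_neutral mult_left_cancel neq0_conv)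
qed

text \<open>\<open>phi E\<close> is 1 or -1 and hence its own inverse, so the subtracted multiple of
  the reference orbit sum has the same value of \<open>phi\<close> as \<kappa>.\<close>

definition residual :: "expo multiset \<Rightarrow> 'a tpoly" where
  "residual \<kappa> = osum d \<kappa> - const_tp (of_int (phi \<kappa> * phi E)) * osum d E"

lemma W_uminus: "F \<in> W \<Longrightarrow> - F \<in> W"
  using W_const[of F "- 1"] by (simp add: const_tp_uminus)

lemma W_sum: "(\<And>x. x \<in> A \<Longrightarrow> g x \<in> W) \<Longrightarrow> sum g A \<in> W"
  by (induction A rule: infinite_finite_induct) (auto intro: W_0 W_add)

text \<open>Each orbit sum in the expansion of the product is a residual plus a multiple of
  \<open>osum d E\<close>, and \<open>phi_relation\<close> cancels these multiples. The product,
  which is in W, is thus a combination of residuals, and the one with coefficient 1 can be solved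
  for.\<close>

lemma residual_step:
  assumes "\<mu> \<noteq> {#}" "\<nu> \<noteq> {#}" "0 \<notin># \<mu>" "0 \<notin># \<nu>" "sum_mset \<mu> + sum_mset \<nu> = \<beta>"
    and "\<kappa> \<in> types \<beta>" "ncount \<mu> \<nu> (rep \<kappa>) = 1"
    and IH: "\<And>\<kappa>'. \<kappa>' \<in> types \<beta> \<Longrightarrow> \<kappa>' \<noteq> \<kappa> \<Longrightarrow> ncount \<mu> \<nu> (rep \<kappa>') \<noteq> 0 \<Longrightarrow> residual \<kappa>' \<in> W"
  shows "residual \<kappa> \<in> W"
proof -
  let ?n = "\<lambda>\<kappa>. ncount \<mu> \<nu> (rep \<kappa>)"
  have "(\<Sum>\<kappa>'\<in>types \<beta>. const_tp (of_nat (?n \<kappa>')) * residual \<kappa>')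
      = (\<Sum>\<kappa>'\<in>types \<beta>. const_tp (of_nat (?n \<kappa>')) * osum d \<kappa>')
        - (\<Sum>\<kappa>'\<in>types \<beta>. const_tp (of_int (int (?n \<kappa>') * phi \<kappa>' * phi E))) * osum d E"
    unfolding residual_def right_diff_distrib sum_subtractf sum_distrib_right
    by (simp add: const_tp_mult mult.assoc)
  also have "(\<Sum>\<kappa>'\<in>types \<beta>. const_tp (of_int (int (?n \<kappa>') * phi \<kappa>' * phi E)) :: 'a tpoly)
      = const_tp (of_int ((\<Sum>\<kappa>'\<in>types \<beta>. int (?n \<kappa>') * phi \<kappa>') * phi E))"
    by (simp only: const_tp_sum of_int_sum sum_distrib_right)
  also have "\<dots> = 0"
    using phi_relation[OF assms(1-5)] by simp
  also have "(\<Sum>\<kappa>'\<in>types \<beta>. const_tp (of_nat (?n \<kappa>')) * osum d \<kappa>') = osum d \<mu> * osum d \<nu>"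
    unfolding osum_mult using assms(5) by simp
  finally have eq: "(\<Sum>\<kappa>'\<in>types \<beta>. const_tp (of_nat (?n \<kappa>')) * residual \<kappa>') = osum d \<mu> * osum d \<nu>"
    by simp
  have "(\<Sum>\<kappa>'\<in>types \<beta>. const_tp (of_nat (?n \<kappa>')) * residual \<kappa>')
      = residual \<kappa> + (\<Sum>\<kappa>'\<in>types \<beta> - {\<kappa>}. const_tp (of_nat (?n \<kappa>')) * residual \<kappa>')"
    using assms(6,7) by (subst sum.remove[of _ \<kappa>]) auto
  then have "residual \<kappa> = osum d \<mu> * osum d \<nu>
      + - (\<Sum>\<kappa>'\<in>types \<beta> - {\<kappa>}. const_tp (of_nat (?n \<kappa>')) * residual \<kappa>')"
    using eq by simp
  also have "\<dots> \<in> W"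
  proof (intro W_add W_uminus W_sum W_prod[OF assms(1-5)])
    fix \<kappa>' assume "\<kappa>' \<in> types \<beta> - {\<kappa>}"
    then show "const_tp (of_nat (?n \<kappa>')) * residual \<kappa>' \<in> W"
      using IH[of \<kappa>'] by (cases "?n \<kappa>' = 0") (auto intro: W_0 W_const)
  qed
  finally show ?thesis .
qed

lemma phi_E: "phi E * phi E = 1"
proof -
  have "orbit_coeff E = 1" using orbit_coeff_replicate_mset[of b f] b_pos f_nz by (simp add: E_def exp_gcd_f)
  then show ?thesis by (simp add: phi_def minus_one_mult_self)
qed

lemma residual_E: "residual E \<in> W"
  by (simp add: residual_def phi_E W_0)

text \<open>Removing one f from every element with \<open>ncount_strip\<close> leaves only other
  terms of larger size, and sizes are at most b since \<open>size \<kappa>\<close> copies of f fit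
  into \<beta> = b f. The induction runs upwards in size; only for E does nothing remain once f is
  removed.\<close>

lemma residual_multiples:
  assumes "\<kappa> \<in> types \<beta>" "\<forall>x\<in>#\<kappa>. \<exists>m. x = smul m f"
  shows "residual \<kappa> \<in> W"
  using assms
proof (induction "b - size \<kappa>" arbitrary: \<kappa> rule: less_induct)
  case less
  have \<kappa>: "0 \<notin># \<kappa>" "sum_mset \<kappa> = \<beta>" using less.prems(1) by (auto simp: types_def)
  show ?case
  proof (cases "\<kappa> = E")
    case False
    define \<mu> where "\<mu> = replicate_mset (size \<kappa>) f"
    define \<nu> where "\<nu> = filter_mset (\<lambda>x. x \<noteq> 0) (image_mset (\<lambda>x. x - f) \<kappa>)"
    have pos: "\<exists>m. x = smul (Suc m) f" if x: "x \<in># \<kappa>" for x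
    proof -
      obtain m where m: "x = smul m f" using bspec[OF less.prems(2) x] by (rule exE)
      have "m \<noteq> 0"
      proof
        assume "m = 0"
        then have "x = 0" unfolding m by (intro poly_mapping_eqI) simp
        with x \<kappa>(1) show False by simp
      qed
      with m show ?thesis by (metis not0_implies_Suc)
    qed
    have strip: "smul (Suc m) f - f = smul m f" for m
      by (rule poly_mapping_eqI) (simp add: lookup_minus)
    have ge: "x - f + f = x" if x: "x \<in># \<kappa>" for x
    proof -
      obtain m where "x = smul (Suc m) f" using pos[OF x] by (rule exE)
      then show ?thesis by (auto intro: poly_mapping_eqI simp: lookup_minus lookup_add)
    qed
    have "\<kappa> \<noteq> {#}" using \<kappa>(2) beta_nz by auto
    have size_less: "size \<kappa>' \<le> b" if "\<kappa>' \<in> types \<beta>" and mult: "\<forall>x\<in>#\<kappa>'. \<exists>m. x = smul m f" for \<kappa>'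
    proof -
      obtain i where i: "lookup f i \<noteq> 0" using f_nz by (auto simp: poly_mapping_eq_iff fun_eq_iff)
      have "size \<kappa>' * lookup f i = (\<Sum>x\<in>#\<kappa>'. lookup f i)" by simp
      also have "\<dots> \<le> (\<Sum>x\<in>#\<kappa>'. lookup x i)"
      proof (rule sum_mset_mono)
        fix x assume x: "x \<in># \<kappa>'"
        obtain m where m: "x = smul m f" using bspec[OF mult x] by (rule exE)
        have "x \<noteq> 0" using x that(1) by (auto simp: types_def)
        then have "m \<noteq> 0" unfolding m by (auto simp: poly_mapping_eq_iff fun_eq_iff)
        then show "lookup f i \<le> lookup x i" by (simp add: m)
      qed
      also have "\<dots> = lookup \<beta> i" using that(1) by (simp add: types_def flip: lookup_sum_mset)
      also have "\<dots> = b * lookup f i" using lookup_smul[of b f i] by (simp only: smul_f)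
      finally show ?thesis using i by simp
    qed
    show ?thesis
    proof (rule residual_step[of \<mu> \<nu>])
      show "\<mu> \<noteq> {#}" using \<open>\<kappa> \<noteq> {#}\<close> by (simp add: \<mu>_def)
      show "\<nu> \<noteq> {#}"
      proof
        assume "\<nu> = {#}"
        then have "y \<notin># \<nu>" for y by simp
        then have "\<forall>x\<in>#\<kappa>. x - f = 0" by (auto simp: \<nu>_def)
        then have "\<forall>x\<in>#\<kappa>. x = f" using ge by (metis add_0)
        then have k: "\<kappa> = replicate_mset (size \<kappa>) f"
          by (metis set_mset_subset_singletonD singletonI subsetI)
        then have "smul (size \<kappa>) f = \<beta>" using \<kappa>(2) by (metis sum_mset_replicate)
        then have "size \<kappa> * exp_gcd f = b" by (simp add: b_def flip: exp_gcd_smul)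
        then have "size \<kappa> = b" by (simp add: exp_gcd_f)
        with k False show False by (simp add: E_def)
      qed
      show "0 \<notin># \<mu>" using f_nz by (auto simp: \<mu>_def)
      show "0 \<notin># \<nu>" by (simp add: \<nu>_def)
      show "sum_mset \<mu> + sum_mset \<nu> = \<beta>"
      proof -
        have drop0: "sum_mset (filter_mset (\<lambda>x. x \<noteq> 0) A) = sum_mset A" for A :: "expo multiset"
          by (induction A) auto
        have "sum_mset (replicate_mset (size A) f) + (\<Sum>x\<in>#A. x - f) = sum_mset A"
          if "\<forall>x\<in>#A. x - f + f = x" for A
          using that
        proof (induction A)
          case (add x A)
          then have "sum_mset (replicate_mset (size A) f) + (\<Sum>x\<in>#A. x - f) = sum_mset A" "x - f + f = x"
            by auto
          then show ?case
            by (simp del: sum_mset_replicate_mset add: ac_simps)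
        qed simp
        then show ?thesis using ge by (simp add: \<mu>_def \<nu>_def drop0 \<kappa>(2) del: sum_mset_replicate_mset)
      qed
      show "\<kappa> \<in> types \<beta>" by fact
      show "ncount \<mu> \<nu> (rep \<kappa>) = 1"
        unfolding \<mu>_def \<nu>_def using ncount_strip(1)[OF f_nz \<kappa>(1) ge] mtype_rep[OF \<kappa>(1)] by blast
      fix \<kappa>' assume k': "\<kappa>' \<in> types \<beta>" "\<kappa>' \<noteq> \<kappa>" "ncount \<mu> \<nu> (rep \<kappa>') \<noteq> 0"
      have rep': "mtype (rep \<kappa>') = \<kappa>'" using k'(1) by (auto simp: types_def mtype_rep)
      have "size \<kappa> < size \<kappa>'"
        using ncount_strip(2)[OF f_nz \<kappa>(1) ge, of "rep \<kappa>'"] k'(2,3) rep'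
        unfolding \<mu>_def \<nu>_def by auto
      \<comment> \<open>The other terms stay in the class: a row of the product is a row of u plus a
        row of v, and both are multiples of f.\<close>
      moreover have mult: "\<forall>x\<in>#\<kappa>'. \<exists>m. x = smul m f"
      proof
        fix x assume "x \<in># \<kappa>'"
        then obtain j where j: "j \<in> msupp (rep \<kappa>')" "x = row (rep \<kappa>') j"
          using rep' by (metis imageE set_mset_mtype)
        obtain u v where uv: "(u, v) \<in> pairs \<mu> \<nu> (rep \<kappa>')"
          using k'(3) unfolding ncount_def by (metis card.empty equals0I surj_pair)
        have z: "0 = smul 0 f" by (rule poly_mapping_eqI) simp
        have "\<exists>m. row u j = smul m f"
        proof (cases "j \<in> msupp u")
          case True
          then have "row u j = f" using row_in_mtype[OF True] uv by (auto simp: pairs_def \<mu>_def split: if_splits)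
          also have "f = smul 1 f" by (rule poly_mapping_eqI) simp
          finally show ?thesis by blast
        qed (use z in \<open>auto simp: row_eq_0_iff[symmetric]\<close>)
        moreover have "\<exists>m. row v j = smul m f"
        proof (cases "j \<in> msupp v")
          case True
          then obtain y where "y \<in># \<kappa>" "row v j = y - f"
            using row_in_mtype[OF True] uv by (auto simp: pairs_def \<nu>_def)
          with pos strip show ?thesis by metis
        qed (use z in \<open>auto simp: row_eq_0_iff[symmetric]\<close>)
        ultimately obtain m1 m2 where "row u j = smul m1 f" "row v j = smul m2 f"
          by (elim exE) (rule that)
        moreover have "x = row u j + row v j" using uv j(2) by (auto simp: pairs_def simp flip: row_add)
        ultimately have "x = smul (m1 + m2) f"
          by (auto intro: poly_mapping_eqI simp: lookup_add distrib_right)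
        then show "\<exists>m. x = smul m f" by blast
      qed
      ultimately show "residual \<kappa>' \<in> W"
        using size_less[OF k'(1) mult] k'(1) by (intro less.hyps) auto
    qed
  qed (simp add: residual_E)
qed

text \<open>Two different elements allow \<open>ncount_separate\<close>, which leads to smaller
  sizes. If all n elements equal x, then n x = b f with f primitive makes x a multiple of f. That
  case descends in the opposite direction and is therefore settled beforehand.\<close>

lemma residual_in: "\<kappa> \<in> types \<beta> \<Longrightarrow> residual \<kappa> \<in> W"
proof (induction "size \<kappa>" arbitrary: \<kappa> rule: less_induct)
  case less
  have \<kappa>: "0 \<notin># \<kappa>" "sum_mset \<kappa> = \<beta>" using less.prems(1) by (auto simp: types_def)
  have "\<kappa> \<noteq> {#}" using \<kappa>(2) beta_nz by auto
  then obtain x where x: "x \<in># \<kappa>" by auto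
  show ?case
  proof (cases "\<forall>y\<in>#\<kappa>. y = x")
    case True
    then have k: "\<kappa> = replicate_mset (size \<kappa>) x"
      by (metis set_mset_subset_singletonD singletonI subsetI)
    then have eq: "smul (size \<kappa>) x = \<beta>" using \<kappa>(2) by (metis sum_mset_replicate)
    then have b: "size \<kappa> * exp_gcd x = b" by (simp add: b_def flip: exp_gcd_smul)
    have "x = smul (exp_gcd x) f"
    proof (rule poly_mapping_eqI)
      fix i
      have "size \<kappa> * lookup x i = size \<kappa> * exp_gcd x * lookup f i"
        unfolding b by (metis eq lookup_smul smul_f)
      then show "lookup x i = lookup (smul (exp_gcd x) f) i" using \<open>\<kappa> \<noteq> {#}\<close> by simp
    qed
    then show ?thesis using True less.prems by (intro residual_multiples) auto
  next
    case False
    define \<mu> where "\<mu> = filter_mset (\<lambda>y. y = x) \<kappa>"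
    define \<nu> where "\<nu> = filter_mset (\<lambda>y. y \<noteq> x) \<kappa>"
    show ?thesis
    proof (rule residual_step[of \<mu> \<nu>])
      have "x \<in># \<mu>" using x by (simp add: \<mu>_def)
      then show "\<mu> \<noteq> {#}" by auto
      obtain y where "y \<in># \<nu>" using False by (auto simp: \<nu>_def)
      then show "\<nu> \<noteq> {#}" by auto
      show "0 \<notin># \<mu>" "0 \<notin># \<nu>" using \<kappa>(1) by (auto simp: \<mu>_def \<nu>_def)
      have "\<kappa> = \<mu> + \<nu>" unfolding \<mu>_def \<nu>_def by (rule multiset_partition)
      then show "sum_mset \<mu> + sum_mset \<nu> = \<beta>" using \<kappa>(2) by simp
      show "\<kappa> \<in> types \<beta>" by fact
      show "ncount \<mu> \<nu> (rep \<kappa>) = 1"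
        unfolding \<mu>_def \<nu>_def using ncount_separate(1)[OF x \<kappa>(1)] mtype_rep[OF \<kappa>(1)] by blast
      fix \<kappa>' assume k': "\<kappa>' \<in> types \<beta>" "\<kappa>' \<noteq> \<kappa>" "ncount \<mu> \<nu> (rep \<kappa>') \<noteq> 0"
      have rep': "mtype (rep \<kappa>') = \<kappa>'" using k'(1) by (auto simp: types_def mtype_rep)
      have "size \<kappa>' < size \<kappa>"
        using ncount_separate(2)[OF x \<kappa>(1), of "rep \<kappa>'"] k'(2,3) rep'
        unfolding \<mu>_def \<nu>_def by auto
      then show "residual \<kappa>' \<in> W" using k'(1) by (rule less.hyps)
    qed
  qed
qed

end

section \<open>Generation and minimality\<close>

lemma invertible_el_mult: "invertible_el x \<Longrightarrow> invertible_el y \<Longrightarrow> invertible_el (x * y)"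
  unfolding invertible_el_def by (metis mult.assoc mult.commute mult.right_neutral)

lemma invertible_el_dvd: "invertible_el x \<longleftrightarrow> x dvd 1"
  unfolding invertible_el_def dvd_def by (metis (full_types))

lemma invertible_el_multD: "invertible_el (x * y) \<Longrightarrow> invertible_el x"
  unfolding invertible_el_dvd by (rule dvd_mult_left)

text \<open>Cancelling an invertible prime factor leaves a smaller non-invertible number, and 1 is
  invertible.\<close>

lemma not_invertible_imp_PA:
  assumes "m > 0" "\<not> invertible_el (of_nat m :: 'a::comm_ring_1)"
  shows "\<exists>p\<in>PA TYPE('a). p dvd m"
  using assms
proof (induction m rule: less_induct)
  case (less m)
  have "m \<noteq> 1" using less.prems(2) by (auto simp: invertible_el_dvd)
  then obtain p where p: "prime p" "p dvd m" using prime_factor_nat by blast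
  show ?case
  proof (cases "p \<in> PA TYPE('a)")
    case False
    obtain n where n: "m = p * n" using p(2) by (rule dvdE)
    have inv: "invertible_el (of_nat p :: 'a)" using False p(1) by (simp add: PA_def)
    have "\<not> invertible_el (of_nat n :: 'a)"
      using less.prems(2) invertible_el_mult[OF inv] by (auto simp: n)
    moreover have "0 < n" "n < m" using less.prems(1) prime_gt_1_nat[OF p(1)] by (auto simp: n)
    ultimately obtain q where "q \<in> PA TYPE('a)" "q dvd n" using less.IH[of n] by blast
    then show ?thesis unfolding n by (blast intro: dvd_mult)
  qed (use p(2) in blast)
qed

lemma PA_not_dvd_invertible:
  "invertible_el (of_nat m :: 'a::comm_ring_1) \<Longrightarrow> p \<in> PA TYPE('a) \<Longrightarrow> \<not> p dvd m"
  unfolding PA_def by (auto elim!: dvdE dest: invertible_el_multD)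

lemma osum_empty: "osum d {#} = 1"
proof (rule poly_mapping_eqI)
  fix M :: mono
  have "M \<in> monoset d {#} \<longleftrightarrow> M = 0"
  proof
    assume "M \<in> monoset d {#}"
    then have "mtype M = {#}" by (simp add: monoset_def)
    from arg_cong[OF this, of size] have "msupp M = {}" by simp
    then show "M = 0" by (intro mono_eqI) (simp add: row_eq_0_iff row_0)
  qed (simp add: monoset_def)
  then show "lookup (osum d {#}) M = lookup 1 M"
    by (auto simp: lookup_osum lookup_one when_def)
qed

lemma smul_nz: "k > 0 \<Longrightarrow> x \<noteq> 0 \<Longrightarrow> smul k x \<noteq> 0"
  using exp_gcd_smul[of k x] by (metis exp_gcd_eq_0_iff mult_eq_0_iff neq0_conv)

lemma of_int_phi_cases:
  "of_int (phi \<kappa>) = (of_nat (orbit_coeff \<kappa>) :: 'a::comm_ring_1) \<or> of_int (phi \<kappa>) = - (of_nat (orbit_coeff \<kappa>) :: 'a)"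
  by (cases "even (size \<kappa>)") (auto simp: phi_def)

lemma size_units: "size (units \<beta>) = total_deg \<beta>"
  using div_sum_units[of 2 0 \<beta>] by (simp add: total_deg_def)

lemma osum_generated:
  fixes G :: "'a::comm_ring_1 tpoly set"
  assumes gen: "\<And>\<beta>. \<beta> \<noteq> 0 \<Longrightarrow> keys \<beta> \<subseteq> {..<r} \<Longrightarrow>
      \<exists>k f. k > 0 \<and> \<beta> = smul k f \<and> invertible_el (of_nat (exp_gcd f) :: 'a) \<and>
        (k \<le> d \<longrightarrow> osum d (replicate_mset k f) \<in> G \<or>
          (total_deg \<beta> > d \<and> (\<forall>p\<in>PA TYPE('a). pos_poly (Qp_idx p r (lookup \<beta>) - Qp p d))))"
  assumes "0 \<notin># \<kappa>" "keys (sum_mset \<kappa>) \<subseteq> {..<r}"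
  shows "osum d \<kappa> \<in> subalg G"
  using assms(2,3)
proof (induction "total_deg (sum_mset \<kappa>)" arbitrary: \<kappa> rule: less_induct)
  case less
  define \<beta> where "\<beta> = sum_mset \<kappa>"
  show ?case
  proof (cases "\<beta> = 0")
    case True
    then have "\<kappa> = {#}"
      using less.prems(1) by (metis \<beta>_def multiset_nonemptyE sum_mset_eq_0_iff')
    then show ?thesis using sa_const[of 1 G] by (simp add: osum_empty)
  next
    case False
    interpret decomposable "subalg G" d \<beta>
    proof
      fix \<mu> \<nu> :: "expo multiset"
      assume *: "\<mu> \<noteq> {#}" "\<nu> \<noteq> {#}" "0 \<notin># \<mu>" "0 \<notin># \<nu>" "sum_mset \<mu> + sum_mset \<nu> = \<beta>"
      have pos: "total_deg (sum_mset A) > 0" if "A \<noteq> {#}" "0 \<notin># A" for A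
        using that size_le_total_deg[of A] by (metis gr_zeroI le_zero_eq size_eq_0_iff_empty)
      have "total_deg \<beta> = total_deg (sum_mset \<mu>) + total_deg (sum_mset \<nu>)" by (simp add: total_deg_add flip: *(5))
      moreover have "keys (sum_mset \<mu>) \<subseteq> {..<r}" "keys (sum_mset \<nu>) \<subseteq> {..<r}"
        using less.prems(2) unfolding \<beta>_def[symmetric] *(5)[symmetric] keys_subset_lessThan_iff
        by (auto simp: lookup_add)
      ultimately show "osum d \<mu> * osum d \<nu> \<in> subalg G"
        using * pos[of \<mu>] pos[of \<nu>] by (intro sa_mult less.hyps) (auto simp: \<beta>_def)
    qed (use False in \<open>auto intro: sa_add subalg_const_mult subalg_0\<close>)
    have ktypes: "\<kappa> \<in> types \<beta>" using less.prems(1) by (simp add: types_def \<beta>_def)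
    have keys\<beta>: "keys \<beta> \<subseteq> {..<r}" using less.prems(2) by (simp add: \<beta>_def)
    \<comment> \<open>The integer multipliers that bring \<open>osum d E\<close> into the
      subalgebra. They form an ideal of the integers, which has a single generator and can be tested
      at primes.\<close>
    define Z where "Z = {z. const_tp (of_int z :: 'a) * osum d E \<in> subalg G}"
    have Z_mult: "z * y \<in> Z" if "z \<in> Z" for z y
      using subalg_const_mult[of "const_tp (of_int z :: 'a) * osum d E" G "of_int y"] that
      by (simp add: Z_def const_tp_mult mult_ac)
    have Z_diff: "z - y \<in> Z" if "z \<in> Z" "y \<in> Z" for z y
      using subalg_diff[of "const_tp (of_int z :: 'a) * osum d E" G "const_tp (of_int y :: 'a) * osum d E"] that
      by (simp add: Z_def const_tp_def single_diff left_diff_distrib)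
    have Z_phi: "phi \<kappa>' \<in> Z" if "\<kappa>' \<in> types \<beta>" "osum d \<kappa>' \<in> subalg G" for \<kappa>'
    proof -
      have "const_tp (of_int (phi \<kappa>' * phi E) :: 'a) * osum d E = osum d \<kappa>' - residual \<kappa>'"
        by (simp add: residual_def)
      also have "\<dots> \<in> subalg G" using that residual_in by (intro subalg_diff)
      finally have "phi \<kappa>' * phi E * phi E \<in> Z" by (intro Z_mult[of "phi \<kappa>' * phi E"]) (simp add: Z_def)
      then show ?thesis by (simp add: mult.assoc phi_E)
    qed
    have Z_orbit_coeff: "int (orbit_coeff \<kappa>') \<in> Z" if "\<kappa>' \<in> types \<beta>" "osum d \<kappa>' \<in> subalg G" for \<kappa>'
      using Z_mult[OF Z_phi[OF that], of "(- 1) ^ size \<kappa>'"] by (simp add: phi_def mult_ac)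
    have Z_invertible: "osum d E \<in> subalg G" if "int m \<in> Z" "invertible_el (of_nat m :: 'a)" for m
    proof -
      obtain y where y: "of_nat m * y = (1 :: 'a)" using \<open>invertible_el _\<close> by (auto simp: invertible_el_def)
      have "const_tp y * (const_tp (of_int (int m)) * osum d E) \<in> subalg G"
        using that(1) by (intro subalg_const_mult[of "const_tp (of_int (int m)) * osum d E"]) (simp add: Z_def)
      moreover have "const_tp y * const_tp (of_int (int m) :: 'a) = 1"
        using y by (simp add: mult.commute flip: const_tp_mult)
      ultimately show ?thesis by (simp only: mult.assoc[symmetric] mult_1)
    qed
    have "osum d E \<in> subalg G"
    proof -
      obtain k g where g: "k > 0" "\<beta> = smul k g" "invertible_el (of_nat (exp_gcd g) :: 'a)"
        "k \<le> d \<longrightarrow> osum d (replicate_mset k g) \<in> G \<or>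
          (total_deg \<beta> > d \<and> (\<forall>p\<in>PA TYPE('a). pos_poly (Qp_idx p r (lookup \<beta>) - Qp p d)))"
        using gen[OF False keys\<beta>] by blast
      have "g \<noteq> 0"
      proof
        assume "g = 0"
        then have "\<beta> = 0" unfolding g(2) by (intro poly_mapping_eqI) simp
        with False show False ..
      qed
      have "replicate_mset k g \<in> types \<beta>"
        using \<open>g \<noteq> 0\<close> by (simp add: types_def sum_mset_replicate g(2) del: sum_mset_replicate_mset)
      consider "osum d (replicate_mset k g) \<in> subalg G"
        | "total_deg \<beta> > d" "\<forall>p\<in>PA TYPE('a). pos_poly (Qp_idx p r (lookup \<beta>) - Qp p d)"
      proof (cases "k \<le> d")
        case False
        \<comment> \<open>Type and generator do not fit into d factors, so the orbit sum is zero and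
          lies in every subalgebra.\<close>
        then have "osum d (replicate_mset k g) = (0 :: 'a tpoly)" by (simp add: osum_eq_0)
        then show ?thesis using that subalg_0[of G] by simp
      qed (use g(4) that sa_gen in blast)
      then show ?thesis
      proof cases
        case 1
        have "int (orbit_coeff (replicate_mset k g)) \<in> Z"
          using \<open>replicate_mset k g \<in> types \<beta>\<close> 1 by (rule Z_orbit_coeff)
        then show ?thesis
          using g(1,3) \<open>g \<noteq> 0\<close> by (intro Z_invertible[of "exp_gcd g"]) (simp_all add: orbit_coeff_replicate_mset)
      next
        case 2
        have big: "int (orbit_coeff \<kappa>') \<in> Z" "orbit_coeff \<kappa>' > 0" if "\<kappa>' \<in> types \<beta>" "size \<kappa>' > d" for \<kappa>'
        proof -
          have "osum d \<kappa>' = (0 :: 'a tpoly)" using that(2) by (rule osum_eq_0)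
          then show "int (orbit_coeff \<kappa>') \<in> Z" using that(1) by (intro Z_orbit_coeff) (auto intro: subalg_0)
          show "orbit_coeff \<kappa>' > 0" using that(1) False by (intro orbit_coeff_pos) (auto simp: types_def)
        qed
        define m where "m = (LEAST m. m > 0 \<and> int m \<in> Z)"
        \<comment> \<open>The finest multiset has size \<open>total_deg \<beta>\<close> > d, so the
          ideal contains a positive integer and m exists.\<close>
        have "units \<beta> \<in> types \<beta>" by (simp add: types_def zero_notin_units sum_mset_units)
        then have ex: "\<exists>m. m > 0 \<and> int m \<in> Z" using big[of "units \<beta>"] 2(1) by (auto simp: size_units)
        have m: "m > 0" "int m \<in> Z" using LeastI_ex[OF ex] by (auto simp: m_def)
        have dvd: "m dvd n" if "int n \<in> Z" for n
        proof -
          have "int (n mod m) = int n - int m * int (n div m)"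
            by (simp add: minus_mult_div_eq_mod[symmetric] zmod_int zdiv_int)
          also have "\<dots> \<in> Z" using that m(2) by (intro Z_diff Z_mult)
          finally have "\<not> n mod m > 0"
            using not_less_Least[of "n mod m" "\<lambda>m. m > 0 \<and> int m \<in> Z"] m(1) by (auto simp: m_def[symmetric])
          then show ?thesis by (simp add: dvd_eq_mod_eq_0)
        qed
        \<comment> \<open>Orbit sums of size above d are zero, so m divides all their coefficients;
          by the digit condition no non-invertible prime divides all of them.\<close>
        have "invertible_el (of_nat m :: 'a)"
        proof (rule ccontr)
          assume "\<not> invertible_el (of_nat m :: 'a)"
          then obtain p where p: "p \<in> PA TYPE('a)" "p dvd m"
            using not_invertible_imp_PA[OF m(1)] by blast
          have "prime p" using p(1) by (simp add: PA_def)
          obtain \<kappa>' where k': "0 \<notin># \<kappa>'" "sum_mset \<kappa>' = \<beta>" "d < size \<kappa>'" "tight p \<kappa>'"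
            using exists_tight[OF \<open>prime p\<close> keys\<beta>] 2(2) p(1) by blast
          have "\<kappa>' \<in> types \<beta>" using k' by (simp add: types_def)
          have "\<not> p dvd orbit_coeff \<kappa>'"
            using not_dvd_orbit_coeff_iff[OF \<open>prime p\<close>, of \<kappa>'] k' False by simp
          moreover have "m dvd orbit_coeff \<kappa>'" using big(1)[OF \<open>\<kappa>' \<in> types \<beta>\<close> k'(3)] by (rule dvd)
          ultimately show False using p(2) dvd_trans by blast
        qed
        with m(2) show ?thesis by (rule Z_invertible)
      qed
    qed
    moreover have "osum d \<kappa> = residual \<kappa> + const_tp (of_int (phi \<kappa> * phi E)) * osum d E"
      by (simp add: residual_def)
    ultimately show ?thesis
      using residual_in[OF ktypes] by (simp add: sa_add subalg_const_mult)
  qed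
qed

lemma TS_generated:
  fixes G :: "'a::comm_ring_1 tpoly set"
  assumes "\<And>\<kappa>. 0 \<notin># \<kappa> \<Longrightarrow> keys (sum_mset \<kappa>) \<subseteq> {..<r} \<Longrightarrow> osum d \<kappa> \<in> subalg G"
    and "F \<in> TS d r"
  shows "F \<in> subalg G"
proof -
  have "(\<Sum>\<kappa>\<in>mtype ` keys F. const_tp (lookup F (rep \<kappa>)) * osum d \<kappa>) \<in> subalg G"
    using assms(2) by (intro subalg_sum subalg_const_mult assms(1)) (auto simp: TS_iff)
  then show ?thesis using TS_expansion[OF assms(2)] by simp
qed

section \<open>The functional that detects a missing generator\<close>

text \<open>The linear functional with value \<open>phi \<kappa>\<close> on orbit sums of degree
  \<beta> and zero in other degrees, restricted to the types that occur in d factors.\<close>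

definition Phi :: "nat \<Rightarrow> expo \<Rightarrow> 'a::comm_ring_1 tpoly \<Rightarrow> 'a" where
  "Phi d \<beta> F = (\<Sum>\<kappa>\<in>{\<kappa> \<in> types \<beta>. size \<kappa> \<le> d}. of_int (phi \<kappa>) * lookup F (rep \<kappa>))"

lemma Phi_add: "Phi d \<beta> (F + G) = Phi d \<beta> F + Phi d \<beta> G"
  by (simp add: Phi_def lookup_add distrib_left sum.distrib)

lemma Phi_const_mult: "Phi d \<beta> (const_tp a * F) = a * Phi d \<beta> F"
  by (simp add: Phi_def lookup_const_mult sum_distrib_left mult.left_commute)

lemma Phi_sum: "Phi d \<beta> (sum g A) = (\<Sum>x\<in>A. Phi d \<beta> (g x))"
  by (simp add: Phi_def lookup_sum sum_distrib_left) (rule sum.swap)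

lemma Phi_const:
  assumes "\<beta> \<noteq> 0"
  shows "Phi d \<beta> (const_tp a) = 0"
  unfolding Phi_def
proof (rule sum.neutral, rule ballI)
  fix \<kappa> assume "\<kappa> \<in> {\<kappa> \<in> types \<beta>. size \<kappa> \<le> d}"
  then have "0 \<notin># \<kappa>" "\<kappa> \<noteq> {#}" using assms by (auto simp: types_def)
  then have "rep \<kappa> \<noteq> 0" using mtype_rep by fastforce
  then show "of_int (phi \<kappa>) * lookup (const_tp a) (rep \<kappa>) = 0"
    by (simp add: const_tp_def lookup_single when_def)
qed

lemma rep_support: "0 \<notin># \<kappa> \<Longrightarrow> msupp (rep \<kappa>) \<subseteq> {..<d} \<longleftrightarrow> size \<kappa> \<le> d"
  by (auto simp: msupp_rep)

lemma Phi_osum: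
  assumes "0 \<notin># \<kappa>" "size \<kappa> \<le> d"
  shows "Phi d \<beta> (osum d \<kappa>) = (if sum_mset \<kappa> = \<beta> then of_int (phi \<kappa>) else (0 :: 'a::comm_ring_1))"
proof -
  have "Phi d \<beta> (osum d \<kappa>) = (\<Sum>\<kappa>'\<in>{\<kappa> \<in> types \<beta>. size \<kappa> \<le> d}. if \<kappa>' = \<kappa> then of_int (phi \<kappa>) else (0 :: 'a))"
    unfolding Phi_def
  proof (rule sum.cong[OF refl])
    fix \<kappa>' assume "\<kappa>' \<in> {\<kappa> \<in> types \<beta>. size \<kappa> \<le> d}"
    then have "0 \<notin># \<kappa>'" "size \<kappa>' \<le> d" by (auto simp: types_def)
    then show "of_int (phi \<kappa>') * lookup (osum d \<kappa>) (rep \<kappa>') = (if \<kappa>' = \<kappa> then of_int (phi \<kappa>) else (0 :: 'a))"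
      by (simp add: lookup_osum monoset_def mtype_rep rep_support)
  qed
  also have "\<dots> = (if \<kappa> \<in> types \<beta> then of_int (phi \<kappa>) else 0)"
    using assms(2) by simp
  finally show ?thesis using assms(1) by (simp add: types_def)
qed

text \<open>By \<open>phi_relation\<close> the sum over all types of degree \<beta> is zero. The
  truncated sum is minus the part of size above d, each term of which q divides.\<close>

lemma Phi_osum_mult:
  assumes q: "\<And>\<kappa>. \<kappa> \<in> types \<beta> \<Longrightarrow> size \<kappa> > d \<Longrightarrow> q dvd orbit_coeff \<kappa>"
    and "\<mu> \<noteq> {#}" "\<nu> \<noteq> {#}" "0 \<notin># \<mu>" "0 \<notin># \<nu>"
  shows "of_nat q dvd Phi d \<beta> (osum d \<mu> * osum d \<nu> :: 'a::comm_ring_1 tpoly)"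
proof -
  let ?h = "\<lambda>\<kappa>. phi \<kappa> * int (ncount \<mu> \<nu> (rep \<kappa>))"
  let ?S = "{\<kappa> \<in> types \<beta>. size \<kappa> \<le> d}"
  have "Phi d \<beta> (osum d \<mu> * osum d \<nu> :: 'a tpoly) = (\<Sum>\<kappa>\<in>?S. of_int (?h \<kappa>))"
    unfolding Phi_def
  proof (rule sum.cong[OF refl])
    fix \<kappa> assume "\<kappa> \<in> ?S"
    then have "0 \<notin># \<kappa>" "size \<kappa> \<le> d" by (auto simp: types_def)
    then show "of_int (phi \<kappa>) * lookup (osum d \<mu> * osum d \<nu>) (rep \<kappa>) = (of_int (?h \<kappa>) :: 'a)"
      by (simp add: lookup_osum_mult rep_support)
  qed
  then have eq: "Phi d \<beta> (osum d \<mu> * osum d \<nu> :: 'a tpoly) = of_int (\<Sum>\<kappa>\<in>?S. ?h \<kappa>)" by simp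
  have "int q dvd (\<Sum>\<kappa>\<in>?S. ?h \<kappa>)"
  proof (cases "sum_mset \<mu> + sum_mset \<nu> = \<beta>")
    case True
    have "(\<Sum>\<kappa>\<in>types \<beta>. ?h \<kappa>) = 0"
      using phi_relation[OF assms(2-5) True] by (simp add: mult.commute)
    moreover have "(\<Sum>\<kappa>\<in>types \<beta>. ?h \<kappa>) = (\<Sum>\<kappa>\<in>?S. ?h \<kappa>) + (\<Sum>\<kappa>\<in>types \<beta> - ?S. ?h \<kappa>)"
      by (subst sum.subset_diff[of ?S "types \<beta>"]) (auto simp: add.commute)
    moreover have "int q dvd (\<Sum>\<kappa>\<in>types \<beta> - ?S. ?h \<kappa>)"
      by (rule dvd_sum) (use q in \<open>auto simp: phi_def\<close>)
    ultimately show ?thesis using dvd_add_left_iff[of "int q" "\<Sum>\<kappa>\<in>types \<beta> - ?S. ?h \<kappa>" "\<Sum>\<kappa>\<in>?S. ?h \<kappa>"] by simp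
  next
    case False
    have "?h \<kappa> = 0" if "\<kappa> \<in> ?S" for \<kappa>
    proof -
      have "sum_mset (mtype (rep \<kappa>)) = \<beta>" using that by (auto simp: types_def mtype_rep)
      then have "ncount \<mu> \<nu> (rep \<kappa>) = 0" using False by (intro ncount_eq_0_degree) auto
      then show ?thesis by simp
    qed
    then have "(\<Sum>\<kappa>\<in>?S. ?h \<kappa>) = 0" by (intro sum.neutral) blast
    then show ?thesis by (simp only: dvd_0_right)
  qed
  then obtain z where "(\<Sum>\<kappa>\<in>?S. ?h \<kappa>) = int q * z" by (rule dvdE)
  then have "Phi d \<beta> (osum d \<mu> * osum d \<nu> :: 'a tpoly) = of_nat q * of_int z"
    unfolding eq by (simp only: of_int_mult of_int_of_nat_eq)
  then show ?thesis by (rule dvdI)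
qed

text \<open>Zero constant terms exclude the empty type from both expansions, so
  \<open>Phi_osum_mult\<close> applies to every pair of types.\<close>

lemma Phi_mult:
  fixes F G :: "'a::comm_ring_1 tpoly"
  assumes q: "\<And>\<kappa>. \<kappa> \<in> types \<beta> \<Longrightarrow> size \<kappa> > d \<Longrightarrow> q dvd orbit_coeff \<kappa>"
    and "F \<in> TS d r" "G \<in> TS d r" "lookup F 0 = 0" "lookup G 0 = 0"
  shows "of_nat q dvd Phi d \<beta> (F * G)"
proof -
  have nonempty: "\<mu> \<noteq> {#}" if H: "\<mu> \<in> mtype ` keys H" "lookup H 0 = 0" for H :: "'a tpoly" and \<mu>
  proof
    assume "\<mu> = {#}"
    then obtain M where M: "M \<in> keys H" "mtype M = {#}" using H(1) by auto
    have "msupp M = {}" using arg_cong[OF M(2), of size] by simp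
    then have "M = 0" by (intro mono_eqI) (simp add: row_eq_0_iff row_0)
    with M(1) H(2) show False by (simp add: in_keys_iff)
  qed
  have "F * G = (\<Sum>\<mu>\<in>mtype ` keys F. const_tp (lookup F (rep \<mu>)) * osum d \<mu>) *
      (\<Sum>\<nu>\<in>mtype ` keys G. const_tp (lookup G (rep \<nu>)) * osum d \<nu>)"
    using TS_expansion[OF assms(2)] TS_expansion[OF assms(3)] by simp
  also have "\<dots> = (\<Sum>\<mu>\<in>mtype ` keys F. \<Sum>\<nu>\<in>mtype ` keys G.
      const_tp (lookup F (rep \<mu>) * lookup G (rep \<nu>)) * (osum d \<mu> * osum d \<nu>))"
    by (simp add: sum_product const_tp_mult mult_ac)
  finally have eq: "Phi d \<beta> (F * G) = (\<Sum>\<mu>\<in>mtype ` keys F. \<Sum>\<nu>\<in>mtype ` keys G.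
      lookup F (rep \<mu>) * lookup G (rep \<nu>) * Phi d \<beta> (osum d \<mu> * osum d \<nu>))"
    by (simp only: Phi_sum Phi_const_mult)
  show ?thesis
    unfolding eq
  proof (intro dvd_sum dvd_mult Phi_osum_mult q)
    fix \<mu> \<nu> assume *: "\<mu> \<in> mtype ` keys F" "\<nu> \<in> mtype ` keys G"
    show "\<mu> \<noteq> {#}" "\<nu> \<noteq> {#}" using nonempty[OF *(1) assms(4)] nonempty[OF *(2) assms(5)] by auto
    show "0 \<notin># \<mu>" "0 \<notin># \<nu>" using * by auto
  qed
qed

text \<open>Only products of elements without constant term are controlled by
  \<open>Phi_mult\<close>. Splitting off constants gives F G = F' G' + a G' + c F' + a c, where the
  outer terms follow from linearity and the induction hypotheses.\<close>

lemma Phi_subalg: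
  fixes S :: "'a::comm_ring_1 tpoly set"
  assumes q: "\<And>\<kappa>. \<kappa> \<in> types \<beta> \<Longrightarrow> size \<kappa> > d \<Longrightarrow> q dvd orbit_coeff \<kappa>"
    and "\<beta> \<noteq> 0" "S \<subseteq> TS d r" "\<And>h. h \<in> S \<Longrightarrow> of_nat q dvd Phi d \<beta> h" "F \<in> subalg S"
  shows "of_nat q dvd Phi d \<beta> F"
  using assms(5)
proof induction
  case (sa_mult F G)
  define a where "a = lookup F 0"
  define c where "c = lookup G 0"
  define F' where "F' = F + const_tp (- a)"
  define G' where "G' = G + const_tp (- c)"
  have TS: "F' \<in> TS d r" "G' \<in> TS d r"
    unfolding F'_def G'_def using sa_mult.hyps assms(3)
    by (auto intro!: TS_add const_tp_TS dest: subalg_subset_TS)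
  have 0: "lookup F' 0 = 0" "lookup G' 0 = 0"
    by (simp_all add: F'_def G'_def a_def c_def const_tp_def lookup_add)
  have FG: "F = F' + const_tp a" "G = G' + const_tp c"
    by (simp_all add: F'_def G'_def const_tp_uminus)
  have "F * G = F' * G' + const_tp a * G' + const_tp c * F' + const_tp (a * c)"
    unfolding FG by (simp add: const_tp_mult algebra_simps)
  then have "Phi d \<beta> (F * G) = Phi d \<beta> (F' * G') + a * Phi d \<beta> G' + c * Phi d \<beta> F'"
    by (simp add: Phi_add Phi_const_mult Phi_const assms(2))
  moreover have "Phi d \<beta> F' = Phi d \<beta> F" "Phi d \<beta> G' = Phi d \<beta> G"
    unfolding F'_def G'_def by (simp_all add: Phi_add Phi_const assms(2))
  ultimately show ?case
    using sa_mult.IH Phi_mult[OF q TS 0] by (simp add: dvd_add dvd_mult)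
qed (auto simp: Phi_const assms(2,4) Phi_add)

section \<open>Each collection has at most one pair in every degree\<close>

lemma mvec_lookup: "keys f \<subseteq> {..<r} \<Longrightarrow> mvec r (lookup f) = f"
  by (rule poly_mapping_eqI) (auto simp: lookup_mvec keys_subset_lessThan_iff)

lemma lookup_mvec_multiidx: "multiidx r \<alpha> \<Longrightarrow> lookup (mvec r \<alpha>) = \<alpha>"
  by (auto simp: fun_eq_iff lookup_mvec multiidx_def)

lemma exp_gcd_eq_gcdidx: "multiidx r (lookup f) \<Longrightarrow> gcdidx r (lookup f) = exp_gcd f"
proof (rule dvd_antisym)
  assume m: "multiidx r (lookup f)"
  have "gcdidx r (lookup f) dvd lookup f i" for i
    by (cases "i < r") (use m in \<open>auto simp: gcdidx_def multiidx_def\<close>)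
  then show "gcdidx r (lookup f) dvd exp_gcd f" by (simp add: dvd_exp_gcd_iff)
  show "exp_gcd f dvd gcdidx r (lookup f)"
    by (auto simp: gcdidx_def dvd_Gcd_iff exp_gcd_dvd_lookup)
qed

lemma absidx_eq_total_deg: "keys f \<subseteq> {..<r} \<Longrightarrow> absidx r (lookup f) = total_deg f"
  unfolding absidx_def total_deg_def by (rule sum.mono_neutral_right) (auto simp: in_keys_iff)

lemma keys_iff_multiidx: "keys f \<subseteq> {..<r} \<longleftrightarrow> multiidx r (lookup f)"
  unfolding keys_subset_lessThan_iff multiidx_def by (metis not_less)

lemma nonconst_iff: "nonconst r (lookup f) \<longleftrightarrow> keys f \<subseteq> {..<r} \<and> f \<noteq> 0"
  unfolding nonconst_def keys_iff_multiidx[symmetric]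
  by (auto simp: keys_subset_lessThan_iff poly_mapping_eq_iff fun_eq_iff)

lemma total_deg_smul: "total_deg (smul k f) = k * total_deg f"
proof (cases "k = 0")
  case False
  then have "keys (smul k f) = keys f" by (auto simp: in_keys_iff)
  then show ?thesis by (simp add: total_deg_def sum_distrib_left)
qed (simp add: total_deg_def)

text \<open>For n > 0, the largest divisor of n all of whose prime factors are non-invertible in
  A.\<close>

definition PA_part :: "'a::comm_ring_1 itself \<Rightarrow> nat \<Rightarrow> nat" where
  "PA_part T n = prod_mset (filter_mset (\<lambda>p. p \<in> PA T) (prime_factorization n))"

text \<open>The prime factors of k are non-invertible in A and those of g are invertible, so the
  product k g determines k.\<close>

lemma PA_part_unique:
  assumes "prod_of_PA TYPE('a::comm_ring_1) k" "invertible_el (of_nat g :: 'a)" "g > 0"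
  shows "PA_part TYPE('a) (k * g) = k"
proof -
  obtain M where M: "\<forall>p\<in>#M. p \<in> PA TYPE('a)" "k = prod_mset M"
    using assms(1) by (auto simp: prod_of_PA_def)
  have prime: "prime p" if "p \<in># M" for p using M(1) that by (auto simp: PA_def)
  then have "k \<noteq> 0" using prime[of 0] unfolding M(2) by auto
  have pf: "prime_factorization k = M"
    unfolding M(2) using prime by (rule prime_factorization_prod_mset_primes)
  have "filter_mset (\<lambda>p. p \<in> PA TYPE('a)) (prime_factorization g) = {#}"
    using PA_not_dvd_invertible[OF assms(2)] by (auto simp: in_prime_factors_iff)
  moreover have "filter_mset (\<lambda>p. p \<in> PA TYPE('a)) M = M"
    using M(1) by (intro filter_mset_eq_conv[THEN iffD2]) auto
  ultimately show ?thesis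
    using assms(3) \<open>k \<noteq> 0\<close>
    by (simp only: PA_part_def prime_factorization_mult neq0_conv[symmetric] pf filter_union_mset
      add_0_right M(2)[symmetric] not_False_eq_True)
qed

lemma PA_part_decomp:
  assumes "n > 0"
  obtains g where "n = PA_part TYPE('a::comm_ring_1) n * g" "invertible_el (of_nat g :: 'a)"
    "prod_of_PA TYPE('a) (PA_part TYPE('a) n)" "PA_part TYPE('a) n > 0"
proof -
  define N where "N = filter_mset (\<lambda>p. \<not> p \<in> PA TYPE('a)) (prime_factorization n)"
  have prime: "prime p" if "p \<in># N" for p using that by (auto simp: N_def)
  have "n = prod_mset (prime_factorization n)" using assms by (simp add: prod_mset_prime_factorization_nat)
  also have "prime_factorization n = filter_mset (\<lambda>p. p \<in> PA TYPE('a)) (prime_factorization n) + N"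
    unfolding N_def by (rule multiset_partition)
  finally have n: "n = PA_part TYPE('a) n * prod_mset N" by (simp add: PA_part_def)
  have "invertible_el (of_nat (prod_mset N) :: 'a)"
  proof (rule ccontr)
    assume "\<not> ?thesis"
    moreover have "prod_mset N > 0" using n assms by (metis mult_0_right neq0_conv)
    ultimately obtain p where p: "p \<in> PA TYPE('a)" "p dvd prod_mset N"
      using not_invertible_imp_PA by blast
    have "prime p" using p(1) by (simp add: PA_def)
    with p(2) obtain q where "q \<in># N" "p dvd q" using prime_dvd_prod_mset_iff by blast
    then have "p = q" using prime \<open>prime p\<close> primes_dvd_imp_eq by blast
    with \<open>q \<in># N\<close> p(1) show False by (simp add: N_def)
  qed
  moreover have "prod_of_PA TYPE('a) (PA_part TYPE('a) n)"
    unfolding prod_of_PA_def PA_part_def by (intro exI[of _ "filter_mset (\<lambda>p. p \<in> PA TYPE('a)) (prime_factorization n)"]) auto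
  moreover have "PA_part TYPE('a) n > 0" using n assms by (metis mult_0 neq0_conv)
  ultimately show thesis using n that by blast
qed

text \<open>The gcd of \<beta> is written as k times an invertible g: for \<open>C2\<close> with g =
  1, for \<open>C1\<close> with k its part made of non-invertible primes. Then f = \<beta>/k has gcd
  g. Membership is claimed for k \<le> d only, since the collections contain no larger k.\<close>

lemma C_exists:
  assumes "C = C1 TYPE('a::comm_ring_1) d r \<or> C = C2 d r" "\<beta> \<noteq> 0" "keys \<beta> \<subseteq> {..<r}"
  obtains k f where "k > 0" "\<beta> = smul k f" "invertible_el (of_nat (exp_gcd f) :: 'a)"
    "k \<le> d \<Longrightarrow> (k, lookup f) \<in> C"
proof -
  note result = that
  have b: "exp_gcd \<beta> > 0" using assms(2) by (auto intro: Nat.gr0I)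
  have main: thesis if kg: "exp_gcd \<beta> = k * g" "k > 0" "invertible_el (of_nat g :: 'a)"
    and C: "\<And>f. k \<le> d \<Longrightarrow> nonconst r f \<Longrightarrow> gcdidx r f = g \<Longrightarrow> (k, f) \<in> C" for k g
  proof -
    define f where "f = sdiv \<beta> k"
    have \<beta>: "\<beta> = smul k f" unfolding f_def using kg(1) by (subst smul_sdiv) auto
    have bf: "exp_gcd f = g" using kg(1,2) unfolding \<beta> exp_gcd_smul by simp
    have "f \<noteq> 0" using assms(2) unfolding \<beta> by (auto simp: poly_mapping_eq_iff fun_eq_iff)
    have keysf: "keys f \<subseteq> {..<r}"
      using assms(3) kg(2) unfolding \<beta> keys_subset_lessThan_iff by auto
    show thesis
    proof (rule result[OF kg(2) \<beta>])
      show "invertible_el (of_nat (exp_gcd f) :: 'a)" using kg(3) by (simp add: bf)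
      show "(k, lookup f) \<in> C" if "k \<le> d"
        using that keysf \<open>f \<noteq> 0\<close>
        by (intro C) (auto simp: nonconst_iff keys_iff_multiidx exp_gcd_eq_gcdidx bf)
    qed
  qed
  show thesis
    using assms(1)
  proof
    assume C: "C = C1 TYPE('a) d r"
    obtain g where "exp_gcd \<beta> = PA_part TYPE('a) (exp_gcd \<beta>) * g" "invertible_el (of_nat g :: 'a)"
      "prod_of_PA TYPE('a) (PA_part TYPE('a) (exp_gcd \<beta>))" "PA_part TYPE('a) (exp_gcd \<beta>) > 0"
      using PA_part_decomp[OF b] by blast
    then show thesis by (intro main[of "PA_part TYPE('a) (exp_gcd \<beta>)" g]) (auto simp: C C1_def)
  next
    assume C: "C = C2 d r"
    show thesis
      by (rule main[of "exp_gcd \<beta>" 1]) (use b in \<open>auto simp: C C2_def invertible_el_dvd\<close>)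
  qed
qed

lemma C_props:
  assumes "C = C1 TYPE('a::comm_ring_1) d r \<or> C = C2 d r" "(k, \<alpha>) \<in> C"
  shows "0 < k" "k \<le> d" "nonconst r \<alpha>" "invertible_el (of_nat (gcdidx r \<alpha>) :: 'a)"
  using assms by (auto simp: C1_def C2_def invertible_el_dvd)

text \<open>The gcd of the common degree determines k, through \<open>PA_part\<close> or because the
  gcd of f is 1, and division by k then gives f. Minimality rests on this: no second generator
  shares a degree.\<close>

lemma C_unique:
  assumes "C = C1 TYPE('a::comm_ring_1) d r \<or> C = C2 d r" "(k, lookup f) \<in> C" "(k', lookup f') \<in> C"
    "smul k f = smul k' f'"
  shows "k = k'" "f = f'"
proof -
  note p = C_props[OF assms(1,2)] and p' = C_props[OF assms(1,3)]
  have m: "multiidx r (lookup f)" "multiidx r (lookup f')" using p(3) p'(3) by (auto simp: nonconst_def)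
  have eq: "k * exp_gcd f = k' * exp_gcd f'" using arg_cong[OF assms(4), of exp_gcd] by (simp add: exp_gcd_smul)
  have pos: "exp_gcd f > 0" "exp_gcd f' > 0"
    using p(3) p'(3) by (auto simp: nonconst_iff intro!: Nat.gr0I)
  show "k = k'"
    using assms(1)
  proof
    assume C: "C = C1 TYPE('a) d r"
    have "prod_of_PA TYPE('a) k" "prod_of_PA TYPE('a) k'" using assms(2,3) by (auto simp: C C1_def)
    then have "PA_part TYPE('a) (k * exp_gcd f) = k" "PA_part TYPE('a) (k' * exp_gcd f') = k'"
      using p(4) p'(4) pos by (auto intro!: PA_part_unique simp: exp_gcd_eq_gcdidx m)
    with eq show ?thesis by simp
  next
    assume C: "C = C2 d r"
    have "exp_gcd f = 1" "exp_gcd f' = 1" using assms(2,3) m by (auto simp: C C2_def exp_gcd_eq_gcdidx)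
    with eq show ?thesis by simp
  qed
  then have "k * lookup f i = k * lookup f' i" for i
    using assms(4) by (metis lookup_smul)
  then show "f = f'" using p(1) by (intro poly_mapping_eqI) simp
qed

lemma Ctilde_iff:
  assumes "keys f \<subseteq> {..<r}"
  shows "(k, lookup f) \<in> Ctilde TYPE('a::comm_ring_1) d r C \<longleftrightarrow> (k, lookup f) \<in> C \<and>
    (total_deg (smul k f) \<le> d \<or> (\<exists>p\<in>PA TYPE('a). \<not> pos_poly (Qp_idx p r (lookup (smul k f)) - Qp p d)))"
proof -
  have "lookup (smul k f) = (\<lambda>i. k * lookup f i)" by auto
  then show ?thesis
    by (simp add: Ctilde_def absidx_eq_total_deg[OF assms] total_deg_smul poly_gt_iff_pos_poly)
qed

theorem theorem7p19:
  fixes d r :: nat and C :: "(nat \<times> (nat \<Rightarrow> nat)) set"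
  assumes "r \<ge> 1" and "d \<ge> 1"
    and "C = C1 TYPE('a::comm_ring_1) d r \<or> C = C2 d r"
  defines "G \<equiv> (\<lambda>(k, \<alpha>). gamma_gen d r k \<alpha> :: 'a tpoly) ` Ctilde TYPE('a) d r C"
  shows "subalg G = TS d r \<and> (\<forall>H. H \<subset> G \<longrightarrow> subalg H \<noteq> TS d r)"
proof -
  note C = assms(3)
  have gamma: "(gamma_gen d r k (lookup f) :: 'a tpoly) = osum d (replicate_mset k f)"
    if "nonconst r (lookup f)" for k f
    using that gamma_gen_eq_osum[of r "lookup f" d k] by (simp add: nonconst_iff mvec_lookup)
  have G_elem: "\<exists>k f. h = osum d (replicate_mset k f) \<and> (k, lookup f) \<in> Ctilde TYPE('a) d r C
      \<and> (k, lookup f) \<in> C \<and> keys f \<subseteq> {..<r} \<and> f \<noteq> 0" if hG: "h \<in> G" for h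
  proof -
    obtain k \<alpha> where h: "h = gamma_gen d r k \<alpha>" "(k, \<alpha>) \<in> Ctilde TYPE('a) d r C"
      using hG by (auto simp: G_def)
    then have "(k, \<alpha>) \<in> C" by (simp add: Ctilde_def)
    then have nc: "nonconst r \<alpha>" using C_props(3)[OF C] by blast
    then have \<alpha>: "lookup (mvec r \<alpha>) = \<alpha>" by (simp add: nonconst_def lookup_mvec_multiidx)
    show ?thesis
      using h nc \<open>(k, \<alpha>) \<in> C\<close> gamma[of "mvec r \<alpha>" k] nonconst_iff[of r "mvec r \<alpha>"]
      by (intro exI[of _ k] exI[of _ "mvec r \<alpha>"]) (simp add: \<alpha>)
  qed
  have smul_keys: "keys (smul k f) \<subseteq> {..<r}" if "keys f \<subseteq> {..<r}" for k f
    using that unfolding keys_subset_lessThan_iff by auto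
  have G_TS: "G \<subseteq> TS d r"
  proof
    fix h assume "h \<in> G"
    then obtain k f where "h = osum d (replicate_mset k f)" "keys f \<subseteq> {..<r}" using G_elem by blast
    with smul_keys[of f k] osum_TS[of "replicate_mset k f" r d] show "h \<in> TS d r"
      by (simp add: sum_mset_replicate del: sum_mset_replicate_mset)
  qed
  have "subalg G = TS d r"
  proof
    show "subalg G \<subseteq> TS d r" using subalg_subset_TS[OF G_TS] by blast
    show "TS d r \<subseteq> subalg G"
    proof
      fix F :: "'a tpoly" assume "F \<in> TS d r"
      then show "F \<in> subalg G"
      proof (rule TS_generated[rotated])
        fix \<kappa> :: "expo multiset" assume "0 \<notin># \<kappa>" "keys (sum_mset \<kappa>) \<subseteq> {..<r}"
        then show "osum d \<kappa> \<in> subalg G"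
        proof (rule osum_generated[rotated])
          fix \<beta> :: expo assume \<beta>: "\<beta> \<noteq> 0" "keys \<beta> \<subseteq> {..<r}"
          obtain k f where kf: "k > 0" "\<beta> = smul k f" "invertible_el (of_nat (exp_gcd f) :: 'a)"
            "k \<le> d \<Longrightarrow> (k, lookup f) \<in> C"
            using C_exists[OF C \<beta>] by blast
          have "osum d (replicate_mset k f) \<in> G \<or>
              (total_deg \<beta> > d \<and> (\<forall>p\<in>PA TYPE('a). pos_poly (Qp_idx p r (lookup \<beta>) - Qp p d)))" if "k \<le> d"
          proof (cases "(k, lookup f) \<in> Ctilde TYPE('a) d r C")
            case True
            have "nonconst r (lookup f)" using C_props(3)[OF C kf(4)[OF that]] .
            from gamma[OF this, of k] True have "osum d (replicate_mset k f) \<in> G"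
              unfolding G_def by (metis (no_types, lifting) case_prod_conv image_eqI)
            then show ?thesis ..
          next
            case False
            have "keys f \<subseteq> {..<r}" using C_props(3)[OF C kf(4)[OF that]] by (simp add: nonconst_iff)
            from Ctilde_iff[OF this, of k d C] False kf(4)[OF that] show ?thesis
              by (auto simp: kf(2))
          qed
          then show "\<exists>k f. k > 0 \<and> \<beta> = smul k f \<and> invertible_el (of_nat (exp_gcd f) :: 'a) \<and>
            (k \<le> d \<longrightarrow> osum d (replicate_mset k f) \<in> G \<or>
              (total_deg \<beta> > d \<and> (\<forall>p\<in>PA TYPE('a). pos_poly (Qp_idx p r (lookup \<beta>) - Qp p d))))"
            using kf(1-3) by blast
        qed
      qed
    qed
  qed
  moreover have "subalg H \<noteq> TS d r" if H: "H \<subset> G" for H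
  proof
    assume eq: "subalg H = TS d r"
    obtain h where h: "h \<in> G" "h \<notin> H" using H by blast
    obtain k f where kf: "h = osum d (replicate_mset k f)" "(k, lookup f) \<in> Ctilde TYPE('a) d r C"
      "(k, lookup f) \<in> C" "keys f \<subseteq> {..<r}" "f \<noteq> 0"
      using G_elem[OF h(1)] by blast
    define \<beta> where "\<beta> = smul k f"
    note k = C_props(1,2)[OF C kf(3)]
    have \<beta>: "\<beta> \<noteq> 0" "keys \<beta> \<subseteq> {..<r}" using k kf(5) smul_keys[OF kf(4)] by (simp_all add: \<beta>_def smul_nz)
    \<comment> \<open>A non-invertible integer that divides the truncation error: zero if no type
      exceeds d, where 0 is not invertible because 1 \<noteq> 0 in A, and otherwise the prime of the
      digit condition.\<close>
    obtain q :: nat where q: "\<not> invertible_el (of_nat q :: 'a)"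
      "\<And>\<kappa>. \<kappa> \<in> types \<beta> \<Longrightarrow> size \<kappa> > d \<Longrightarrow> q dvd orbit_coeff \<kappa>"
    proof (cases "total_deg \<beta> \<le> d")
      case True
      have "\<not> size \<kappa> > d" if "\<kappa> \<in> types \<beta>" for \<kappa>
        using that True size_le_total_deg[of \<kappa>] by (auto simp: types_def)
      then show ?thesis by (intro that[of 0]) (auto simp: invertible_el_dvd)
    next
      case False
      then obtain p where p: "p \<in> PA TYPE('a)" "\<not> pos_poly (Qp_idx p r (lookup \<beta>) - Qp p d)"
        using Ctilde_iff[OF kf(4), of k d C] kf(2) by (auto simp: \<beta>_def)
      have "prime p" "\<not> invertible_el (of_nat p :: 'a)" using p(1) by (auto simp: PA_def)
      moreover have "p dvd orbit_coeff \<kappa>" if "\<kappa> \<in> types \<beta>" "size \<kappa> > d" for \<kappa>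
      proof (rule ccontr)
        assume "\<not> p dvd orbit_coeff \<kappa>"
        then have "tight p \<kappa>"
          using not_dvd_orbit_coeff_iff[OF \<open>prime p\<close>, of \<kappa>] that(1) \<beta>(1) by (auto simp: types_def)
        then show False
          using tight_imp_pos_poly[OF \<open>prime p\<close>, of \<kappa> r d] that \<beta>(2) p(2) by (auto simp: types_def)
      qed
      ultimately show ?thesis by (intro that[of p])
    qed
    \<comment> \<open>By \<open>C_unique\<close> the remaining generators live in degrees other than
      \<beta>, where the functional is zero.\<close>
    have H_dvd: "of_nat q dvd Phi d \<beta> g" if g: "g \<in> H" for g
    proof -
      obtain k' f' where kf': "g = osum d (replicate_mset k' f')" "(k', lookup f') \<in> C" "f' \<noteq> 0"
        using G_elem[of g] g H by blast
      have "smul k' f' \<noteq> \<beta>"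
      proof
        assume "smul k' f' = \<beta>"
        from C_unique[OF C kf'(2) kf(3) this[unfolded \<beta>_def]] have "g = h" by (simp add: kf' kf(1))
        with g h(2) show False by simp
      qed
      then have "Phi d \<beta> g = 0"
        unfolding kf'(1) using C_props(2)[OF C kf'(2)] kf'(3)
        by (subst Phi_osum) (auto simp: sum_mset_replicate simp del: sum_mset_replicate_mset)
      then show ?thesis by simp
    qed
    have H_TS: "H \<subseteq> TS d r" and h_in: "h \<in> subalg H" using eq G_TS h(1) H by auto
    have "of_nat q dvd Phi d \<beta> h"
      by (rule Phi_subalg[OF q(2) \<beta>(1) H_TS H_dvd h_in])
    moreover have "Phi d \<beta> h = of_int (phi (replicate_mset k f))"
      unfolding kf(1) using k kf(5)
      by (subst Phi_osum) (auto simp: sum_mset_replicate \<beta>_def simp del: sum_mset_replicate_mset)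
    \<comment> \<open>Up to sign, the functional takes the value \<open>exp_gcd f\<close> on h. This
      is a unit of A, so q would have to be one as well.\<close>
    ultimately have "of_nat q dvd (of_nat (exp_gcd f) :: 'a)"
      using of_int_phi_cases[of "replicate_mset k f", where 'a = 'a]
      unfolding orbit_coeff_replicate_mset[OF k(1) kf(5)] by (metis dvd_minus_iff)
    moreover have "(of_nat (exp_gcd f) :: 'a) dvd 1"
      using C_props(4)[OF C kf(3)] kf(4)
      by (simp add: exp_gcd_eq_gcdidx keys_iff_multiidx invertible_el_dvd)
    ultimately show False using q(1) dvd_trans unfolding invertible_el_dvd by blast
  qed
  ultimately show ?thesis by blast
qed

end
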